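(* Let $G$ and $G^*$ be two finite groups that act freely and isometrically on spheres of some dimensions, with invariants (type, $g$, $a$, $\overline{G}$, and possibly $\overline{G}_0$) and (type$^*$, $g^*$, $a^*$, $\overline{G^*}$, and possibly $\overline{G^*}_0$) as defined in the context. Then $G$ and $G^*$ are isomorphic if and only if they have the same type, $g=g^*$, $a=a^*$, $\overline{G}=\overline{G^*}$, and (if they are defined) $\overline{G}_0=\overline{G^*}_0$.
   Context: Acting freely and isometrically on a sphere means having a free action by isometries on a round sphere $S^n$ for some $n$. Every finite group $G$ with such an action has one of the types (I)–(VI) below; the type is determined by $G$, and the subgroup $A$ is uniquely determined by $G$. Notation: $N:K$ is an internal semidirect product with normal subgroup $N$ and complement $K$; $X\times Y$ is an internal direct product; $H\cdot2$ is a group having $H$ as a normal subgroup with quotient $\mathbb{Z}/2$, nonsplit. Actions are by conjugation; an automorphism is outer if it is not inner. A quaternionic group is $Q_{2^m}=\langle x,y\mid x^{2^{m-1}}=1,\ yxy^{-1}=x^{-1},\ y^2=x^{2^{m-2}}\rangle$, $m\ge3$. $2A_5=\mathrm{SL}_2(\mathbb{F}_5)$ is the binary icosahedral group. Types. In every case $A,B$ are cyclic of odd coprime orders, every nontrivial Sylow subgroup of $B$ acts nontrivially on $A$, and every prime-order element of $B$ acts trivially on $A$. (I) $A:(B\times T)$, $T$ a cyclic $2$-group whose involution (if $T\ne1$) fixes $A$ pointwise. (II) $A:(B\times T)$, $T$ quaternionic. (III) $(Q_8\times A):(\Theta\times B)$, where $\Theta$ is a cyclic $3$-group acting nontrivially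 on $Q_8$ whose elements of order $3$ centralize $A$, and $|A|,|B|$ are prime to $3$. (IV) $\bigl((Q_8\times A):(\Theta\times B)\bigr)\cdot2$, with $\Theta,|A|,|B|$ as in (III), the quotient $\mathbb{Z}/2$ being the image of a subgroup $\Phi\cong\mathbb{Z}/4$ whose elements of order $4$ act by an outer automorphism on $Q_8$, by inversion on $\Theta$ and trivially on $B$. (V) $2A_5\times(A:B)$, with $|A|,|B|$ prime to $15$. (VI) $\bigl(2A_5\times(A:B)\bigr)\cdot2$, with $|A|,|B|$ prime to $15$, the quotient $\mathbb{Z}/2$ being the image of a subgroup $\Phi\cong\mathbb{Z}/4$ whose elements of order $4$ act by an outer automorphism on $2A_5$ and trivially on $B$. Invariants of $G$: its type; $g:=|G|$; $a:=|A|$; $\overline{G}$, the image of $G$ in $\mathrm{Aut}(A)$ under conjugation; and, only if $G$ has type (II) and $16$ divides $|G|$, also $\overline{G}_0$, the image in $\mathrm{Aut}(A)$ of $G_0$, where $G_0$ is the unique index $2$ subgroup of $G$ with cyclic Sylow $2$-subgroups. Using the canonical isomorphism $\mathrm{Aut}(A)\cong(\mathbb{Z}/a)^*$ (with $u\in(\mathbb{Z}/a)^*$ corresponding to the $u$th power map), $\overline{G}$ and $\overline{G}_0$ are regarded as subgroups of $(\mathbb{Z}/a)^*$. The invariants of $G^*$ are defined the same way, from its own subgroup $A^*$. *)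

theory Defs
  imports
    "HOL-Analysis.Analysis"
    "HOL-Algebra.Elementary_Groups"
    "HOL-Algebra.Group_Action"
    "HOL-Algebra.Multiplicative_Group"
    "HOL-Number_Theory.Totient"
begin

section \<open>Free isometric actions on round spheres\<close>

text \<open>
  The sphere \<open>S\<^sup>n\<close> is the underlying set of the library's \<^const>\<open>nsphere\<close>: the unit vectors of
  \<open>\<real>\<^sup>n\<^sup>+\<^sup>1\<close>, represented as functions \<^typ>\<open>nat \<Rightarrow> real\<close> vanishing outside \<open>{0..n}\<close>.  This keeps
  the dimension an ordinary natural number, so that it can be quantified over.  The round
  distance of two points is the angle between them.
\<close>

definition round_dist :: "nat \<Rightarrow> (nat \<Rightarrow> real) \<Rightarrow> (nat \<Rightarrow> real) \<Rightarrow> real" where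
  "round_dist n x y = arccos (\<Sum>i\<le>n. x i * y i)"

definition acts_freely_isometrically_on_sphere :: "('a, 'b) monoid_scheme \<Rightarrow> nat \<Rightarrow> bool" where
  "acts_freely_isometrically_on_sphere G n \<longleftrightarrow>
     (\<exists>\<phi>. group_action G (topspace (nsphere n)) \<phi> \<and>
          (\<forall>g\<in>carrier G. \<forall>x\<in>topspace (nsphere n). \<forall>y\<in>topspace (nsphere n).
             round_dist n (\<phi> g x) (\<phi> g y) = round_dist n x y) \<and>
          (\<forall>g\<in>carrier G. g \<noteq> \<one>\<^bsub>G\<^esub> \<longrightarrow> (\<forall>x\<in>topspace (nsphere n). \<phi> g x \<noteq> x)))"

section \<open>Group-theoretic vocabulary\<close>

text \<open>
  All groups occurring in the structure of \<open>G\<close> are subsets \<open>S\<close> of \<^term>\<open>carrier G\<close>; as groups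
  they are \<open>G\<lparr>carrier := S\<rparr>\<close>.  \<open>internal_semidirect G S N K\<close> says \<open>S = N : K\<close>, and
  \<open>internal_direct G S M N\<close> says \<open>S = M \<times> N\<close>.
\<close>

definition internal_semidirect ::
  "('a, 'b) monoid_scheme \<Rightarrow> 'a set \<Rightarrow> 'a set \<Rightarrow> 'a set \<Rightarrow> bool" where
  "internal_semidirect G S N K \<longleftrightarrow>
     subgroup S G \<and> N \<lhd> G\<lparr>carrier := S\<rparr> \<and> subgroup K (G\<lparr>carrier := S\<rparr>) \<and>
     N \<inter> K = {\<one>\<^bsub>G\<^esub>} \<and> N <#>\<^bsub>G\<^esub> K = S"

definition internal_direct ::
  "('a, 'b) monoid_scheme \<Rightarrow> 'a set \<Rightarrow> 'a set \<Rightarrow> 'a set \<Rightarrow> bool" where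
  "internal_direct G S M N \<longleftrightarrow>
     subgroup S G \<and> M \<lhd> G\<lparr>carrier := S\<rparr> \<and> N \<lhd> G\<lparr>carrier := S\<rparr> \<and>
     M \<inter> N = {\<one>\<^bsub>G\<^esub>} \<and> M <#>\<^bsub>G\<^esub> N = S"

definition conj_map :: "('a, 'b) monoid_scheme \<Rightarrow> 'a set \<Rightarrow> 'a \<Rightarrow> 'a \<Rightarrow> 'a" where
  "conj_map G N x = (\<lambda>n\<in>N. x \<otimes>\<^bsub>G\<^esub> n \<otimes>\<^bsub>G\<^esub> inv\<^bsub>G\<^esub> x)"

definition acts_trivially :: "('a, 'b) monoid_scheme \<Rightarrow> 'a \<Rightarrow> 'a set \<Rightarrow> bool" where
  "acts_trivially G x N \<longleftrightarrow> (\<forall>n\<in>N. conj_map G N x n = n)"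

definition acts_by_inversion :: "('a, 'b) monoid_scheme \<Rightarrow> 'a \<Rightarrow> 'a set \<Rightarrow> bool" where
  "acts_by_inversion G x N \<longleftrightarrow> (\<forall>n\<in>N. conj_map G N x n = inv\<^bsub>G\<^esub> n)"

definition acts_by_outer_auto :: "('a, 'b) monoid_scheme \<Rightarrow> 'a \<Rightarrow> 'a set \<Rightarrow> bool" where
  "acts_by_outer_auto G x N \<longleftrightarrow>
     conj_map G N x \<in> auto (G\<lparr>carrier := N\<rparr>) \<and> conj_map G N x \<notin> conj_map G N ` N"

definition is_sylow_of :: "('a, 'b) monoid_scheme \<Rightarrow> nat \<Rightarrow> 'a set \<Rightarrow> 'a set \<Rightarrow> bool" where
  "is_sylow_of G p P S \<longleftrightarrow>
     Factorial_Ring.prime p \<and> subgroup P (G\<lparr>carrier := S\<rparr>) \<and> card P = p ^ multiplicity p (card S)"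

text \<open>
  \<open>Q\<close> with \<open>q = 2\<^sup>m\<close>: the presented group has order \<open>2\<^sup>m\<close>, so a group is isomorphic to it
  iff it has that order and is generated by elements satisfying the relations.
\<close>

definition is_quaternionic :: "nat \<Rightarrow> ('a, 'b) monoid_scheme \<Rightarrow> bool" where
  "is_quaternionic q K \<longleftrightarrow>
     group K \<and> order K = q \<and>
     (\<exists>m\<ge>3. q = 2 ^ m \<and>
       (\<exists>x\<in>carrier K. \<exists>y\<in>carrier K.
          generate K {x, y} = carrier K \<and>
          x [^]\<^bsub>K\<^esub> ((2::nat) ^ (m - 1)) = \<one>\<^bsub>K\<^esub> \<and>
          y \<otimes>\<^bsub>K\<^esub> x \<otimes>\<^bsub>K\<^esub> inv\<^bsub>K\<^esub> y = inv\<^bsub>K\<^esub> x \<and>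
          y [^]\<^bsub>K\<^esub> (2::nat) = x [^]\<^bsub>K\<^esub> ((2::nat) ^ (m - 2))))"

text \<open>
  The binary icosahedral group.  The numeral type \<^typ>\<open>5\<close> of \<open>HOL-Library.Numeral_Type\<close> carries
  arithmetic modulo 5, i.e. it is the field with five elements.
\<close>

definition SL2_F5 :: "(5^2^2) monoid" where
  "SL2_F5 = \<lparr>carrier = {M. det M = 1}, mult = (**), one = mat 1\<rparr>"

section \<open>The six types\<close>

datatype sf_type = Type_I | Type_II | Type_III | Type_IV | Type_V | Type_VI

definition AB_conditions :: "('a, 'b) monoid_scheme \<Rightarrow> 'a set \<Rightarrow> 'a set \<Rightarrow> bool" where
  "AB_conditions G A B \<longleftrightarrow>
     subgroup A G \<and> subgroup B G \<and>
     cyclic_group (G\<lparr>carrier := A\<rparr>) \<and> cyclic_group (G\<lparr>carrier := B\<rparr>) \<and>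
     odd (card A) \<and> odd (card B) \<and> coprime (card A) (card B) \<and>
     (\<forall>p P. is_sylow_of G p P B \<and> P \<noteq> {\<one>\<^bsub>G\<^esub>} \<longrightarrow> (\<exists>x\<in>P. \<not> acts_trivially G x A)) \<and>
     (\<forall>b\<in>B. Factorial_Ring.prime (group.ord G b) \<longrightarrow> acts_trivially G b A)"

definition type_I_structure :: "('a, 'b) monoid_scheme \<Rightarrow> 'a set \<Rightarrow> bool" where
  "type_I_structure G A \<longleftrightarrow>
     (\<exists>B T BT. AB_conditions G A B \<and>
        internal_direct G BT B T \<and> internal_semidirect G (carrier G) A BT \<and>
        cyclic_group (G\<lparr>carrier := T\<rparr>) \<and> (\<exists>k. card T = 2 ^ k) \<and>
        (\<forall>t\<in>T. group.ord G t = 2 \<longrightarrow> acts_trivially G t A))"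

definition type_II_structure :: "('a, 'b) monoid_scheme \<Rightarrow> 'a set \<Rightarrow> bool" where
  "type_II_structure G A \<longleftrightarrow>
     (\<exists>B T BT. AB_conditions G A B \<and>
        internal_direct G BT B T \<and> internal_semidirect G (carrier G) A BT \<and>
        (\<exists>q. is_quaternionic q (G\<lparr>carrier := T\<rparr>)))"

text \<open>\<open>H = (Q \<times> A) : (\<Theta> \<times> B)\<close> as in type (III); \<open>H\<close> is a subgroup of an ambient group \<open>G\<close>.\<close>

definition type_III_decomposition ::
  "('a, 'b) monoid_scheme \<Rightarrow> 'a set \<Rightarrow> 'a set \<Rightarrow> 'a set \<Rightarrow> 'a set \<Rightarrow> 'a set \<Rightarrow> bool" where
  "type_III_decomposition G H Q A \<Theta> B \<longleftrightarrow>
     AB_conditions G A B \<and>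
     (\<exists>QA \<Theta>B. internal_direct G QA Q A \<and> internal_direct G \<Theta>B \<Theta> B \<and>
        internal_semidirect G H QA \<Theta>B) \<and>
     is_quaternionic 8 (G\<lparr>carrier := Q\<rparr>) \<and>
     cyclic_group (G\<lparr>carrier := \<Theta>\<rparr>) \<and> (\<exists>k. card \<Theta> = 3 ^ k) \<and>
     (\<exists>\<theta>\<in>\<Theta>. \<not> acts_trivially G \<theta> Q) \<and>
     (\<forall>\<theta>\<in>\<Theta>. group.ord G \<theta> = 3 \<longrightarrow> acts_trivially G \<theta> A) \<and>
     coprime (card A) 3 \<and> coprime (card B) 3"

text \<open>\<open>H = Q \<times> (A : B)\<close> as in type (V); \<open>H\<close> is a subgroup of an ambient group \<open>G\<close>.\<close>

definition type_V_decomposition ::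
  "('a, 'b) monoid_scheme \<Rightarrow> 'a set \<Rightarrow> 'a set \<Rightarrow> 'a set \<Rightarrow> 'a set \<Rightarrow> bool" where
  "type_V_decomposition G H Q A B \<longleftrightarrow>
     AB_conditions G A B \<and>
     (\<exists>AB. internal_semidirect G AB A B \<and> internal_direct G H Q AB) \<and>
     G\<lparr>carrier := Q\<rparr> \<cong> SL2_F5 \<and>
     coprime (card A) 15 \<and> coprime (card B) 15"

text \<open>\<open>G = H\<cdot>2\<close>, nonsplit, the quotient being the image of \<open>\<Phi> \<cong> \<int>/4\<close>.\<close>

definition nonsplit_extension_by_2 ::
  "('a, 'b) monoid_scheme \<Rightarrow> 'a set \<Rightarrow> 'a set \<Rightarrow> bool" where
  "nonsplit_extension_by_2 G H \<Phi> \<longleftrightarrow>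
     H \<lhd> G \<and> G Mod H \<cong> integer_mod_group 2 \<and>
     \<not> (\<exists>K. internal_semidirect G (carrier G) H K) \<and>
     subgroup \<Phi> G \<and> G\<lparr>carrier := \<Phi>\<rparr> \<cong> integer_mod_group 4 \<and>
     (\<lambda>x. H #>\<^bsub>G\<^esub> x) ` \<Phi> = carrier (G Mod H)"

definition type_IV_structure :: "('a, 'b) monoid_scheme \<Rightarrow> 'a set \<Rightarrow> bool" where
  "type_IV_structure G A \<longleftrightarrow>
     (\<exists>H Q \<Theta> B \<Phi>. type_III_decomposition G H Q A \<Theta> B \<and> nonsplit_extension_by_2 G H \<Phi> \<and>
        (\<forall>\<phi>\<in>\<Phi>. group.ord G \<phi> = 4 \<longrightarrow>
           acts_by_outer_auto G \<phi> Q \<and> acts_by_inversion G \<phi> \<Theta> \<and> acts_trivially G \<phi> B))"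

definition type_VI_structure :: "('a, 'b) monoid_scheme \<Rightarrow> 'a set \<Rightarrow> bool" where
  "type_VI_structure G A \<longleftrightarrow>
     (\<exists>H Q B \<Phi>. type_V_decomposition G H Q A B \<and> nonsplit_extension_by_2 G H \<Phi> \<and>
        (\<forall>\<phi>\<in>\<Phi>. group.ord G \<phi> = 4 \<longrightarrow>
           acts_by_outer_auto G \<phi> Q \<and> acts_trivially G \<phi> B))"

text \<open>
  \<open>has_type G \<tau> A\<close>: the group \<open>G\<close> has type \<open>\<tau>\<close>, and \<open>A\<close> is the subgroup of that name in the
  structure of \<open>G\<close>.  For every finite group acting freely and isometrically on a sphere there is
  exactly one such \<open>\<tau>\<close> and exactly one such \<open>A\<close>.
\<close>

fun has_type :: "('a, 'b) monoid_scheme \<Rightarrow> sf_type \<Rightarrow> 'a set \<Rightarrow> bool" where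
  "has_type G Type_I A \<longleftrightarrow> type_I_structure G A"
| "has_type G Type_II A \<longleftrightarrow> type_II_structure G A"
| "has_type G Type_III A \<longleftrightarrow> (\<exists>Q \<Theta> B. type_III_decomposition G (carrier G) Q A \<Theta> B)"
| "has_type G Type_IV A \<longleftrightarrow> type_IV_structure G A"
| "has_type G Type_V A \<longleftrightarrow> (\<exists>Q B. type_V_decomposition G (carrier G) Q A B)"
| "has_type G Type_VI A \<longleftrightarrow> type_VI_structure G A"

section \<open>The remaining invariants\<close>

text \<open>
  The image of a subgroup \<open>S\<close> in \<open>Aut(A)\<close>, regarded as a subset of \<open>(\<int>/a)\<^sup>*\<close> with \<open>a = |A|\<close>.
  A unit modulo \<open>a\<close> is represented by its residue in \<^term>\<open>totatives a\<close>, i.e. in \<open>{1..a}\<close>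
  (for \<open>a = 1\<close> the only unit is thus written 1).
\<close>

definition unit_image :: "('a, 'b) monoid_scheme \<Rightarrow> 'a set \<Rightarrow> 'a set \<Rightarrow> nat set" where
  "unit_image G A S =
     {u \<in> totatives (card A). (\<lambda>n\<in>A. n [^]\<^bsub>G\<^esub> u) \<in> conj_map G A ` S}"

text \<open>\<open>G\<^sub>0\<close>; it exists and is unique when \<open>G\<close> has type (II) and 16 divides \<open>|G|\<close>.\<close>

definition index2_subgroup :: "('a, 'b) monoid_scheme \<Rightarrow> 'a set" where
  "index2_subgroup G =
     (THE K. subgroup K G \<and> card (rcosets\<^bsub>G\<^esub> K) = 2 \<and>
        (\<forall>P. is_sylow_of G 2 P K \<longrightarrow> cyclic_group (G\<lparr>carrier := P\<rparr>)))"

end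

theory Submission
  imports Defs "HOL-Algebra.Sylow"
begin

text \<open>
  The argument is purely group theoretic. Each type is detected by properties that isomorphisms
  preserve (a normal 2-complement, cyclic Sylow 2-subgroups, a normal subgroup of order 8,
  divisibility of the order by 16), and \<open>A\<close> is detected as the normal cyclic Hall subgroup of odd order
  such that no Sylow subgroup for an odd prime dividing the index is normal; this gives the
  invariance of all the data.

  Conversely, let generators \<open>a\<close>, \<open>a'\<close> of \<open>A\<close>, \<open>A'\<close> be given, and let \<open>E\<close> be the subgroup of the pairs
  \<open>(g, g')\<close> that raise \<open>a\<close> and \<open>a'\<close> to the same power. As the images in \<open>Aut(A)\<close> agree, \<open>E\<close> maps onto
  both factors, and as the orders of the factors in the structure of the groups are coprime, the
  generators of these factors can be chosen in pairs lying in \<open>E\<close>. The subgroup of \<open>G \<times> G'\<close> generated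
  by such pairs is onto both factors and, adding one pair at a time, has order at most \<open>|G|\<close>. So it is
  the graph of an isomorphism.
\<close>

section \<open>Conjugation in groups\<close>

text \<open>What pairing through \<open>E\<close> does not settle is the action on the non-abelian
  2-part. In type II a quaternion group of order at least 16 has only one cyclic subgroup of index
  2, so its generator must be paired inside that subgroup; this is what the agreement of the images
  of \<open>index2_subgroup\<close> provides. In order 8 the three cyclic subgroups of order 4 are
  interchangeable. In types III and IV \<open>Q\<close> centralizes \<open>A\<close>, so its
  generators are instead adapted to a generator of \<open>\<Theta>\<close> (and to the element of
  order 4) until the conjugation formulas are identical in both groups. In types V and VI an
  isomorphism of \<open>Q\<close> with SL_2(F_5) plays that role, and in type VI the outer
  automorphism is brought to one normal form: it exchanges the transvections with off-diagonal
  entries 1 and 2, where 2 occurs because it is not a square mod 5. Throughout, Aut(A) is abelian;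
  hence elements of odd order that are conjugate to their inverse, and squares in quaternion groups,
  centralize \<open>A\<close>.\<close>

definition conj_by :: "('a, 'b) monoid_scheme \<Rightarrow> 'a \<Rightarrow> 'a \<Rightarrow> 'a" where
  "conj_by G g x = g \<otimes>\<^bsub>G\<^esub> x \<otimes>\<^bsub>G\<^esub> inv\<^bsub>G\<^esub> g"

context group
begin

lemma inv_mult_cancel [simp]:
  assumes "x \<in> carrier G" "y \<in> carrier G"
  shows "inv x \<otimes> (x \<otimes> y) = y" "x \<otimes> (inv x \<otimes> y) = y"
  using assms by (simp_all flip: m_assoc)

lemma conj_by_closed [simp]:
  "g \<in> carrier G \<Longrightarrow> x \<in> carrier G \<Longrightarrow> conj_by G g x \<in> carrier G"
  by (simp add: conj_by_def)

lemma conj_by_mult: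
  assumes "g \<in> carrier G" "x \<in> carrier G" "y \<in> carrier G"
  shows "conj_by G g (x \<otimes> y) = conj_by G g x \<otimes> conj_by G g y"
  using assms by (simp add: conj_by_def m_assoc)

lemma conj_by_one_right [simp]: "g \<in> carrier G \<Longrightarrow> conj_by G g \<one> = \<one>"
  by (simp add: conj_by_def)

lemma conj_by_one_left [simp]: "x \<in> carrier G \<Longrightarrow> conj_by G \<one> x = x"
  by (simp add: conj_by_def)

lemma conj_by_pow:
  assumes "g \<in> carrier G" "x \<in> carrier G"
  shows "conj_by G g (x [^] (n::nat)) = conj_by G g x [^] n"
  by (induction n) (use assms in \<open>simp_all add: conj_by_mult\<close>)

lemma conj_by_inv:
  assumes "g \<in> carrier G" "x \<in> carrier G"
  shows "conj_by G g (inv x) = inv (conj_by G g x)"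
  using assms by (simp add: conj_by_def m_assoc inv_mult_group)

lemma conj_by_conj_by:
  assumes "g \<in> carrier G" "h \<in> carrier G" "x \<in> carrier G"
  shows "conj_by G (g \<otimes> h) x = conj_by G g (conj_by G h x)"
  using assms by (simp add: conj_by_def m_assoc inv_mult_group)

lemma conj_by_eq_self_iff:
  assumes "g \<in> carrier G" "x \<in> carrier G"
  shows "conj_by G g x = x \<longleftrightarrow> g \<otimes> x = x \<otimes> g"
  using assms inv_solve_right[of x "g \<otimes> x" g] by (auto simp: conj_by_def)

lemma conj_by_mult_right:
  assumes "g \<in> carrier G" "x \<in> carrier G"
  shows "conj_by G g x \<otimes> g = g \<otimes> x"
  using assms by (simp add: conj_by_def m_assoc)

lemma conj_by_inj:
  assumes "g \<in> carrier G" "x \<in> carrier G" "y \<in> carrier G" "conj_by G g x = conj_by G g y"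
  shows "x = y"
  using assms by (simp add: conj_by_def)

lemma conj_by_inv_cancel [simp]:
  assumes "g \<in> carrier G" "x \<in> carrier G"
  shows "conj_by G (inv g) (conj_by G g x) = x" "conj_by G g (conj_by G (inv g) x) = x"
  using assms by (simp_all flip: conj_by_conj_by)

text \<open>Bezout writes g as a product of integer powers of g^m and g^n. Most coprimality
  arguments on elements below reduce to this.\<close>

lemma coprime_pow_mem:
  assumes "subgroup S G" "g \<in> carrier G" "g [^] (m::nat) \<in> S" "g [^] (n::nat) \<in> S" "coprime m n"
  shows "g \<in> S"
proof -
  obtain u v where uv: "u * int m + v * int n = 1"
    using bezout_int[of "int m" "int n"] assms(5) by auto
  have "g = g [^] (int m * u + int n * v)"
    using uv assms(2) by (simp add: mult.commute)
  also have "\<dots> = (g [^] m) [^] u \<otimes> (g [^] n) [^] v"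
    using assms(2) by (simp add: int_pow_mult int_pow_pow flip: int_pow_int)
  also have "\<dots> \<in> S"
    using assms by (intro subgroup.m_closed) (auto intro: subgroup_int_pow_closed)
  finally show ?thesis .
qed

lemma centralizer_subgroup:
  assumes "A \<subseteq> carrier G"
  shows "subgroup {g \<in> carrier G. \<forall>x\<in>A. conj_by G g x = x} G"
proof (rule subgroupI)
  fix a assume a: "a \<in> {g \<in> carrier G. \<forall>x\<in>A. conj_by G g x = x}"
  then have "a \<in> carrier G" "conj_by G a x = x" if "x \<in> A" for x
    using that by auto
  then have "conj_by G (inv a) x = x" if "x \<in> A" for x
    using that assms conj_by_inv_cancel(1)[of a x] by auto
  then show "inv a \<in> {g \<in> carrier G. \<forall>x\<in>A. conj_by G g x = x}"
    using a by auto
qed (use assms in \<open>auto simp: conj_by_conj_by subset_iff intro: exI[of _ \<one>]\<close>)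

text \<open>The centralizer of x contains g^m by hypothesis and g^n because it is 1; Bezout then
  puts g into it.\<close>

lemma coprime_pow_commute:
  assumes "g \<in> carrier G" "x \<in> carrier G" "g [^] (m::nat) \<otimes> x = x \<otimes> g [^] m"
    and "g [^] (n::nat) = \<one>" "coprime m n"
  shows "g \<otimes> x = x \<otimes> g"
proof -
  have "g \<in> {g \<in> carrier G. \<forall>y\<in>{x}. conj_by G g y = y}"
    by (rule coprime_pow_mem[of _ _ m n]) (use assms centralizer_subgroup[of "{x}"] conj_by_eq_self_iff[of "g [^] m" x] in auto)
  then show ?thesis using assms conj_by_eq_self_iff by auto
qed

lemma subgroup_pow_closed:
  "subgroup H G \<Longrightarrow> x \<in> H \<Longrightarrow> x [^] (n::nat) \<in> H"
  by (induction n) (auto simp: subgroup.one_closed subgroup.m_closed)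

lemma subgroup_conj_closed:
  "subgroup H G \<Longrightarrow> x \<in> H \<Longrightarrow> y \<in> H \<Longrightarrow> conj_by G x y \<in> H"
  by (simp add: conj_by_def subgroup.m_closed subgroup.m_inv_closed)

lemma normal_conj_closed: "N \<lhd> G \<Longrightarrow> g \<in> carrier G \<Longrightarrow> x \<in> N \<Longrightarrow> conj_by G g x \<in> N"
  by (simp add: conj_by_def normal.inv_op_closed2)

lemma normal_iff_conj: "N \<lhd> G \<longleftrightarrow> subgroup N G \<and> (\<forall>g\<in>carrier G. \<forall>x\<in>N. conj_by G g x \<in> N)"
  by (simp add: normal_inv_iff conj_by_def)

lemma card_set_mult:
  assumes "subgroup H G" "subgroup K G" "H \<inter> K = {\<one>}"
  shows "card (H <#> K) = card H * card K"
proof -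
  interpret group_disjoint_sum G H K
    using assms by (simp add: group_disjoint_sum_def group_axioms)
  have "H <#> K = (\<lambda>(h, k). h \<otimes> k) ` (H \<times> K)"
    by (auto simp: set_mult_def)
  moreover have "inj_on (\<lambda>(h, k). h \<otimes> k) (H \<times> K)"
    using cancel assms(3) by (auto simp: inj_on_def)
  ultimately show ?thesis
    by (simp add: card_image card_cartesian_product)
qed

lemma normal_commutator_mem:
  assumes "N \<lhd> G" "n \<in> N" "g \<in> carrier G"
  shows "n \<otimes> conj_by G g (inv n) \<in> N" "conj_by G g n \<otimes> inv n \<in> N"
  using assms normal_imp_subgroup[OF assms(1)] normal_conj_closed[OF assms(1,3)]
  by (simp_all add: subgroup.m_closed subgroup.m_inv_closed)

text \<open>The commutator of x and y lies in M, as x times a conjugate of x^-1, and in N, as a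
  conjugate of y times y^-1. Membership of the two conjugates stands in place of normality, so the
  lemma also serves subgroups that are normal only in a smaller group.\<close>

lemma disjoint_normal_commute:
  assumes M: "subgroup M G" "x \<in> M" "conj_by G y x \<in> M"
    and N: "subgroup N G" "y \<in> N" "conj_by G x y \<in> N" and "M \<inter> N = {\<one>}"
  shows "x \<otimes> y = y \<otimes> x"
proof -
  have C: "x \<in> carrier G" "y \<in> carrier G"
    using assms by (auto dest: subgroup.subset)
  have "conj_by G x y \<otimes> inv y = x \<otimes> inv (conj_by G y x)"
    using C by (simp add: conj_by_def m_assoc inv_mult_group)
  moreover have "conj_by G x y \<otimes> inv y \<in> N" "x \<otimes> inv (conj_by G y x) \<in> M"
    using assms by (simp_all add: subgroup.m_closed subgroup.m_inv_closed)
  ultimately have "conj_by G x y \<otimes> inv y = \<one>"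
    using assms(7) by auto
  then have "conj_by G x y = y"
    using C inv_solve_right[of \<one> "conj_by G x y" y] by simp
  then show ?thesis
    using C by (simp add: conj_by_eq_self_iff)
qed

end

section \<open>Hall subgroups, cyclic subgroups and orders in a finite group\<close>

locale finite_group = group +
  assumes fin [simp]: "finite (carrier G)"
begin

lemma finite_subgroup: "subgroup H G \<Longrightarrow> finite H"
  using fin finite_subset subgroup.subset by blast

lemma finite_subgroupI:
  assumes "S \<subseteq> carrier G" "\<one> \<in> S" "\<And>x y. x \<in> S \<Longrightarrow> y \<in> S \<Longrightarrow> x \<otimes> y \<in> S"
  shows "subgroup S G"
proof (rule subgroupI)
  fix a assume a: "a \<in> S"
  then have C: "a \<in> carrier G" using assms by auto
  have *: "a [^] n \<in> S" for n :: nat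
    by (induction n) (use assms a in auto)
  have "ord a \<ge> 1" using C fin by (rule ord_ge_1[rotated])
  then have "a [^] (ord a - 1) \<otimes> a = \<one>"
    using C by (simp flip: nat_pow_Suc)
  then have "inv a = a [^] (ord a - 1)"
    using C by (simp add: inv_equality)
  with *[of "ord a - 1"] show "inv a \<in> S" by simp
qed (use assms in auto)

lemma generate_singleton: "a \<in> carrier G \<Longrightarrow> generate G {a} = range (\<lambda>k::nat. a [^] k)"
  by (auto simp: generate_pow_on_finite_carrier)

lemma ord_pos: "a \<in> carrier G \<Longrightarrow> ord a > 0"
  using ord_ge_1[OF fin] by (simp add: Suc_le_lessD)

lemma card_subgroup_pos: "subgroup H G \<Longrightarrow> card H > 0"
  using finite_subgroup[of H] subgroup.one_closed[of H G] by (auto simp: card_gt_0_iff)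

lemma card_subgroup_dvd: "subgroup H G \<Longrightarrow> card H dvd order G"
  using lagrange[of H] by (auto intro!: dvdI[of _ _ "card (rcosets H)"] simp: mult.commute)

lemma order_pos: "order G > 0"
  by (simp add: order_gt_0_iff_finite)

lemma subgroup_finite_group: "subgroup H G \<Longrightarrow> finite_group (G\<lparr>carrier := H\<rparr>)"
  using subgroup_imp_group finite_subgroup by (simp add: finite_group_def finite_group_axioms_def)

lemma pow_card_subgroup: "subgroup H G \<Longrightarrow> x \<in> H \<Longrightarrow> x [^] card H = \<one>"
  using group.pow_order_eq_1[OF subgroup_imp_group, of H x]
  by (simp add: order_def flip: nat_pow_consistent)

lemma card_subgroup_dvd_subgroup:
  assumes "subgroup H G" "subgroup K G" "H \<subseteq> K"
  shows "card H dvd card K"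
  using finite_group.card_subgroup_dvd[OF subgroup_finite_group[OF assms(2)]] subgroup_incl[OF assms]
  by (simp add: order_def)

text \<open>The quotient by N has order m, so x^m lies in N, and so does x^k = 1. A normal Hall
  subgroup thus contains every element whose order fits, which is how such subgroups are shown to be
  stable under further conjugation.\<close>

lemma hall_mem:
  assumes "N \<lhd> G" "order G = card N * m" "x \<in> carrier G" "x [^] (k::nat) = \<one>" "coprime k m"
  shows "x \<in> N"
proof -
  interpret N: normal N G by fact
  interpret F: group "G Mod N" by (rule N.factorgroup_is_group)
  have S: "subgroup N G" by (rule N.subgroup_axioms)
  have "order (G Mod N) * card N = order G"
    using lagrange[OF S] by (simp add: order_def FactGroup_def)
  then have m: "order (G Mod N) = m"
    using assms(2) card_subgroup_pos[OF S] by simp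
  have "(N #> x) [^]\<^bsub>G Mod N\<^esub> m = N"
    using F.pow_order_eq_1[of "N #> x"] assms(3) m by (auto simp: carrier_FactGroup)
  then have "N #> (x [^] m) = N"
    using N.FactGroup_pow[OF assms(3)] by simp
  then have "x [^] m \<in> N"
    using assms(3) S rcos_self[of "x [^] m" N] by simp
  then show ?thesis
    using coprime_pow_mem[OF S assms(3) _ _ assms(5)] assms(4) subgroup.one_closed[OF S] by simp
qed

lemma hall_mem_subgroup:
  assumes "subgroup H G" "subgroup N G" "N \<subseteq> H" "\<And>h n. h \<in> H \<Longrightarrow> n \<in> N \<Longrightarrow> conj_by G h n \<in> N"
    and "card H = card N * m" "x \<in> H" "x [^] (k::nat) = \<one>" "coprime k m"
  shows "x \<in> N"
proof -
  interpret H: finite_group "G\<lparr>carrier := H\<rparr>"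
    by (rule subgroup_finite_group) fact
  have "N \<lhd> G\<lparr>carrier := H\<rparr>"
    unfolding H.normal_inv_iff using subgroup_incl[OF assms(2,1,3)] assms(1,4)
    by (simp add: conj_by_def)
  then show ?thesis
    by (rule H.hall_mem[of _ m _ k]) (use assms in \<open>simp_all add: order_def flip: nat_pow_consistent\<close>)
qed

lemma cyclic_subgroupE:
  assumes "subgroup A G" "cyclic_group (G\<lparr>carrier := A\<rparr>)"
  obtains a where "a \<in> A" "a \<in> carrier G" "generate G {a} = A" "ord a = card A"
proof -
  interpret A: group "G\<lparr>carrier := A\<rparr>" using assms(1) by (rule subgroup_imp_group)
  obtain a where a: "a \<in> A" "A = range (\<lambda>n::int. a [^]\<^bsub>G\<lparr>carrier := A\<rparr>\<^esub> n)"
    using assms(2) A.cyclic_group by auto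
  then have C: "a \<in> carrier G" using assms(1) subgroup.subset by blast
  have "A = range (\<lambda>n::int. a [^] n)"
    using a int_pow_consistent[OF assms(1) a(1)] by simp
  then have "generate G {a} = A"
    using generate_pow[OF C] by auto
  then show ?thesis
    using that a(1) C generate_pow_card[OF C] by simp
qed

lemma cyclic_subgroupI:
  assumes "subgroup A G" "a \<in> A" "ord a = card A"
  shows "cyclic_group (G\<lparr>carrier := A\<rparr>)" "generate G {a} = A"
proof -
  interpret A: group "G\<lparr>carrier := A\<rparr>" using assms(1) by (rule subgroup_imp_group)
  have C: "a \<in> carrier G" using assms subgroup.subset by blast
  show *: "generate G {a} = A"
    using generate_subgroup_incl[of "{a}" A] generate_pow_card[OF C] assms finite_subgroup[OF assms(1)]
    by (intro card_subset_eq) auto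
  have "A = range (\<lambda>n::int. a [^]\<^bsub>G\<lparr>carrier := A\<rparr>\<^esub> n)"
    using * generate_pow[OF C] int_pow_consistent[OF assms(1,2)] by (simp add: full_SetCompr_eq)
  then show "cyclic_group (G\<lparr>carrier := A\<rparr>)"
    using A.cyclic_group assms(2) by auto
qed

lemma internal_semidirectD:
  assumes "internal_semidirect G S N K"
  shows "subgroup S G" "subgroup N G" "subgroup K G" "N \<subseteq> S" "K \<subseteq> S" "N \<inter> K = {\<one>}"
    "\<And>s n. s \<in> S \<Longrightarrow> n \<in> N \<Longrightarrow> conj_by G s n \<in> N"
    "\<And>s. s \<in> S \<Longrightarrow> \<exists>n\<in>N. \<exists>k\<in>K. s = n \<otimes> k"
    "card S = card N * card K"
proof -
  have S: "subgroup S G" and N: "N \<lhd> G\<lparr>carrier := S\<rparr>" and K: "subgroup K (G\<lparr>carrier := S\<rparr>)"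
    and D: "N \<inter> K = {\<one>}" "N <#> K = S"
    using assms unfolding internal_semidirect_def by auto
  interpret S: group "G\<lparr>carrier := S\<rparr>" using S by (rule subgroup_imp_group)
  show "subgroup S G" "N \<inter> K = {\<one>}" by fact+
  show sN: "subgroup N G" and sK: "subgroup K G"
    using incl_subgroup[OF S normal_imp_subgroup[OF N]] incl_subgroup[OF S K] .
  show "N \<subseteq> S" "K \<subseteq> S"
    using subgroup.subset[OF K] subgroup.subset[OF normal_imp_subgroup[OF N]] by simp_all
  show "conj_by G s n \<in> N" if "s \<in> S" "n \<in> N" for s n
    using S.normal_invE(2)[OF N, of s n] that S by (simp add: conj_by_def)
  show "\<exists>n\<in>N. \<exists>k\<in>K. s = n \<otimes> k" if "s \<in> S" for s
    using that D(2) by (auto simp: set_mult_def)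
  show "card S = card N * card K"
    using card_set_mult[OF sN sK D(1)] D(2) by simp
qed

lemma internal_directD:
  assumes "internal_direct G S M N"
  shows "internal_semidirect G S M N"
    "\<And>s n. s \<in> S \<Longrightarrow> n \<in> N \<Longrightarrow> conj_by G s n \<in> N"
    "\<And>x y. x \<in> M \<Longrightarrow> y \<in> N \<Longrightarrow> x \<otimes> y = y \<otimes> x"
proof -
  show sd: "internal_semidirect G S M N"
    using assms normal_imp_subgroup[of N "G\<lparr>carrier := S\<rparr>"] unfolding internal_direct_def internal_semidirect_def by simp
  note sd = internal_semidirectD[OF sd]
  interpret S: group "G\<lparr>carrier := S\<rparr>" using sd(1) by (rule subgroup_imp_group)
  show n: "conj_by G s n \<in> N" if "s \<in> S" "n \<in> N" for s n
    using S.normal_invE(2)[of N s n] that sd(1) assms by (simp add: conj_by_def internal_direct_def)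
  show "x \<otimes> y = y \<otimes> x" if "x \<in> M" "y \<in> N" for x y
    by (rule disjoint_normal_commute[OF sd(2) that(1) _ sd(3) that(2) _ sd(6)])
      (use n[of x y] sd(4,5) sd(7)[of y x] that in auto)
qed

text \<open>Conjugation by c preserves the subgroup R generated by X, since this can be tested on X,
  and the sets R c^0, ..., R c^(m-1) together already form a subgroup. As only an upper bound is
  claimed, m may be any positive exponent with c^m in R.\<close>

lemma card_generate_insert_le:
  assumes X: "X \<subseteq> carrier G" and c: "c \<in> carrier G" and n: "\<And>x. x \<in> X \<Longrightarrow> conj_by G c x \<in> generate G X"
    and m: "c [^] m \<in> generate G X" "m > 0"
  shows "card (generate G (insert c X)) \<le> m * card (generate G X)"
proof -
  define R where "R = generate G X"
  have R: "subgroup R G" unfolding R_def using X by (rule generate_is_subgroup)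
  have RC: "r \<in> carrier G" if "r \<in> R" for r using subgroup.subset[OF R] that by auto
  have cR: "conj_by G c r \<in> R" if "r \<in> R" for r
    using that unfolding R_def
  proof induction
    case one then show ?case using c by (simp add: generate.one)
  next
    case (incl h) then show ?case using n by simp
  next
    case (inv h) then show ?case
      using n[OF inv] X c generate_m_inv_closed[OF X] conj_by_inv[OF c, of h] by auto
  next
    case (eng h1 h2) then show ?case
      using generate_in_carrier[OF X] c by (simp add: conj_by_mult generate.eng)
  qed
  have ciR: "conj_by G (c [^] i) r \<in> R" if "r \<in> R" for r and i :: nat
    using that by (induction i arbitrary: r) (use c cR RC in \<open>auto simp: conj_by_conj_by\<close>)
  define S where "S = (\<lambda>(i, r). r \<otimes> c [^] i) ` ({..<m} \<times> R)"
  have S: "r \<otimes> c [^] i \<in> S" if "r \<in> R" for r and i :: nat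
  proof -
    have "c [^] i = (c [^] m) [^] (i div m) \<otimes> c [^] (i mod m)"
      using c by (simp add: nat_pow_pow nat_pow_mult)
    then have "r \<otimes> c [^] i = (r \<otimes> (c [^] m) [^] (i div m)) \<otimes> c [^] (i mod m)"
      using c RC[OF that] by (simp add: m_assoc)
    moreover have "r \<otimes> (c [^] m) [^] (i div m) \<in> R"
      using R m that by (simp add: R_def[symmetric] subgroup_pow_closed subgroup.m_closed)
    ultimately show ?thesis unfolding S_def using m(2) by force
  qed
  have "subgroup S G"
  proof (rule finite_subgroupI)
    show "S \<subseteq> carrier G" using RC c by (auto simp: S_def)
    show "\<one> \<in> S" using S[of \<one> 0] R by (simp add: subgroup.one_closed)
    fix x y assume "x \<in> S" "y \<in> S"
    then obtain r i s j where xy: "x = r \<otimes> c [^] i" "y = s \<otimes> c [^] j" "r \<in> R" "s \<in> R" "i < m" "j < m"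
      by (auto simp: S_def)
    have "x \<otimes> y = (r \<otimes> conj_by G (c [^] i) s) \<otimes> c [^] (i + j)"
      using xy c RC by (simp add: conj_by_def m_assoc flip: nat_pow_mult)
    then show "x \<otimes> y \<in> S"
      using S ciR xy R by (simp add: subgroup.m_closed)
  qed
  moreover have "insert c X \<subseteq> S"
  proof -
    have "c \<in> S" using S[of \<one> 1] R c by (simp add: subgroup.one_closed)
    moreover have "x \<in> S" if "x \<in> X" for x
      using S[of x 0] that X by (auto simp: R_def generate.incl)
    ultimately show ?thesis by auto
  qed
  ultimately have "generate G (insert c X) \<subseteq> S"
    by (rule generate_subgroup_incl[rotated])
  moreover have "finite S" unfolding S_def using finite_subgroup[OF R] by auto
  ultimately have "card (generate G (insert c X)) \<le> card S"
    by (rule card_mono[rotated])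
  also have "\<dots> \<le> card ({..<m} \<times> R)"
    unfolding S_def using finite_subgroup[OF R] by (intro card_image_le) auto
  finally show ?thesis by (simp add: R_def card_cartesian_product)
qed

end

section \<open>Direct products and graphs of isomorphisms\<close>

lemma finite_group_DirProd:
  "finite_group G \<Longrightarrow> finite_group G' \<Longrightarrow> finite_group (G \<times>\<times> G')"
  by (simp add: finite_group_def finite_group_axioms_def DirProd_group)

lemma pow_DirProd: "(x, y) [^]\<^bsub>G \<times>\<times> G'\<^esub> (n::nat) = (x [^]\<^bsub>G\<^esub> n, y [^]\<^bsub>G'\<^esub> n)"
  by (induction n) simp_all

lemma conj_by_DirProd:
  assumes "group G" "group G'" "g \<in> carrier G" "g' \<in> carrier G'"
  shows "conj_by (G \<times>\<times> G') (g, g') (x, y) = (conj_by G g x, conj_by G' g' y)"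
  using assms by (simp add: conj_by_def)

text \<open>A subgroup of \<open>G \<times> G'\<close> that is onto both factors and no larger than they are is the graph
  of an isomorphism.\<close>

lemma is_iso_of_generated_graph:
  assumes G: "finite_group G" and G': "finite_group G'"
    and X: "X \<subseteq> carrier G \<times> carrier G'"
    and fst: "carrier G \<subseteq> generate G (fst ` X)" and snd: "carrier G' \<subseteq> generate G' (snd ` X)"
    and card: "card (generate (G \<times>\<times> G') X) \<le> order G" "order G = order G'"
  shows "G \<cong> G'"
proof -
  interpret G: finite_group G by fact
  interpret G': finite_group G' by fact
  interpret P: finite_group "G \<times>\<times> G'" by (rule finite_group_DirProd) fact+
  define R where "R = generate (G \<times>\<times> G') X"
  have XC: "X \<subseteq> carrier (G \<times>\<times> G')" using X by simp
  have R: "subgroup R (G \<times>\<times> G')"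
    unfolding R_def by (rule P.generate_is_subgroup) fact
  have RC: "R \<subseteq> carrier G \<times> carrier G'" using subgroup.subset[OF R] by simp
  have h1: "group_hom (G \<times>\<times> G') G fst" and h2: "group_hom (G \<times>\<times> G') G' snd"
    by (unfold_locales; auto simp: hom_def)+
  have "fst ` R = generate G (fst ` X)" "snd ` R = generate G' (snd ` X)"
    unfolding R_def using group_hom.generate_img[OF h1 XC] group_hom.generate_img[OF h2 XC] by auto
  then have im: "fst ` R = carrier G" "snd ` R = carrier G'"
    using fst snd image_mono[OF RC, of fst] image_mono[OF RC, of snd]
    by (simp_all add: equalityI split: if_splits)
  have fR: "finite R" using P.finite_subgroup[OF R] .
  have le: "card R \<le> card (carrier G)" "card R \<le> card (carrier G')"
    using card by (simp_all add: R_def order_def)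
  \<comment> \<open>Each projection maps R onto a set with at least as many elements as R, so it
    cannot identify two pairs.\<close>
  have i1: "inj_on fst R" and i2: "inj_on snd R"
    using im le card_image_le[OF fR, of fst] card_image_le[OF fR, of snd]
    by (simp_all add: eq_card_imp_inj_on[OF fR] antisym)
  define f where "f = snd \<circ> inv_into R fst"
  have f: "(x, f x) \<in> R" if "x \<in> carrier G" for x
  proof -
    have "inv_into R fst x \<in> R" "fst (inv_into R fst x) = x"
      using that im inv_into_into[of x fst R] f_inv_into_f[of x fst R] by auto
    then show ?thesis unfolding f_def comp_apply by (cases "inv_into R fst x") simp
  qed
  have fu: "f x = y" if "(x, y) \<in> R" for x y
    using that f[of x] RC inj_onD[OF i1, of "(x, f x)" "(x, y)"] by auto
  have "f \<in> hom G G'"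
  proof (rule homI)
    fix x y assume xy: "x \<in> carrier G" "y \<in> carrier G"
    show "f x \<in> carrier G'" using f[OF xy(1)] RC by auto
    show "f (x \<otimes>\<^bsub>G\<^esub> y) = f x \<otimes>\<^bsub>G'\<^esub> f y"
      using subgroup.m_closed[OF R f[OF xy(1)] f[OF xy(2)]] by (simp add: fu)
  qed
  moreover have "bij_betw f (carrier G) (carrier G')"
  proof -
    have "inj_on f (carrier G)"
    proof (rule inj_onI)
      fix x y assume "x \<in> carrier G" "y \<in> carrier G" "f x = f y"
      then show "x = y"
        using f[of x] f[of y] inj_onD[OF i2, of "(x, f x)" "(y, f y)"] by auto
    qed
    moreover have "f ` carrier G = carrier G'"
    proof
      show "f ` carrier G \<subseteq> carrier G'" using f RC by auto
      show "carrier G' \<subseteq> f ` carrier G"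
      proof
        fix y assume "y \<in> carrier G'"
        then obtain x where "(x, y) \<in> R" using im(2) by force
        then show "y \<in> f ` carrier G" using fu[of x y] RC by auto
      qed
    qed
    ultimately show ?thesis by (simp add: bij_betw_def)
  qed
  ultimately show ?thesis by (auto simp: is_iso_def iso_def)
qed

section \<open>The group \<open>SL\<^sub>2(F\<^sub>5)\<close>\<close>

lemma UNIV_5: "(UNIV::5 set) = {0, 1, 2, 3, 4}"
proof -
  have "card {0, 1, 2, 3, 4::5} = 5" by simp
  then show ?thesis by (intro card_subset_eq[symmetric]) simp_all
qed

text \<open>Polynomial identities over the field with five elements are settled by trying all
  values; this form turns a quantifier into five instances that simplification evaluates.\<close>

lemma all_5: "(\<forall>x::5. P x) \<longleftrightarrow> P 0 \<and> P 1 \<and> P 2 \<and> P 3 \<and> P 4"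
proof -
  have "(\<forall>x::5. P x) \<longleftrightarrow> (\<forall>x\<in>UNIV. P x)" by simp
  then show ?thesis unfolding UNIV_5 by simp
qed

lemma exhaust_5: "x = 0 \<or> x = 1 \<or> x = 2 \<or> x = 3 \<or> x = (4::5)"
  using UNIV_I[of x] unfolding UNIV_5 by simp

definition mat2 :: "5 \<Rightarrow> 5 \<Rightarrow> 5 \<Rightarrow> 5 \<Rightarrow> 5^2^2" where
  "mat2 a b c d = vector [vector [a, b], vector [c, d]]"

lemma mat2_cases: obtains a b c d where "M = mat2 a b c d"
proof
  show "M = mat2 (M$1$1) (M$1$2) (M$2$1) (M$2$2)"
    by (simp add: mat2_def vec_eq_iff forall_2 vector_2)
qed

lemma mat2_eq_iff [simp]: "mat2 a b c d = mat2 a' b' c' d' \<longleftrightarrow> a = a' \<and> b = b' \<and> c = c' \<and> d = d'"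
  by (auto simp: mat2_def vec_eq_iff forall_2 vector_2)

lemma mat2_mult [simp]:
  "mat2 a b c d ** mat2 a' b' c' d' = mat2 (a*a' + b*c') (a*b' + b*d') (c*a' + d*c') (c*b' + d*d')"
  by (simp add: mat2_def vec_eq_iff forall_2 vector_2 matrix_matrix_mult_def sum_2)

lemma mat_1_eq_mat2: "mat 1 = mat2 1 0 0 1"
  by (simp add: mat2_def vec_eq_iff forall_2 vector_2 mat_def)

lemma det_mat2 [simp]: "det (mat2 a b c d) = a*d - b*c"
  by (simp add: mat2_def det_2 vector_2)

lemma SL2_mult [simp]: "x \<otimes>\<^bsub>SL2_F5\<^esub> y = x ** y"
  by (simp add: SL2_F5_def)

lemma SL2_one [simp]: "\<one>\<^bsub>SL2_F5\<^esub> = mat2 1 0 0 1"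
  by (simp add: SL2_F5_def mat_1_eq_mat2)

lemma SL2_carrier_iff: "x \<in> carrier SL2_F5 \<longleftrightarrow> det x = 1"
  by (simp add: SL2_F5_def)

lemma SL2_carrier_mat2 [simp]: "mat2 a b c d \<in> carrier SL2_F5 \<longleftrightarrow> a*d - b*c = 1"
  by (simp add: SL2_carrier_iff)

lemma SL2_cases:
  assumes "M \<in> carrier SL2_F5"
  obtains a b c d where "M = mat2 a b c d" "a*d - b*c = 1"
  using assms mat2_cases[of M] by (metis SL2_carrier_mat2)

interpretation SL2: finite_group SL2_F5
proof -
  have "group SL2_F5"
  proof (rule groupI)
    fix x assume "x \<in> carrier SL2_F5"
    then obtain a b c d where x: "x = mat2 a b c d" "a*d - b*c = 1" by (rule SL2_cases)
    then show "\<exists>y\<in>carrier SL2_F5. y \<otimes>\<^bsub>SL2_F5\<^esub> x = \<one>\<^bsub>SL2_F5\<^esub>"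
      by (intro bexI[of _ "mat2 d (-b) (-c) a"]) (simp_all add: algebra_simps)
    show "\<one>\<^bsub>SL2_F5\<^esub> \<otimes>\<^bsub>SL2_F5\<^esub> x = x" by (simp add: x)
  qed (auto simp: SL2_carrier_iff det_mul matrix_mul_assoc simp flip: mat_1_eq_mat2)
  then show "finite_group SL2_F5"
    by (simp add: finite_group_def finite_group_axioms_def)
qed

lemma SL2_inv:
  assumes "a*d - b*c = 1"
  shows "inv\<^bsub>SL2_F5\<^esub> (mat2 a b c d) = mat2 d (-b) (-c) a"
  using assms by (intro SL2.inv_equality) (simp_all add: algebra_simps)

text \<open>Fermat's identity makes the cube of c its inverse, which is how inverses are written
  below. By the second part a nontrivial unipotent matrix has all others of its shape among its
  powers.\<close>

lemma field5_facts:
  fixes c :: 5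
  shows "c \<noteq> 0 \<Longrightarrow> c*c*c*c = 1" "c \<noteq> 0 \<Longrightarrow> \<exists>n. of_nat n * c = j"
proof -
  have "\<forall>c::5. c \<noteq> 0 \<longrightarrow> c*c*c*c = 1" by (simp add: all_5)
  then show "c \<noteq> 0 \<Longrightarrow> c*c*c*c = 1" by blast
  have "\<forall>c j::5. c \<noteq> 0 \<longrightarrow> of_nat 0 * c = j \<or> of_nat 1 * c = j \<or> of_nat 2 * c = j
      \<or> of_nat 3 * c = j \<or> of_nat 4 * c = j"
    by (simp add: all_5)
  then show "c \<noteq> 0 \<Longrightarrow> \<exists>n. of_nat n * c = j" by blast
qed

text \<open>Split by the lower left entry c. If c is nonzero, then a, c and d determine b, giving 5
  * 4 * 5 matrices; if c = 0, then d is the inverse of a and b is free, giving 4 * 5. Inverses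
  appear as cubes.\<close>

lemma order_SL2: "order SL2_F5 = 120"
proof -
  define f :: "5 \<times> 5 \<times> 5 \<Rightarrow> 5^2^2" where "f = (\<lambda>(a, c, d). mat2 a ((a*d - 1)*(c*c*c)) c d)"
  define g :: "5 \<times> 5 \<Rightarrow> 5^2^2" where "g = (\<lambda>(a, b). mat2 a b 0 (a*a*a))"
  define X :: "(5 \<times> 5 \<times> 5) set" where "X = UNIV \<times> (-{0}) \<times> UNIV"
  define Y :: "(5 \<times> 5) set" where "Y = (-{0}) \<times> UNIV"
  have 1: "\<forall>a b c d::5. a*d - b*c = 1 \<longrightarrow> c \<noteq> 0 \<longrightarrow> b = (a*d - 1)*(c*c*c)"
    "\<forall>a b d::5. a*d = 1 \<longrightarrow> a \<noteq> 0 \<and> d = a*a*a"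
    "\<forall>a c d::5. c \<noteq> 0 \<longrightarrow> a*d - ((a*d - 1)*(c*c*c))*c = 1"
    "\<forall>a::5. a \<noteq> 0 \<longrightarrow> a*(a*a*a) = 1"
    by (simp_all add: all_5)
  have "carrier SL2_F5 = f ` X \<union> g ` Y"
  proof (intro equalityI subsetI)
    fix M assume "M \<in> carrier SL2_F5"
    then obtain a b c d where M: "M = mat2 a b c d" "a*d - b*c = 1" by (rule SL2_cases)
    show "M \<in> f ` X \<union> g ` Y"
    proof (cases "c = 0")
      case True
      then have "M = g (a, b)" "(a, b) \<in> Y" using M 1(2) by (auto simp: g_def Y_def)
      then show ?thesis by blast
    next
      case False
      then have "M = f (a, c, d)" "(a, c, d) \<in> X" using M 1(1) by (auto simp: f_def X_def)
      then show ?thesis by blast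
    qed
  next
    fix M assume "M \<in> f ` X \<union> g ` Y"
    then show "M \<in> carrier SL2_F5" using 1(3,4) unfolding f_def g_def X_def Y_def by auto (metis+)
  qed
  moreover have "f ` X \<inter> g ` Y = {}" by (auto simp: f_def g_def X_def Y_def)
  moreover have "card (f ` X) = card X" "card (g ` Y) = card Y"
    by (auto intro!: card_image simp: inj_on_def f_def g_def)
  moreover have "card X = 100" "card Y = 20"
    by (simp_all add: X_def Y_def card_cartesian_product Compl_eq_Diff_UNIV card_Diff_singleton)
  ultimately show ?thesis by (simp add: order_def card_Un_disjoint)
qed

lemma SL2_pow_unipotent:
  "mat2 1 b 0 1 [^]\<^bsub>SL2_F5\<^esub> (n::nat) = mat2 1 (of_nat n * b) 0 1"
  "mat2 1 0 c 1 [^]\<^bsub>SL2_F5\<^esub> (n::nat) = mat2 1 0 (of_nat n * c) 1"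
  by (induction n) (simp_all add: algebra_simps)

text \<open>The powers of the two matrices are all upper and all lower unipotents. A matrix with
  nonzero lower left entry is a product of the form upper, lower, upper; the others become of this
  kind after adding the first row to the second.\<close>

lemma SL2_generate:
  assumes "c \<noteq> 0"
  shows "generate SL2_F5 {mat2 1 1 0 1, mat2 1 0 c 1} = carrier SL2_F5" (is "generate _ ?X = _")
proof
  have X: "?X \<subseteq> carrier SL2_F5" by simp
  note H = SL2.generate_is_subgroup[OF X]
  show "generate SL2_F5 ?X \<subseteq> carrier SL2_F5" using X by (rule SL2.generate_incl)
  have u: "mat2 1 j 0 1 \<in> generate SL2_F5 ?X" for j
  proof -
    obtain n where "of_nat n * (1::5) = j" using field5_facts(2)[of 1] by auto
    then have "mat2 1 1 0 1 [^]\<^bsub>SL2_F5\<^esub> n = mat2 1 j 0 1" by (simp add: SL2_pow_unipotent)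
    then show ?thesis using SL2.subgroup_pow_closed[OF H, of "mat2 1 1 0 1" n] by (simp add: generate.incl)
  qed
  have l: "mat2 1 0 j 1 \<in> generate SL2_F5 ?X" for j
  proof -
    obtain n where "of_nat n * c = j" using field5_facts(2)[OF assms] by auto
    then have "mat2 1 0 c 1 [^]\<^bsub>SL2_F5\<^esub> n = mat2 1 0 j 1" by (simp add: SL2_pow_unipotent)
    then show ?thesis using SL2.subgroup_pow_closed[OF H, of "mat2 1 0 c 1" n] by (simp add: generate.incl)
  qed
  have m: "x ** y \<in> generate SL2_F5 ?X" if "x \<in> generate SL2_F5 ?X" "y \<in> generate SL2_F5 ?X" for x y
    using generate.eng[OF that] by simp
  have nz: "mat2 a b e d \<in> generate SL2_F5 ?X" if "a*d - b*e = 1" "e \<noteq> 0" for a b e d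
  proof -
    have "\<forall>a b e d::5. a*d - b*e = 1 \<longrightarrow> e \<noteq> 0 \<longrightarrow> 1 + (a-1)*(e*e*e)*e = a \<and>
        a*((d-1)*(e*e*e)) + (a-1)*(e*e*e) = b \<and> e*((d-1)*(e*e*e)) + 1 = d"
      by (simp add: all_5)
    then have "mat2 a b e d = (mat2 1 ((a-1)*(e*e*e)) 0 1 ** mat2 1 0 e 1) ** mat2 1 ((d-1)*(e*e*e)) 0 1"
      using that by simp
    then show ?thesis using u l m by metis
  qed
  show "carrier SL2_F5 \<subseteq> generate SL2_F5 ?X"
  proof
    fix M assume "M \<in> carrier SL2_F5"
    then obtain a b e d where M: "M = mat2 a b e d" "a*d - b*e = 1" by (rule SL2_cases)
    show "M \<in> generate SL2_F5 ?X"
    proof (cases "e = 0")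
      case True
      then have "a \<noteq> 0" using M by auto
      then have "mat2 a b a (b + d) \<in> generate SL2_F5 ?X"
        using M True by (intro nz) (simp_all add: algebra_simps)
      moreover have "M = mat2 1 0 (-1) 1 ** mat2 a b a (b + d)"
        using M True by (simp add: algebra_simps)
      ultimately show ?thesis using l m by metis
    qed (use M nz in auto)
  qed
qed

text \<open>The entries of the square are compared with those of the identity over all values. Since
  4 = -1 mod 5, the second alternative is the central matrix -I.\<close>

lemma SL2_involution:
  assumes "M \<in> carrier SL2_F5" "M ** M = mat2 1 0 0 1"
  shows "M = mat2 1 0 0 1 \<or> M = mat2 4 0 0 4"
proof -
  obtain a b c d where M: "M = mat2 a b c d" "a*d - b*c = 1" using assms(1) by (rule SL2_cases)
  have "\<forall>a b c d::5. a*d - b*c = 1 \<longrightarrow> a*a + b*c = 1 \<longrightarrow> a*b + b*d = 0 \<longrightarrow> c*a + d*c = 0 \<longrightarrow>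
      b = 0 \<and> c = 0 \<and> (a = 1 \<and> d = 1 \<or> a = 4 \<and> d = 4)"
    by (simp add: all_5)
  then show ?thesis using M assms(2) by auto
qed

definition mat_square :: "5^2^2 \<Rightarrow> 5^2^2" where
  "mat_square M = M ** M"

lemma mat_square_mat2 [simp]: "mat_square (mat2 a b c d) = mat2 (a*a + b*c) (a*b + b*d) (c*a + d*c) (c*b + d*d)"
  by (simp add: mat_square_def)

lemma SL2_pow_8: "M \<in> carrier SL2_F5 \<Longrightarrow> M [^]\<^bsub>SL2_F5\<^esub> (8::nat) = mat_square (mat_square (mat_square M))"
proof -
  assume M: "M \<in> carrier SL2_F5"
  have sq: "x [^]\<^bsub>SL2_F5\<^esub> (2::nat) = mat_square x" if "x \<in> carrier SL2_F5" for x
    using SL2.l_one[OF that] by (simp add: numeral_2_eq_2 mat_square_def)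
  have C: "mat_square x \<in> carrier SL2_F5" if "x \<in> carrier SL2_F5" for x
    unfolding sq[OF that, symmetric] using that by (rule SL2.nat_pow_closed)
  have "M [^]\<^bsub>SL2_F5\<^esub> (2*2*2::nat) = ((M [^]\<^bsub>SL2_F5\<^esub> (2::nat)) [^]\<^bsub>SL2_F5\<^esub> (2::nat)) [^]\<^bsub>SL2_F5\<^esub> (2::nat)"
    using M by (simp only: SL2.nat_pow_pow SL2.nat_pow_closed)
  also have "\<dots> = mat_square (mat_square (mat_square M))"
    using M by (simp only: sq C)
  finally show ?thesis by simp
qed

text \<open>The first eight left-hand sides are the entries of m U m^-1 and m L m^-1, where m has
  rows (a, b) and (c, d) and U, L are the upper and lower elementary matrices. Once the determinant
  is replaced by 1, each conjugate involves a single column of m, which leaves 25 cases for each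
  commutator.\<close>

lemma comm_ring_det_eqs:
  fixes a b c d :: "'a::comm_ring_1"
  assumes "a*d - b*c = 1"
  shows "a*d + (a + b)*(-c) = 1 - a*c" "a*(-b) + (a + b)*a = a*a"
    "c*d + (c + d)*(-c) = -(c*c)" "c*(-b) + (c + d)*a = 1 + a*c"
    "(a + b)*d + b*(-c) = 1 + b*d" "(a + b)*(-b) + b*a = -(b*b)"
    "(c + d)*d + d*(-c) = d*d" "(c + d)*(-b) + d*a = 1 - b*d"
    "b*c = a*d - 1" "c*b = a*d - 1"
proof -
  have *: "a*d + (a + b)*(-c) = (a*d - b*c) - a*c" "c*(-b) + (c + d)*a = (a*d - b*c) + a*c"
    "(a + b)*d + b*(-c) = (a*d - b*c) + b*d" "(c + d)*(-b) + d*a = (a*d - b*c) - b*d"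
    "b*c = a*d - (a*d - b*c)" "c*b = a*d - (a*d - b*c)"
    by (simp_all add: algebra_simps)
  show "a*d + (a + b)*(-c) = 1 - a*c" "c*(-b) + (c + d)*a = 1 + a*c"
    "(a + b)*d + b*(-c) = 1 + b*d" "(c + d)*(-b) + d*a = 1 - b*d" "b*c = a*d - 1" "c*b = a*d - 1"
    using * unfolding assms .
qed (simp_all add: algebra_simps)

text \<open>These come from the entries of the fourth power of a matrix, arranged so that b and c
  occur only in the product bc. With bc = ad - 1 they eliminate b and c from the study of elements
  of order 5.\<close>

lemma comm_ring_trace_eqs:
  fixes a b c d :: "'a::comm_ring_1"
  shows "(a*b + b*d)*(c*a + d*c) = (b*c)*((a + d)*(a + d))"
    "(c*a + d*c)*(a*b + b*d) = (b*c)*((a + d)*(a + d))"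
    "((a*a + b*c)*(a*b + b*d) + (a*b + b*d)*(c*b + d*d))*c = (b*c)*((a + d)*(a*a + b*c + (b*c + d*d)))"
    "(-b)*c = -(b*c)"
  by (simp_all add: algebra_simps)

text \<open>The commutators of a matrix with the two elementary matrices see its first and its second
  column only.\<close>

lemma SL2_noncentral_commutator:
  assumes m: "m \<in> carrier SL2_F5"
    and "\<And>g. g \<in> carrier SL2_F5 \<Longrightarrow>
      (conj_by SL2_F5 m g \<otimes>\<^bsub>SL2_F5\<^esub> inv\<^bsub>SL2_F5\<^esub> g) [^]\<^bsub>SL2_F5\<^esub> (8::nat) = \<one>\<^bsub>SL2_F5\<^esub>"
  shows "m = mat2 1 0 0 1 \<or> m = mat2 4 0 0 4"
proof -
  obtain a b c d where M: "m = mat2 a b c d" "a*d - b*c = 1" using m by (rule SL2_cases)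
  have U: "inv\<^bsub>SL2_F5\<^esub> (mat2 1 1 0 1) = mat2 1 (-1) 0 1" "inv\<^bsub>SL2_F5\<^esub> (mat2 1 0 1 1) = mat2 1 0 (-1) 1"
    by (simp_all add: SL2_inv)
  have 1: "conj_by SL2_F5 m (mat2 1 1 0 1) \<otimes>\<^bsub>SL2_F5\<^esub> inv\<^bsub>SL2_F5\<^esub> (mat2 1 1 0 1) = mat2 (1 - a*c) (a*a) (-(c*c)) (1 + a*c) ** mat2 1 (-1) 0 1"
    unfolding U conj_by_def M(1) SL2_inv[OF M(2)] SL2_mult mat2_mult comm_ring_det_eqs(1-8)[OF M(2)]
      mult_1_right mult_zero_right add_0_right add_0_left ..
  have 2: "conj_by SL2_F5 m (mat2 1 0 1 1) \<otimes>\<^bsub>SL2_F5\<^esub> inv\<^bsub>SL2_F5\<^esub> (mat2 1 0 1 1) = mat2 (1 + b*d) (-(b*b)) (d*d) (1 - b*d) ** mat2 1 0 (-1) 1"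
    unfolding U conj_by_def M(1) SL2_inv[OF M(2)] SL2_mult mat2_mult comm_ring_det_eqs(1-8)[OF M(2)]
      mult_1_right mult_zero_right add_0_right add_0_left ..
  have C: "conj_by SL2_F5 m g \<otimes>\<^bsub>SL2_F5\<^esub> inv\<^bsub>SL2_F5\<^esub> g \<in> carrier SL2_F5" if "g \<in> carrier SL2_F5" for g
    by (rule SL2.m_closed[OF SL2.conj_by_closed[OF m that] SL2.inv_closed[OF that]])
  have "mat_square (mat_square (mat_square (mat2 (1 - a*c) (a*a) (-(c*c)) (1 + a*c) ** mat2 1 (-1) 0 1))) = mat2 1 0 0 1"
    using assms(2)[of "mat2 1 1 0 1"] C[of "mat2 1 1 0 1"] unfolding 1
    by (simp add: SL2_pow_8 del: mat_square_mat2 SL2_mult mat2_mult)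
  then have ac: "c = 0 \<and> (a = 1 \<or> a = 4)"
    using exhaust_5[of a] exhaust_5[of c] by (elim disjE; hypsubst_thin; simp)
  have "mat_square (mat_square (mat_square (mat2 (1 + b*d) (-(b*b)) (d*d) (1 - b*d) ** mat2 1 0 (-1) 1))) = mat2 1 0 0 1"
    using assms(2)[of "mat2 1 0 1 1"] C[of "mat2 1 0 1 1"] unfolding 2
    by (simp add: SL2_pow_8 del: mat_square_mat2 SL2_mult mat2_mult)
  then have "b = 0 \<and> (d = 1 \<or> d = 4)"
    using exhaust_5[of b] exhaust_5[of d] by (elim disjE; hypsubst_thin; simp)
  with ac show ?thesis using M by auto
qed

text \<open>Two elements of order p are exhibited whose product has trace 3 = -2, so that the
  product is minus a unipotent matrix and its fifth power is -I. A subgroup containing all elements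
  killed by p therefore contains an involution and has even order.\<close>

lemma SL2_odd_subgroup:
  assumes N: "subgroup N SL2_F5" and odd: "odd (card N)" and p: "p = 3 \<or> p = 5"
    and mem: "\<And>x. x \<in> carrier SL2_F5 \<Longrightarrow> x [^]\<^bsub>SL2_F5\<^esub> (p::nat) = \<one>\<^bsub>SL2_F5\<^esub> \<Longrightarrow> x \<in> N"
  shows False
proof -
  let ?z = "mat2 4 0 0 4"
  have m: "x ** y \<in> N" if "x \<in> N" "y \<in> N" for x y
    using subgroup.m_closed[OF N that] by (simp only: SL2_mult)
  have z: "?z \<in> N"
  proof (cases "p = 3")
    case True
    have "mat2 0 4 1 4 [^]\<^bsub>SL2_F5\<^esub> (3::nat) = \<one>\<^bsub>SL2_F5\<^esub>" "mat2 0 1 4 4 [^]\<^bsub>SL2_F5\<^esub> (3::nat) = \<one>\<^bsub>SL2_F5\<^esub>"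
      by (simp_all add: numeral_3_eq_3)
    then have "mat2 0 4 1 4 \<in> N" "mat2 0 1 4 4 \<in> N"
      using mem[of "mat2 0 4 1 4"] mem[of "mat2 0 1 4 4"] True by simp_all
    then have "mat2 0 4 1 4 ** mat2 0 1 4 4 \<in> N" by (rule m)
    also have "mat2 0 4 1 4 ** mat2 0 1 4 4 = mat2 1 1 1 2" by simp
    finally have "mat2 1 1 1 2 [^]\<^bsub>SL2_F5\<^esub> (5::nat) \<in> N"
      by (rule SL2.subgroup_pow_closed[OF N])
    also have "mat2 1 1 1 2 [^]\<^bsub>SL2_F5\<^esub> (5::nat) = ?z"
      by (simp add: eval_nat_numeral)
    finally show ?thesis .
  next
    case False
    then have p5: "p = 5" using p by simp
    have "mat2 1 1 0 1 [^]\<^bsub>SL2_F5\<^esub> (5::nat) = \<one>\<^bsub>SL2_F5\<^esub>" "mat2 1 0 1 1 [^]\<^bsub>SL2_F5\<^esub> (5::nat) = \<one>\<^bsub>SL2_F5\<^esub>"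
      by (simp_all add: SL2_pow_unipotent)
    then have "mat2 1 1 0 1 \<in> N" "mat2 1 0 1 1 \<in> N"
      using mem[of "mat2 1 1 0 1"] mem[of "mat2 1 0 1 1"] p5 by simp_all
    then have "mat2 1 1 0 1 ** mat2 1 0 1 1 \<in> N" by (rule m)
    also have "mat2 1 1 0 1 ** mat2 1 0 1 1 = mat2 2 1 1 1" by simp
    finally have "mat2 2 1 1 1 [^]\<^bsub>SL2_F5\<^esub> (5::nat) \<in> N"
      by (rule SL2.subgroup_pow_closed[OF N])
    also have "mat2 2 1 1 1 [^]\<^bsub>SL2_F5\<^esub> (5::nat) = ?z"
      by (simp add: eval_nat_numeral)
    finally show ?thesis .
  qed
  have C: "?z \<in> carrier SL2_F5" by simp
  have "?z [^]\<^bsub>SL2_F5\<^esub> (2::nat) = \<one>\<^bsub>SL2_F5\<^esub>"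
    by (simp add: eval_nat_numeral)
  then have "SL2.ord ?z dvd 2" by (simp only: SL2.pow_eq_id[OF C])
  moreover have "SL2.ord ?z dvd card N"
    using SL2.pow_card_subgroup[OF N z] by (simp only: SL2.pow_eq_id[OF C])
  moreover have "coprime 2 (card N)" using odd by simp
  ultimately have "SL2.ord ?z = 1"
    using coprime_common_divisor_nat by blast
  then have "?z = \<one>\<^bsub>SL2_F5\<^esub>" by (simp only: SL2.ord_eq_1[OF C])
  then show False by simp
qed

section \<open>Homomorphisms and automorphisms of SL_2(F_5)\<close>

lemma hom_eq_on_generate:
  assumes "group G" "group H" "f \<in> hom G H" "g \<in> hom G H" "X \<subseteq> carrier G"
    and "\<And>x. x \<in> X \<Longrightarrow> f x = g x" "x \<in> generate G X"
  shows "f x = g x"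
proof -
  interpret f: group_hom G H f using assms by (simp add: group_hom_def group_hom_axioms_def)
  interpret g: group_hom G H g using assms by (simp add: group_hom_def group_hom_axioms_def)
  show ?thesis using assms(7)
  proof induction
    case (eng x y)
    then show ?case using f.G.generate_in_carrier[OF assms(5)] by simp
  qed (use assms(5,6) in auto)
qed

text \<open>P is an arbitrary invertible matrix, so this supplies all automorphisms coming from
  GL_2(F_5), including those that are not inner in SL_2(F_5).\<close>

lemma SL2_conj_iso:
  assumes "P ** P' = mat 1" "P' ** P = mat 1"
  shows "(\<lambda>M. P ** M ** P') \<in> iso SL2_F5 SL2_F5"
proof (rule isoI)
  have d: "det P * det P' = 1"
    using arg_cong[OF assms(1), of det] by (simp add: det_mul)
  have c: "P ** M ** P' \<in> carrier SL2_F5" if "M \<in> carrier SL2_F5" for M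
    using that d by (simp add: SL2_carrier_iff det_mul)
  have c': "P' ** M ** P \<in> carrier SL2_F5" if "M \<in> carrier SL2_F5" for M
    using that d by (simp add: SL2_carrier_iff det_mul mult.commute)
  have i: "P' ** (P ** M ** P') ** P = M" "P ** (P' ** M ** P) ** P' = M" for M
    using assms by (simp_all add: matrix_mul_assoc) (simp_all add: assms flip: matrix_mul_assoc)
  show "(\<lambda>M. P ** M ** P') \<in> hom SL2_F5 SL2_F5"
  proof (rule homI)
    fix x y
    have "P ** (x ** y) ** P' = P ** x ** (P' ** P) ** y ** P'"
      unfolding assms(2) by (simp add: matrix_mul_assoc)
    then show "P ** (x \<otimes>\<^bsub>SL2_F5\<^esub> y) ** P' = (P ** x ** P') \<otimes>\<^bsub>SL2_F5\<^esub> (P ** y ** P')"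
      by (simp add: matrix_mul_assoc)
  qed (use c in auto)
  show "bij_betw (\<lambda>M. P ** M ** P') (carrier SL2_F5) (carrier SL2_F5)"
    by (rule bij_betw_byWitness[where f' = "\<lambda>M. P' ** M ** P"]) (use c c' i in auto)
qed


text \<open>In characteristic 5 a matrix with fifth power 1 is unipotent, hence of trace 2. The
  check compares the fourth power with the inverse, eliminates b and c, and runs through the values
  of a and d.\<close>

lemma SL2_order_5_trace:
  assumes "mat2 a b c d \<in> carrier SL2_F5" "mat2 a b c d [^]\<^bsub>SL2_F5\<^esub> (5::nat) = \<one>\<^bsub>SL2_F5\<^esub>"
  shows "a + d = 2"
proof -
  let ?v = "mat2 a b c d"
  have d: "a*d - b*c = 1" using assms(1) by simp
  have "(?v [^]\<^bsub>SL2_F5\<^esub> (2::nat) \<otimes>\<^bsub>SL2_F5\<^esub> ?v [^]\<^bsub>SL2_F5\<^esub> (2::nat)) \<otimes>\<^bsub>SL2_F5\<^esub> ?v = ?v [^]\<^bsub>SL2_F5\<^esub> Suc (2 + 2)"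
    by (simp only: SL2.nat_pow_mult[OF assms(1)] SL2.nat_pow_Suc)
  also have "Suc (2 + 2) = 5" by simp
  also note assms(2)
  finally have "?v [^]\<^bsub>SL2_F5\<^esub> (2::nat) \<otimes>\<^bsub>SL2_F5\<^esub> ?v [^]\<^bsub>SL2_F5\<^esub> (2::nat) = inv\<^bsub>SL2_F5\<^esub> ?v"
    using assms(1) by (intro SL2.inv_equality[symmetric]) (simp_all del: SL2_mult mat2_mult SL2_one)
  moreover have "?v [^]\<^bsub>SL2_F5\<^esub> (2::nat) = ?v ** ?v"
    using assms(1) SL2.l_one[of ?v] by (simp add: numeral_2_eq_2)
  ultimately have "(?v ** ?v) ** (?v ** ?v) = mat2 d (-b) (-c) a"
    using SL2_inv[OF d] by simp
  then have e: "(a*a + b*c)*(a*a + b*c) + (a*b + b*d)*(c*a + d*c) = d"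
      "(c*a + d*c)*(a*b + b*d) + (c*b + d*d)*(c*b + d*d) = a"
      "(a*a + b*c)*(a*b + b*d) + (a*b + b*d)*(c*b + d*d) = -b"
    unfolding mat2_mult mat2_eq_iff by blast+
  note bc = comm_ring_det_eqs(9,10)[OF d]
  note t = comm_ring_trace_eqs(1,2,4)
  have e': "(a*a + (a*d - 1))*(a*a + (a*d - 1)) + (a*d - 1)*((a + d)*(a + d)) = d"
      "(a*d - 1)*((a + d)*(a + d)) + ((a*d - 1) + d*d)*((a*d - 1) + d*d) = a"
    using e(1,2) unfolding t bc .
  \<comment> \<open>Multiplying the equation of the upper right entry by c makes b and c occur only
    through bc.\<close>
  have "(-b)*c = (b*c)*((a + d)*(a*a + b*c + (b*c + d*d)))"
    using comm_ring_trace_eqs(3)[of a b c d] unfolding e(3) .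
  then have e3: "- (a*d - 1) = (a*d - 1)*((a + d)*(a*a + (a*d - 1) + ((a*d - 1) + d*d)))"
    unfolding t(3) bc .
  show ?thesis
    using exhaust_5[of a] exhaust_5[of d] e' e3 by (elim disjE; hypsubst_thin; simp)
qed

text \<open>Conjugation by an upper unipotent fixes the first matrix. The shift s = (1 - a)/c makes
  the upper left entry 1; trace 2 and determinant 1 then leave the lower unipotent with the same
  c.\<close>

lemma SL2_unipotent_pair:
  assumes "a*d - b*c = 1" "a + d = 2" "c \<noteq> 0"
  shows "\<exists>f\<in>iso SL2_F5 SL2_F5. f (mat2 1 1 0 1) = mat2 1 1 0 1 \<and> f (mat2 a b c d) = mat2 1 0 c 1"
proof -
  define s where "s = (1 - a)*(c*c*c)"
  have d: "d = 2 - a" using assms(2) by (simp add: eq_diff_eq add.commute)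
  have "b*(c*c*c*c) = (b*c)*(c*c*c)" by (simp only: mult.assoc)
  also have "b*c = a*d - 1" using comm_ring_det_eqs(9)[OF assms(1)] .
  finally have "b*(c*c*c*c) = (a*d - 1)*(c*c*c)" .
  then have b: "b = (a*(2 - a) - 1)*(c*c*c)"
    using field5_facts(1)[OF assms(3)] d by simp
  have "mat2 1 s 0 1 ** mat2 a b c d ** mat2 1 (-s) 0 1 = mat2 1 0 c 1"
    unfolding s_def b d
    using exhaust_5[of a] exhaust_5[of c] assms(3) by (elim disjE; hypsubst_thin; simp)
  moreover have "(\<lambda>M. mat2 1 s 0 1 ** M ** mat2 1 (-s) 0 1) \<in> iso SL2_F5 SL2_F5"
    by (rule SL2_conj_iso) (simp_all add: mat_1_eq_mat2)
  moreover have "mat2 1 s 0 1 ** mat2 1 1 0 1 ** mat2 1 (-s) 0 1 = mat2 1 1 0 1" by simp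
  ultimately show ?thesis by (intro bexI[of _ "\<lambda>M. mat2 1 s 0 1 ** M ** mat2 1 (-s) 0 1"] conjI)
qed

text \<open>Some element m of order 5 is moved out of its Sylow subgroup, so after an automorphism m
  is the upper unipotent with entry 1 and its image a lower unipotent with entry c. If c is 1 or -1,
  an element of SL_2(F_5) exchanges the two and \<open>\<beta>\<close> is inner; the non-squares 2
  and 3 are linked by passing to the square of m and rescaling. This is the origin of the constant
  2.\<close>

lemma SL2_outer_involution:
  assumes \<beta>: "\<beta> \<in> iso SL2_F5 SL2_F5" and inv: "\<And>m. m \<in> carrier SL2_F5 \<Longrightarrow> \<beta> (\<beta> m) = m"
    and out: "\<And>g. g \<in> carrier SL2_F5 \<Longrightarrow> \<exists>m\<in>carrier SL2_F5. \<beta> m \<noteq> conj_by SL2_F5 g m"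
  shows "\<exists>f\<in>iso SL2_F5 SL2_F5. \<exists>m\<in>carrier SL2_F5. f m = mat2 1 1 0 1 \<and> f (\<beta> m) = mat2 1 0 2 1"
proof -
  let ?S = "SL2_F5" and ?U = "mat2 1 1 0 1" and ?L = "mat2 1 0 1 1"
  have hom: "\<beta> \<in> hom ?S ?S" using \<beta> by (simp add: iso_def)
  interpret b: group_hom ?S ?S \<beta> by (unfold_locales) (rule hom)
  have conj_hom: "conj_by ?S g \<in> hom ?S ?S" if "g \<in> carrier ?S" for g
    using that by (intro homI) (auto simp del: SL2_mult simp: SL2.conj_by_mult)
  \<comment> \<open>The automorphism f carries m and l to a generating pair, so they generate
    themselves; if \<open>\<beta>\<close> agrees with an inner automorphism on both, it is inner,
    against \<open>out\<close>.\<close>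
  have gen: "False" if "g \<in> carrier ?S" "c \<noteq> 0" "f \<in> iso ?S ?S" "m \<in> carrier ?S" "l \<in> carrier ?S"
      "f m = ?U" "f l = mat2 1 0 c 1" "\<beta> m = conj_by ?S g m" "\<beta> l = conj_by ?S g l" for g c f m l
  proof -
    interpret f: group_hom ?S ?S f using that(3) by unfold_locales (simp add: iso_def)
    have "f ` generate ?S {m, l} = generate ?S {?U, mat2 1 0 c 1}"
      using f.generate_img[of "{m, l}"] that by simp
    then have "f ` generate ?S {m, l} = f ` carrier ?S"
      using SL2_generate[OF that(2)] that(3) by (simp add: iso_def bij_betw_def)
    then have "generate ?S {m, l} = carrier ?S"
      using that(3-5) SL2.generate_incl[of "{m, l}"] inj_on_image_eq_iff[of f "carrier ?S" "generate ?S {m, l}" "carrier ?S"]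
      by (simp add: iso_def bij_betw_def)
    then have "\<beta> x = conj_by ?S g x" if "x \<in> carrier ?S" for x
      using hom_eq_on_generate[OF SL2.is_group SL2.is_group hom conj_hom, of g "{m, l}" x] that \<open>g \<in> _\<close>
        \<open>m \<in> _\<close> \<open>l \<in> _\<close> \<open>\<beta> m = _\<close> \<open>\<beta> l = _\<close> by auto
    then show False using out[OF that(1)] by blast
  qed
  have o5: "\<beta> m [^]\<^bsub>?S\<^esub> (5::nat) = \<one>\<^bsub>?S\<^esub>" if "m \<in> carrier ?S" "m [^]\<^bsub>?S\<^esub> (5::nat) = \<one>\<^bsub>?S\<^esub>" for m
    using b.hom_nat_pow[OF that(1), of 5] b.hom_one that(2) by (simp del: SL2_one)
  have "\<beta> ?U \<in> carrier ?S" by (rule b.hom_closed) simp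
  then obtain a b c d where U: "\<beta> ?U = mat2 a b c d" "a*d - b*c = 1"
    by (rule SL2_cases)
  have trU: "a + d = 2"
    using o5[of ?U] SL2_order_5_trace[of a b c d] U by (simp add: SL2_pow_unipotent)
  have "\<beta> ?L \<in> carrier ?S" by (rule b.hom_closed) simp
  then obtain a' b' c' d' where L: "\<beta> ?L = mat2 a' b' c' d'" "a'*d' - b'*c' = 1"
    by (rule SL2_cases)
  have trL: "a' + d' = 2"
    using o5[of ?L] SL2_order_5_trace[of a' b' c' d'] L by (simp add: SL2_pow_unipotent)
  have bz: "\<beta> (mat2 4 0 0 4) = mat2 4 0 0 4"
  proof -
    let ?z = "mat2 4 0 0 4"
    have C: "?z \<in> carrier ?S" by simp
    have "\<beta> ?z ** \<beta> ?z = \<beta> (?z ** ?z)" using b.hom_mult[OF C C] by simp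
    also have "?z ** ?z = mat2 1 0 0 1" by simp
    also have "\<beta> \<dots> = mat2 1 0 0 1" using b.hom_one by simp
    finally have "\<beta> ?z = mat2 1 0 0 1 \<or> \<beta> ?z = ?z" using b.hom_closed[OF C] by (rule SL2_involution[rotated])
    moreover have "\<beta> ?z \<noteq> mat2 1 0 0 1"
    proof
      assume "\<beta> ?z = mat2 1 0 0 1"
      then have "\<beta> (\<beta> ?z) = mat2 1 0 0 1" using b.hom_one by simp
      then show False using inv[OF C] by simp
    qed
    ultimately show ?thesis by blast
  qed
  have "\<exists>c. c \<noteq> 0 \<and> (\<exists>f\<in>iso ?S ?S. \<exists>m\<in>carrier ?S. f m = ?U \<and> f (\<beta> m) = mat2 1 0 c 1)"
  proof (cases "c = 0")
    case False
    obtain f where "f\<in>iso ?S ?S" "f ?U = ?U" "f (mat2 a b c d) = mat2 1 0 c 1"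
      using SL2_unipotent_pair[OF U(2) trU False] by blast
    then show ?thesis using False U(1) by (intro exI[of _ c] conjI bexI[of _ f] bexI[of _ ?U]) auto
  next
    case c0: True
    show ?thesis
    proof (cases "b' = 0")
      case False
      let ?J = "mat2 0 1 1 0"
      have J: "(\<lambda>M. ?J ** M ** ?J) \<in> iso ?S ?S"
        by (rule SL2_conj_iso) (simp_all add: mat_1_eq_mat2)
      have "d'*a' - c'*b' = 1" "d' + a' = 2"
        using L(2) trL by (simp_all only: mult.commute add.commute)
      from SL2_unipotent_pair[OF this False] obtain f
        where f: "f\<in>iso ?S ?S" "f ?U = ?U" "f (mat2 d' c' b' a') = mat2 1 0 b' 1"
        by blast
      have "f \<circ> (\<lambda>M. ?J ** M ** ?J) \<in> iso ?S ?S" using J f(1) by (rule iso_set_trans)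
      moreover have "(f \<circ> (\<lambda>M. ?J ** M ** ?J)) ?L = ?U" using f(2) by simp
      moreover have "(f \<circ> (\<lambda>M. ?J ** M ** ?J)) (\<beta> ?L) = mat2 1 0 b' 1"
        using f(3) unfolding L(1) by simp
      ultimately show ?thesis using False by (intro exI[of _ b'] conjI bexI[of _ "f \<circ> (\<lambda>M. ?J ** M ** ?J)"] bexI[of _ ?L]) simp_all
    next
      \<comment> \<open>Now both elementary matrices are sent into their own Sylow subgroups, to the
        powers with exponents b and c'. Each exponent is 1 or -1 because \<open>\<beta>\<close> is
        an involution.\<close>
      case b0: True
      have *: "x = 1 \<and> y = 1" if "x*y = 1" "x + y = 2" for x y :: 5
        using exhaust_5[of x] exhaust_5[of y] that by (elim disjE; hypsubst_thin; simp)
      have "a = 1 \<and> d = 1" "a' = 1 \<and> d' = 1"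
        using U(2) L(2) trU trL c0 b0 *[of a d] *[of a' d'] by simp_all
      then have UL: "\<beta> ?U = mat2 1 b 0 1" "\<beta> ?L = mat2 1 0 c' 1"
        using U L c0 b0 by simp_all
      obtain n where n: "of_nat n * (1::5) = b" using field5_facts(2)[of 1] by auto
      have "mat2 1 1 0 1 = \<beta> (?U [^]\<^bsub>?S\<^esub> n)"
        using inv[of ?U] UL n by (simp add: SL2_pow_unipotent)
      also have "\<dots> = mat2 1 (b*b) 0 1"
        using b.hom_nat_pow[of ?U n] UL n by (simp add: SL2_pow_unipotent)
      finally have bb: "b*b = 1" by simp
      obtain n where n: "of_nat n * (1::5) = c'" using field5_facts(2)[of 1] by auto
      have "mat2 1 0 1 1 = \<beta> (?L [^]\<^bsub>?S\<^esub> n)"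
        using inv[of ?L] UL n by (simp add: SL2_pow_unipotent)
      also have "\<dots> = mat2 1 0 (c'*c') 1"
        using b.hom_nat_pow[of ?L n] UL n by (simp add: SL2_pow_unipotent)
      finally have cc: "c'*c' = 1" by simp
      \<comment> \<open>The product of the two elementary matrices has fifth power -I, a relation
        that \<open>\<beta>\<close> preserves. It rules out opposite signs of b and c', and equal
        signs make \<open>\<beta>\<close> inner.\<close>
      have p5: "mat2 2 1 1 1 [^]\<^bsub>?S\<^esub> (5::nat) = mat2 4 0 0 4"
        by (simp add: eval_nat_numeral)
      have "mat2 4 0 0 4 = \<beta> (mat2 2 1 1 1 [^]\<^bsub>?S\<^esub> (5::nat))"
        unfolding p5 bz ..
      also have "\<dots> = \<beta> (mat2 2 1 1 1) [^]\<^bsub>?S\<^esub> (5::nat)"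
        by (rule b.hom_nat_pow) simp
      also have "\<beta> (mat2 2 1 1 1) = mat2 (1 + b*c') b c' 1"
        using b.hom_mult[of ?U ?L] UL by simp
      finally have "mat2 (1 + b*c') b c' 1 [^]\<^bsub>?S\<^esub> (5::nat) = mat2 4 0 0 4" by simp
      then have "b = 1 \<and> c' = 1 \<or> b = 4 \<and> c' = 4"
        using exhaust_5[of b] exhaust_5[of c'] bb cc
        by (elim disjE; hypsubst_thin; simp add: eval_nat_numeral)
      then consider "b = 1" "c' = 1" | "b = 4" "c' = 4" by blast
      then have False
      proof cases
        case 1
        then show ?thesis
          using gen[of "\<one>\<^bsub>?S\<^esub>" 1 id ?U ?L] UL SL2.conj_by_one_left[of ?U] SL2.conj_by_one_left[of ?L]
          by (simp add: id_iso)
      next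
        case 2
        \<comment> \<open>Conjugation by the diagonal matrix with entries 2 and 3 multiplies both
          off-diagonal entries by 4 = -1.\<close>
        then show ?thesis
          using gen[of "mat2 2 0 0 3" 1 id ?U ?L] UL
          by (simp add: id_iso conj_by_def SL2_inv)
      qed
      then show ?thesis ..
    qed
  qed
  then obtain c f m where f: "c \<noteq> 0" "f \<in> iso ?S ?S" "m \<in> carrier ?S" "f m = ?U" "f (\<beta> m) = mat2 1 0 c 1"
    by blast
  interpret f: group_hom ?S ?S f using f(2) by unfold_locales (simp add: iso_def)
  have bij: "bij_betw f (carrier ?S) (carrier ?S)" using f(2) by (simp add: iso_def)
  \<comment> \<open>As an involution \<open>\<beta>\<close> exchanges m and
    \<open>\<beta> m\<close>. An inner automorphism exchanging their images under f is pulled back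
    by f to an inner one that agrees with \<open>\<beta>\<close> on both.\<close>
  have inner: False if g: "g \<in> carrier ?S" "conj_by ?S g ?U = mat2 1 0 c 1" "conj_by ?S g (mat2 1 0 c 1) = ?U" for g
  proof -
    have "g \<in> f ` carrier ?S" using bij g(1) by (simp add: bij_betw_def)
    then obtain h where h: "h \<in> carrier ?S" "f h = g" by blast
    have fc: "f (conj_by ?S h x) = conj_by ?S g (f x)" if "x \<in> carrier ?S" for x
      using that h by (simp add: conj_by_def del: SL2_mult)
    have "f (\<beta> m) = f (conj_by ?S h m)" "f (\<beta> (\<beta> m)) = f (conj_by ?S h (\<beta> m))"
      using f g fc inv by simp_all
    then have "\<beta> m = conj_by ?S h m" "\<beta> (\<beta> m) = conj_by ?S h (\<beta> m)"
      using bij f(3) h(1) by (auto simp: bij_betw_def inj_on_def)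
    then show False using gen[OF h(1) f(1,2,3) _ f(4,5)] b.hom_closed[OF f(3)] by blast
  qed
  have "\<forall>c::5. c \<noteq> 0 \<longrightarrow> c = 1 \<or> c = 4 \<or> c = 2 \<or> c = 3" by (simp add: all_5)
  then consider "c = 1" | "c = 4" | "c = 2" | "c = 3" using f(1) by blast
  then show ?thesis
  proof cases
    case 1
    then show ?thesis using inner[of "mat2 0 3 3 0"] by (simp add: conj_by_def SL2_inv)
  next
    case 2
    then show ?thesis using inner[of "mat2 0 1 4 0"] by (simp add: conj_by_def SL2_inv)
  next
    case 3
    then show ?thesis using f by blast
  next
    case 4
    \<comment> \<open>Squaring m turns the entries 1 and 3 into 2 and 6 = 1; conjugation by the
      diagonal matrix with entries 1 and 2 then turns these into 1 and 2.\<close>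
    let ?h = "\<lambda>M. mat2 1 0 0 2 ** M ** mat2 1 0 0 3"
    have "?h \<in> iso ?S ?S"
      by (rule SL2_conj_iso) (simp_all add: mat_1_eq_mat2)
    then have "?h \<circ> f \<in> iso ?S ?S" using f(2) by (intro iso_set_trans)
    moreover have "m ** m \<in> carrier ?S" using SL2.m_closed[OF f(3,3)] by simp
    moreover have "(?h \<circ> f) (m ** m) = ?U"
      using f.hom_mult[OF f(3,3)] f(4) by simp
    moreover have "(?h \<circ> f) (\<beta> (m ** m)) = mat2 1 0 2 1"
      using b.hom_mult[OF f(3,3)] f.hom_mult[of "\<beta> m" "\<beta> m"] f(3,5) 4 by simp
    ultimately show ?thesis by blast
  qed
qed

section \<open>Quaternion groups\<close>

text \<open>Take for t the product of the primes that divide n but not j. A prime of n dividing j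
  divides neither d nor t, and every other prime of n divides t but not j. This turns an exponent
  into a unit without leaving its class modulo d.\<close>

lemma coprime_add_multiple:
  fixes j d n :: nat
  assumes "coprime j d" "n > 0"
  shows "\<exists>t. coprime (j + d * t) n"
proof -
  define S where "S = {p \<in> prime_factors n. \<not> p dvd j}"
  have fS: "finite S" by (simp add: S_def)
  have "coprime (j + d * \<Prod>S) n"
  proof (rule ccontr)
    assume "\<not> ?thesis"
    then have "gcd (j + d * \<Prod>S) n \<noteq> 1" by (simp add: coprime_iff_gcd_eq_1)
    then obtain p where p: "prime p" "p dvd gcd (j + d * \<Prod>S) n"
      using prime_factor_nat by blast
    then have pj: "p dvd j + d * \<Prod>S" and pn: "p dvd n" by auto
    show False
    proof (cases "p dvd j")
      case True
      then have "p dvd d * \<Prod>S" using pj by (simp add: dvd_add_right_iff)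
      moreover have "\<not> p dvd d"
        using True assms(1) p(1) coprime_common_divisor_nat[of j d p] by auto
      ultimately have "p dvd \<Prod>S" using p(1) by (simp add: prime_dvd_mult_iff)
      then obtain q where q: "q \<in> S" "p dvd q"
        using prime_dvd_prod_iff[OF fS p(1), of "\<lambda>x. x"] by auto
      then have "p = q" using p(1) primes_dvd_imp_eq by (auto simp: S_def in_prime_factors_iff)
      then show False using q True by (simp add: S_def)
    next
      case False
      then have "p \<in> S" using p(1) pn assms(2) by (simp add: S_def in_prime_factors_iff)
      then have "p dvd \<Prod>S" using fS by (simp add: dvd_prodI[where f="\<lambda>x. x", simplified])
      then show False using pj False by (simp add: dvd_add_left_iff)
    qed
  qed
  then show ?thesis by blast
qed

text \<open>The presentation of \<open>is_quaternionic\<close> with chosen generators. The order of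
  x and the position of y outside the powers of x replace the generation condition, because these
  are what can be checked when generators are changed.\<close>

definition quat_gens :: "('a, 'b) monoid_scheme \<Rightarrow> 'a set \<Rightarrow> nat \<Rightarrow> 'a \<Rightarrow> 'a \<Rightarrow> bool" where
  "quat_gens G T m x y \<longleftrightarrow> subgroup T G \<and> 3 \<le> m \<and> card T = 2 ^ m \<and> x \<in> T \<and> y \<in> T \<and>
     group.ord G x = 2 ^ (m - 1) \<and> y \<notin> generate G {x} \<and> conj_by G y x = inv\<^bsub>G\<^esub> x \<and>
     y [^]\<^bsub>G\<^esub> (2::nat) = x [^]\<^bsub>G\<^esub> ((2::nat) ^ (m - 2))"

context finite_group
begin

text \<open>Counting gives at most twice ord x elements in the group generated by x and y, so the
  order 2^m forces x to have the largest order its relation allows and y to lie outside the powers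
  of x.\<close>

lemma quat_gensE:
  assumes "subgroup T G" "is_quaternionic q (G\<lparr>carrier := T\<rparr>)"
  obtains m x y where "quat_gens G T m x y" "q = 2 ^ m"
proof -
  let ?T = "G\<lparr>carrier := T\<rparr>"
  obtain m x y where m: "m \<ge> 3" "q = 2 ^ m" "order ?T = q" and xy: "x \<in> T" "y \<in> T"
    and g: "generate ?T {x, y} = T" and r: "x [^]\<^bsub>?T\<^esub> ((2::nat) ^ (m - 1)) = \<one>"
      "y \<otimes> x \<otimes> inv\<^bsub>?T\<^esub> y = inv\<^bsub>?T\<^esub> x"
      "y [^]\<^bsub>?T\<^esub> (2::nat) = x [^]\<^bsub>?T\<^esub> ((2::nat) ^ (m - 2))"
    using assms(2) unfolding is_quaternionic_def by auto
  have C: "x \<in> carrier G" "y \<in> carrier G" using xy assms(1) subgroup.subset by blast+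
  have card: "card T = 2 ^ m" using m by (simp add: order_def)
  have gen: "generate G {x, y} = T" using g generate_consistent[OF _ assms(1), of "{x, y}"] xy by simp
  have conj: "conj_by G y x = inv x" using r(2) m_inv_consistent[OF assms(1)] xy by (simp add: conj_by_def)
  have p: "x [^] ((2::nat) ^ (m - 1)) = \<one>" "y [^] (2::nat) = x [^] ((2::nat) ^ (m - 2))"
    using r(1,3) by (simp_all flip: nat_pow_consistent)
  have "card (generate G (insert y {x})) \<le> 2 * card (generate G {x})"
  proof (rule card_generate_insert_le)
    show "y [^] (2::nat) \<in> generate G {x}" using p(2) C by (simp add: generate_singleton)
    fix z assume "z \<in> {x}"
    then show "conj_by G y z \<in> generate G {x}" using conj C by (simp add: generate.inv)
  qed (use C in auto)
  then have le: "2 ^ m \<le> 2 * ord x"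
    using gen card generate_pow_card[OF C(1)] by (simp add: insert_commute)
  have "2 ^ m = 2 * (2::nat) ^ (m - 1)" using m(1) by (simp flip: power_Suc)
  moreover have "ord x dvd 2 ^ (m - 1)" using p(1) pow_eq_id[OF C(1)] by simp
  ultimately have ord: "ord x = 2 ^ (m - 1)"
    using le dvd_imp_le[of "ord x" "2 ^ (m - 1)"] by simp
  have "y \<notin> generate G {x}"
  proof
    assume "y \<in> generate G {x}"
    then have "generate G {x, y} \<subseteq> generate G {x}"
      using generate_subgroup_incl[OF _ generate_is_subgroup[of "{x}"], of "{x, y}"] C by (auto intro: generate.incl)
    then have "T \<subseteq> generate G {x}" using gen by simp
    then have "card T \<le> ord x"
      using generate_pow_card[OF C(1)] card_mono[OF finite_subgroup[OF generate_is_subgroup[of "{x}"]]] C by simp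
    then show False using card ord \<open>2 ^ m = 2 * 2 ^ (m - 1)\<close> by simp
  qed
  then have "quat_gens G T m x y"
    unfolding quat_gens_def using assms(1) m(1) card xy ord conj p(2) by simp
  then show ?thesis using that m(2) by blast
qed

context
  fixes T m x y
  assumes q: "quat_gens G T m x y"
begin

lemma quat_simps:
  shows "subgroup T G" "3 \<le> m" "card T = 2 ^ m" "x \<in> T" "y \<in> T" "ord x = 2 ^ (m - 1)"
    "y \<notin> generate G {x}" "conj_by G y x = inv x" "y [^] (2::nat) = x [^] ((2::nat) ^ (m - 2))"
    "x \<in> carrier G" "y \<in> carrier G"
  using q subgroup.subset[of T G] by (auto simp: quat_gens_def)

lemma quat_pow_eq_one: "x [^] ((2::nat) ^ (m - 1)) = \<one>"
  using pow_ord_eq_1[OF quat_simps(10)] quat_simps(6) by simp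

lemma quat_conj_pow: "conj_by G y (x [^] (i::nat)) = inv (x [^] i)"
  by (simp add: conj_by_pow quat_simps nat_pow_inv)

lemma quat_elements:
  assumes "t \<in> T"
  shows "\<exists>i::nat. t = x [^] i \<or> t = x [^] i \<otimes> y"
proof -
  define X where "X = generate G {x}"
  have X: "subgroup X G" "X \<subseteq> T" "card X = 2 ^ (m - 1)"
    using generate_is_subgroup[of "{x}"] generate_subgroup_incl[of "{x}" T] generate_pow_card[of x] quat_simps
    by (simp_all add: X_def)
  note XC = subgroup.subset[OF X(1)]
  have Y: "(\<lambda>t. t \<otimes> y) ` X \<subseteq> T"
    using X(2) quat_simps(1,5) by (auto intro: subgroup.m_closed)
  have disj: "X \<inter> (\<lambda>t. t \<otimes> y) ` X = {}"
  proof -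
    have False if "s \<in> X" "t \<in> X" "s = t \<otimes> y" for s t
    proof -
      have "inv t \<otimes> s \<in> X" using X(1) that(1,2) by (simp add: subgroup.m_closed subgroup.m_inv_closed)
      moreover have "inv t \<otimes> s = y" using that quat_simps(11) XC by auto
      ultimately have "y \<in> X" by simp
      then show False using quat_simps(7) by (simp add: X_def)
    qed
    then show ?thesis by blast
  qed
  have inj: "inj_on (\<lambda>t. t \<otimes> y) X"
    using inj_on_multc[OF quat_simps(11)] XC by (rule inj_on_subset)
  have fX: "finite X" using finite_subgroup[OF X(1)] .
  have "card (X \<union> (\<lambda>t. t \<otimes> y) ` X) = 2 * 2 ^ (m - 1)"
    using card_Un_disjoint[OF fX finite_imageI[OF fX] disj] card_image[OF inj] X(3) by simp
  also have "\<dots> = card T" using quat_simps(2,3) by (simp flip: power_Suc)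
  finally have "X \<union> (\<lambda>t. t \<otimes> y) ` X = T"
    using X(2) Y finite_subgroup[OF quat_simps(1)] by (intro card_subset_eq) auto
  then have "t \<in> X \<or> (\<exists>s\<in>X. t = s \<otimes> y)" using assms by blast
  then show ?thesis
    unfolding X_def using quat_simps(10) by (auto simp: generate_singleton)
qed

lemma quat_generate: "generate G {x, y} = T"
proof
  show "generate G {x, y} \<subseteq> T" using generate_subgroup_incl[of "{x, y}" T] quat_simps by simp
  show "T \<subseteq> generate G {x, y}"
  proof
    fix t assume "t \<in> T"
    then obtain i :: nat where "t = x [^] i \<or> t = x [^] i \<otimes> y" using quat_elements by blast
    moreover have "x [^] i \<in> generate G {x, y}"
      using subgroup_pow_closed[OF generate_is_subgroup[of "{x, y}"]] quat_simps by (simp add: generate.incl)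
    ultimately show "t \<in> generate G {x, y}" by (auto intro: generate.eng generate.incl)
  qed
qed

text \<open>Write w = x^i y. Conjugation by x^i fixes x, so w inverts x like y, and w^2 = x^i (y x^i
  y^-1) y^2 = y^2 because y inverts x^i.\<close>

lemma quat_change_y:
  assumes "w \<in> T" "w \<notin> generate G {x}"
  shows "quat_gens G T m x w"
proof -
  note C = quat_simps(10,11)
  obtain i :: nat where w: "w = x [^] i \<otimes> y"
    using quat_elements[OF assms(1)] assms(2) C(1) by (auto simp: generate_singleton)
  have "conj_by G w x = conj_by G (x [^] i) (inv x)"
    unfolding w using C quat_simps(8) by (simp add: conj_by_conj_by)
  also have "\<dots> = inv (conj_by G (x [^] i) x)" using C by (simp add: conj_by_inv)
  also have "conj_by G (x [^] i) x = x"
    using C nat_pow_Suc2[of x i] by (simp add: conj_by_eq_self_iff)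
  finally have c: "conj_by G w x = inv x" .
  have "w [^] (2::nat) = x [^] i \<otimes> (conj_by G y (x [^] i) \<otimes> (y \<otimes> y))"
    unfolding w using C by (simp add: numeral_2_eq_2 conj_by_def m_assoc)
  also have "\<dots> = y [^] (2::nat)"
    using C by (simp add: quat_conj_pow numeral_2_eq_2)
  finally have "w [^] (2::nat) = x [^] ((2::nat) ^ (m - 2))" using quat_simps(9) by simp
  then show ?thesis using q c assms by (simp add: quat_gens_def)
qed

lemma quat_pow_half_outside:
  assumes "w \<in> T" "w \<notin> generate G {x}"
  shows "w [^] (4::nat) = \<one>"
proof -
  have C: "w \<in> carrier G" using assms quat_simps(1) subgroup.subset by blast
  have "w [^] (2*2::nat) = (w [^] (2::nat)) [^] (2::nat)" using C by (simp only: nat_pow_pow)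
  also have "w [^] (2::nat) = x [^] ((2::nat) ^ (m - 2))"
    using quat_change_y[OF assms] by (simp add: quat_gens_def)
  also have "(x [^] ((2::nat) ^ (m - 2))) [^] (2::nat) = x [^] ((2::nat) ^ (m - 2) * 2)"
    using quat_simps(10) by (rule nat_pow_pow)
  also have "(2::nat) ^ (m - 2) * 2 = 2 ^ (m - 1)"
    using quat_simps(2) by (simp add: mult.commute flip: power_Suc)
  finally show ?thesis using quat_pow_eq_one by simp
qed

end

section \<open>The quaternion group of order 8 and its automorphisms\<close>

context
  fixes Q x y
  assumes q: "quat_gens G Q 3 x y"
begin

lemma q8_subset: "t \<in> Q \<Longrightarrow> t \<in> carrier G"
  using quat_simps(1)[OF q] subgroup.subset by blast

lemma q8_center:
  "x \<otimes> x \<in> Q" "x \<otimes> x \<in> carrier G" "(x \<otimes> x) \<otimes> (x \<otimes> x) = \<one>" "x \<otimes> x \<noteq> \<one>"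
  "y \<otimes> x = (x \<otimes> x) \<otimes> (x \<otimes> y)"
  "t \<in> Q \<Longrightarrow> (x \<otimes> x) \<otimes> t = t \<otimes> (x \<otimes> x)"
proof -
  note C = quat_simps(10,11)[OF q]
  show zQ: "x \<otimes> x \<in> Q" using quat_simps(1,4)[OF q] by (simp add: subgroup.m_closed)
  show zC: "x \<otimes> x \<in> carrier G" using C by simp
  have x4: "x [^] (4::nat) = \<one>" using quat_pow_eq_one[OF q] by simp
  then show zz: "(x \<otimes> x) \<otimes> (x \<otimes> x) = \<one>" using C by (simp add: eval_nat_numeral m_assoc)
  have "\<not> ord x dvd 2" using quat_simps(6)[OF q] by simp
  then have "x [^] (2::nat) \<noteq> \<one>" using pow_eq_id[OF C(1)] by blast
  then show "x \<otimes> x \<noteq> \<one>" using C by (simp add: eval_nat_numeral)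
  have inv: "inv x = x \<otimes> (x \<otimes> x)" using zz C by (intro inv_equality) (simp_all add: m_assoc)
  have "y \<otimes> x = conj_by G y x \<otimes> y" using C by (simp add: conj_by_mult_right)
  then show yx: "y \<otimes> x = (x \<otimes> x) \<otimes> (x \<otimes> y)"
    using C by (simp add: quat_simps(8)[OF q] inv m_assoc)
  have "y \<otimes> (x \<otimes> x) = (x \<otimes> x) \<otimes> y"
  proof -
    have "y \<otimes> (x \<otimes> x) = (x \<otimes> (x \<otimes> x)) \<otimes> (y \<otimes> x)" using yx C by (simp add: m_assoc flip: m_assoc[of y x x])
    also have "\<dots> = ((x \<otimes> x) \<otimes> (x \<otimes> x)) \<otimes> ((x \<otimes> x) \<otimes> y)" using C by (simp add: yx m_assoc)
    finally show ?thesis using zz C by simp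
  qed
  then have zy: "conj_by G (x \<otimes> x) y = y" using C by (simp add: conj_by_eq_self_iff)
  have zx: "conj_by G (x \<otimes> x) x = x" using C by (simp add: conj_by_eq_self_iff m_assoc)
  show "(x \<otimes> x) \<otimes> t = t \<otimes> (x \<otimes> x)" if t: "t \<in> Q"
  proof -
    obtain i :: nat where "t = x [^] i \<or> t = x [^] i \<otimes> y" using quat_elements[OF q t] by blast
    then have "conj_by G (x \<otimes> x) t = t"
      using zx zy C by (auto simp: conj_by_mult conj_by_pow)
    then show ?thesis using zC t q8_subset by (simp add: conj_by_eq_self_iff)
  qed
qed

lemma q8_square:
  assumes "t \<in> Q" "t \<noteq> \<one>" "t \<noteq> x \<otimes> x"
  shows "t \<otimes> t = x \<otimes> x"
proof (cases "t \<in> generate G {x}")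
  case True
  note C = quat_simps(10,11)[OF q]
  obtain i :: nat where i: "t = x [^] i" using True C by (auto simp: generate_singleton)
  have x4: "x [^] (4::nat) = \<one>" using quat_pow_eq_one[OF q] by simp
  have per: "x [^] k = x [^] (k mod 4)" for k :: nat
  proof -
    have "x [^] k = x [^] (4 * (k div 4) + k mod 4)" by simp
    also have "\<dots> = (x [^] (4::nat)) [^] (k div 4) \<otimes> x [^] (k mod 4)"
      using C by (simp only: nat_pow_mult nat_pow_pow)
    finally show ?thesis using x4 C by simp
  qed
  have "i mod 4 = 0 \<or> i mod 4 = 2 \<or> (i + i) mod 4 = 2" by presburger
  then show ?thesis
  proof (elim disjE)
    assume a: "(i + i) mod 4 = 2"
    have "t \<otimes> t = x [^] (i + i)" unfolding i using C by (simp add: nat_pow_mult)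
    also have "\<dots> = x [^] (2::nat)" using per[of "i + i"] a by simp
    finally show ?thesis using C by (simp add: numeral_2_eq_2)
  next
    assume "i mod 4 = 0" then show ?thesis using assms(2) i per[of i] by simp
  next
    assume "i mod 4 = 2" then show ?thesis using assms(3) i per[of i] C by (simp add: numeral_2_eq_2)
  qed
next
  case False
  from quat_change_y[OF q assms(1) False] have "t [^] (2::nat) = x [^] (2::nat)"
    by (simp add: quat_gens_def)
  then show ?thesis using quat_simps(10)[OF q] q8_subset[OF assms(1)] by (simp add: numeral_2_eq_2)
qed

text \<open>Here x x plays the role of -1, and the hypotheses say that r and s are not 1 or -1 and
  do not agree up to sign. Then r s is not 1 or -1 either, so r s and s have the same square -1, and
  comparing these squares gives s r s^-1 = r^-1.\<close>

lemma q8_change: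
  assumes r: "r \<in> Q" "r \<noteq> \<one>" "r \<noteq> x \<otimes> x" and s: "s \<in> Q" "s \<noteq> \<one>" "s \<noteq> x \<otimes> x"
    and rs: "s \<noteq> r" "s \<noteq> (x \<otimes> x) \<otimes> r"
  shows "quat_gens G Q 3 r s"
proof -
  let ?z = "x \<otimes> x"
  note C = q8_subset[OF r(1)] q8_subset[OF s(1)] and z = q8_center
  note rr = q8_square[OF r] and ss = q8_square[OF s]
  have r2: "r [^] (2::nat) = ?z" using rr C by (simp add: numeral_2_eq_2)
  have "r [^] (2*2::nat) = ?z \<otimes> ?z"
    using C by (simp add: numeral_2_eq_2 rr[symmetric] m_assoc)
  then have r4: "r [^] (4::nat) = \<one>" using z(3) by simp
  have "ord r dvd 2 ^ 2" "\<not> ord r dvd 2 ^ 1"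
    using r2 r4 z(4) pow_eq_id[OF C(1), of 4] pow_eq_id[OF C(1), of 2] by simp_all
  then have ord: "ord r = 2 ^ 2"
    by (metis dvd_power_le divides_primepow_nat two_is_prime_nat le_Suc_eq le_imp_power_dvd numeral_2_eq_2 One_nat_def)
  have ns: "s \<notin> generate G {r}"
  proof
    assume "s \<in> generate G {r}"
    then obtain i :: nat where i: "s = r [^] i" using C by (auto simp: generate_singleton)
    have "r [^] i = r [^] (4 * (i div 4) + i mod 4)" by simp
    also have "\<dots> = (r [^] (4::nat)) [^] (i div 4) \<otimes> r [^] (i mod 4)"
      using C by (simp only: nat_pow_mult nat_pow_pow)
    finally have i': "s = r [^] (i mod 4)" using i r4 C by simp
    have "i mod 4 < 4" by simp
    then consider "i mod 4 = 0" | "i mod 4 = 1" | "i mod 4 = 2" | "i mod 4 = 3" by linarith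
    then show False
    proof cases
      case 4
      then have "s = (r \<otimes> r) \<otimes> r" using i' C by (simp add: numeral_3_eq_3)
      then show False using rr rs(2) by simp
    qed (use i' C s rs r2 in simp_all)
  qed
  have "r \<otimes> s \<noteq> \<one>"
  proof
    assume "r \<otimes> s = \<one>"
    moreover have "r \<otimes> (?z \<otimes> r) = (r \<otimes> r) \<otimes> ?z"
      using z(6)[OF r(1)] C z(2) by (simp add: m_assoc)
    ultimately have "r \<otimes> s = r \<otimes> (?z \<otimes> r)" using rr z(3) by simp
    then have "s = ?z \<otimes> r" using C z(2) by (metis Units_eq Units_l_cancel m_closed)
    then show False using rs by simp
  qed
  moreover have "r \<otimes> s \<noteq> ?z" using rr C rs(1) by (metis Units_eq Units_l_cancel)
  moreover have "r \<otimes> s \<in> Q" using r s quat_simps(1)[OF q] by (simp add: subgroup.m_closed)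
  ultimately have "(r \<otimes> s) \<otimes> (r \<otimes> s) = s \<otimes> s" using q8_square ss by simp
  then have "r \<otimes> (s \<otimes> r) = s" using C by (metis m_assoc m_closed right_cancel)
  then have "r \<otimes> conj_by G s r = \<one>" using C by (simp add: conj_by_def flip: m_assoc)
  then have "conj_by G s r = inv r" using C by (metis conj_by_closed inv_equality inv_inv)
  then show ?thesis
    unfolding quat_gens_def using quat_simps(1,3)[OF q] r s ord ns r2 ss C
    by (simp add: numeral_2_eq_2)
qed

lemma q8_cases:
  assumes "t \<in> Q"
  shows "t \<in> {\<one>, x \<otimes> x, x, (x \<otimes> x) \<otimes> x, y, (x \<otimes> x) \<otimes> y, x \<otimes> y, (x \<otimes> x) \<otimes> (x \<otimes> y)}"
proof -
  note C = quat_simps(10,11)[OF q]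
  have x4: "x [^] (4::nat) = \<one>" using quat_pow_eq_one[OF q] by simp
  obtain i :: nat where i: "t = x [^] i \<or> t = x [^] i \<otimes> y" using quat_elements[OF q assms] by blast
  have "x [^] i = x [^] (4 * (i div 4) + i mod 4)" by simp
  also have "\<dots> = (x [^] (4::nat)) [^] (i div 4) \<otimes> x [^] (i mod 4)"
    using C by (simp only: nat_pow_mult nat_pow_pow)
  finally have per: "x [^] i = x [^] (i mod 4)" using x4 C by simp
  have "i mod 4 < 4" by simp
  then consider "i mod 4 = 0" | "i mod 4 = 1" | "i mod 4 = 2" | "i mod 4 = 3" by linarith
  then have "x [^] i \<in> {\<one>, x, x \<otimes> x, (x \<otimes> x) \<otimes> x}"
    by cases (use per C in \<open>simp_all add: numeral_2_eq_2 numeral_3_eq_3\<close>)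
  then show ?thesis using i C by (auto simp: m_assoc)
qed

end


text \<open>An element of odd order acts on the three cyclic subgroups of order 4 of a quaternion group
  trivially or as a 3-cycle; replacing \<open>x\<close> by its inverse fixes the signs.\<close>

lemma q8_odd_action:
  assumes q: "quat_gens G Q 3 x y" and C: "c \<in> carrier G" and n: "\<And>t. t \<in> Q \<Longrightarrow> conj_by G c t \<in> Q"
    and ord: "c [^] (n::nat) = \<one>" "odd n"
  shows "(\<forall>t\<in>Q. conj_by G c t = t) \<or>
    (\<exists>x y. quat_gens G Q 3 x y \<and> conj_by G c x = y \<and> conj_by G c y = x \<otimes> y)"
proof -
  let ?z = "x \<otimes> x"
  note QC = q8_subset[OF q] and z = q8_center[OF q]
  note sq = q8_square[OF q]
  have inj: "s = t" if "conj_by G c s = conj_by G c t" "s \<in> Q" "t \<in> Q" for s t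
    using conj_by_inj[OF C _ _ that(1)] that QC by blast
  have mQ: "s \<otimes> t \<in> Q" if "s \<in> Q" "t \<in> Q" for s t
    using quat_simps(1)[OF q] that by (simp add: subgroup.m_closed)
  have cz: "conj_by G c ?z = ?z"
  proof (rule ccontr)
    assume a: "conj_by G c ?z \<noteq> ?z"
    have "conj_by G c ?z \<noteq> \<one>" using inj[of ?z \<one>] z(1,4) C quat_simps(1)[OF q] by (auto simp: subgroup.one_closed)
    then have "conj_by G c ?z \<otimes> conj_by G c ?z = ?z" using sq[OF n[OF z(1)]] a by simp
    moreover have "conj_by G c ?z \<otimes> conj_by G c ?z = \<one>"
      using z(2,3) C by (simp flip: conj_by_mult)
    ultimately show False using z(4) by simp
  qed
  \<comment> \<open>The order of c is odd, so if c^4 fixes t then c does; cycles of length 2 and 4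
    are thereby excluded.\<close>
  have fixed: "conj_by G c t = t" if "conj_by G c (conj_by G c (conj_by G c (conj_by G c t))) = t" "t \<in> Q" for t
  proof -
    have "conj_by G (c [^] (4::nat)) t = t"
      using that C QC by (simp add: eval_nat_numeral conj_by_conj_by)
    then have "c [^] (4::nat) \<otimes> t = t \<otimes> c [^] (4::nat)"
      using C QC that by (simp add: conj_by_eq_self_iff)
    moreover have "coprime 4 n" using ord(2) coprime_power_left_iff[of 2 2 n] by simp
    ultimately have "c \<otimes> t = t \<otimes> c"
      using coprime_pow_commute[OF C QC[OF that(2)] _ ord(1)] by blast
    then show ?thesis using C QC that by (simp add: conj_by_eq_self_iff)
  qed
  have zt: "?z \<otimes> (?z \<otimes> t) = t" if "t \<in> carrier G" for t
    using z(2,3) that by (simp flip: m_assoc[of ?z ?z t])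
  have czt: "conj_by G c (?z \<otimes> t) = ?z \<otimes> conj_by G c t" if "t \<in> Q" for t
    using cz C z(2) QC[OF that] by (simp add: conj_by_mult)
  show ?thesis
  proof (cases "\<forall>t\<in>Q. conj_by G c t = t \<or> conj_by G c t = ?z \<otimes> t")
    case True
    have "conj_by G c t = t" if t: "t \<in> Q" for t
    proof -
      have *: "conj_by G c (conj_by G c s) = s" if "s \<in> Q" for s
        using True that czt[OF that] zt QC[OF that] by metis
      then show ?thesis using fixed[OF _ t] t n by simp
    qed
    then show ?thesis by blast
  next
    \<comment> \<open>Now r and its image s generate Q. The image of s can only be r s up to sign:
      the other values violate injectivity or produce a cycle of length 2 or 4.\<close>
    case False
    then obtain r where r: "r \<in> Q" "conj_by G c r \<noteq> r" "conj_by G c r \<noteq> ?z \<otimes> r" by blast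
    define s where "s = conj_by G c r"
    have rr: "r \<noteq> \<one>" "r \<noteq> ?z" using r(2) cz C by auto
    have s: "s \<in> Q" using n r(1) by (simp add: s_def)
    have ss: "s \<noteq> \<one>" "s \<noteq> ?z"
      using inj[of r \<one>] inj[of r ?z] r(1) rr cz C z(1) subgroup.one_closed[OF quat_simps(1)[OF q]]
      by (auto simp: s_def)
    have srz: "s \<noteq> r" "s \<noteq> ?z \<otimes> r" using r by (simp_all add: s_def)
    have q1: "quat_gens G Q 3 r s" by (rule q8_change[OF q r(1) rr s ss srz])
    have zr: "r \<otimes> r = ?z" by (rule sq[OF r(1) rr])
    have "conj_by G c s \<in> {\<one>, ?z, r, ?z \<otimes> r, s, ?z \<otimes> s, r \<otimes> s, ?z \<otimes> (r \<otimes> s)}"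
      using q8_cases[OF q1 n[OF s]] by (simp add: zr)
    moreover have "conj_by G c s \<noteq> \<one>" "conj_by G c s \<noteq> ?z" "conj_by G c s \<noteq> s"
      using inj[of s \<one>] inj[of s ?z] inj[of s r] s r(1) ss cz C z(1) srz subgroup.one_closed[OF quat_simps(1)[OF q]]
      by (auto simp flip: s_def)
    moreover have "conj_by G c s \<noteq> ?z \<otimes> s"
      using inj[of s "?z \<otimes> r"] s r(1) mQ z(1) srz czt[OF r(1)] by (auto simp flip: s_def)
    moreover have "conj_by G c s \<noteq> r"
    proof
      assume a: "conj_by G c s = r"
      then have "conj_by G c (conj_by G c (conj_by G c (conj_by G c r))) = r" by (simp add: s_def)
      then show False using fixed r(1,2) by blast
    qed
    moreover have "conj_by G c s \<noteq> ?z \<otimes> r"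
    proof
      assume a: "conj_by G c s = ?z \<otimes> r"
      have "conj_by G c (conj_by G c (conj_by G c (conj_by G c r))) = conj_by G c (?z \<otimes> s)"
        using a czt[OF r(1)] by (simp add: s_def)
      also have "\<dots> = r" using czt[OF s] a zt QC[OF r(1)] by simp
      finally show False using fixed r(1,2) by blast
    qed
    ultimately consider "conj_by G c s = r \<otimes> s" | "conj_by G c s = ?z \<otimes> (r \<otimes> s)" by blast
    then show ?thesis
    proof cases
      case 1 then show ?thesis using q1 s_def by blast
    next
      case 2
      have zn: "?z \<otimes> t \<noteq> \<one>" "?z \<otimes> t \<noteq> ?z" if "t \<in> Q" "t \<noteq> \<one>" "t \<noteq> ?z" for t
      proof -
        show "?z \<otimes> t \<noteq> \<one>" using zt[OF QC[OF that(1)]] that(3) z(2) by auto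
        show "?z \<otimes> t \<noteq> ?z" using zt[OF QC[OF that(1)]] that(2) z(3) by auto
      qed
      have "?z \<otimes> s \<noteq> ?z \<otimes> r" using srz(1) z(2) QC[OF r(1)] QC[OF s] by simp
      moreover have "?z \<otimes> s \<noteq> ?z \<otimes> (?z \<otimes> r)"
        using srz(2) z(2) QC[OF r(1)] QC[OF s] by simp
      ultimately have "quat_gens G Q 3 (?z \<otimes> r) (?z \<otimes> s)"
        by (rule q8_change[OF q mQ[OF z(1) r(1)] zn[OF r(1) rr] mQ[OF z(1) s] zn[OF s ss]])
      moreover have "conj_by G c (?z \<otimes> r) = ?z \<otimes> s" using czt[OF r(1)] s_def by simp
      moreover have "conj_by G c (?z \<otimes> s) = (?z \<otimes> r) \<otimes> (?z \<otimes> s)"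
      proof -
        have "conj_by G c (?z \<otimes> s) = r \<otimes> s" using czt[OF s] 2 zt QC r(1) s by simp
        also have "\<dots> = (?z \<otimes> ?z) \<otimes> (r \<otimes> s)" using z(3) QC r(1) s by simp
        also have "\<dots> = (?z \<otimes> (?z \<otimes> r)) \<otimes> s" using z(2) QC r(1) s by (simp add: m_assoc)
        also have "?z \<otimes> (?z \<otimes> r) = (?z \<otimes> r) \<otimes> ?z" using z(6)[OF mQ[OF z(1) r(1)]] by simp
        finally show ?thesis using z(2) QC r(1) s by (simp add: m_assoc)
      qed
      ultimately show ?thesis by blast
    qed
  qed
qed

lemma q8_yxy: "quat_gens G Q 3 x y \<Longrightarrow> y \<otimes> (x \<otimes> y) = x"
proof -
  assume q: "quat_gens G Q 3 x y"
  note C = quat_simps(10,11)[OF q] and z = q8_center[OF q]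
  have yy: "y \<otimes> y = x \<otimes> x" using quat_simps(9)[OF q] C by (simp add: numeral_2_eq_2)
  have "y \<otimes> (x \<otimes> y) = (y \<otimes> x) \<otimes> y" using C by (simp add: m_assoc)
  also have "\<dots> = (x \<otimes> x) \<otimes> (x \<otimes> (y \<otimes> y))" using C unfolding z(5) by (simp add: m_assoc)
  also have "\<dots> = ((x \<otimes> x) \<otimes> (x \<otimes> x)) \<otimes> x" using C by (simp add: yy m_assoc)
  finally show ?thesis using z(3) C by simp
qed

text \<open>A 3-cycle on x, y, x y would make c^3 centralize x. As the order of c is prime to 3, c
  itself would then centralize x, although it sends x to y.\<close>

lemma q8_coprime_6_action:
  assumes q: "quat_gens G Q 3 x y" and C: "c \<in> carrier G" and n: "\<And>t. t \<in> Q \<Longrightarrow> conj_by G c t \<in> Q"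
    and ord: "c [^] (n::nat) = \<one>" "odd n" "coprime n 3" and t: "t \<in> Q"
  shows "conj_by G c t = t"
proof (rule ccontr)
  assume "conj_by G c t \<noteq> t"
  then obtain x y where q: "quat_gens G Q 3 x y" and c: "conj_by G c x = y" "conj_by G c y = x \<otimes> y"
    using q8_odd_action[OF q C n ord(1,2)] t by blast
  note CC = quat_simps(10,11)[OF q]
  have "conj_by G (c [^] (3::nat)) x = x"
    using c C CC q8_yxy[OF q] by (simp add: numeral_3_eq_3 conj_by_conj_by conj_by_mult)
  then have "c [^] (3::nat) \<otimes> x = x \<otimes> c [^] (3::nat)"
    using C CC by (simp add: conj_by_eq_self_iff)
  then have "c \<otimes> x = x \<otimes> c"
    using coprime_pow_commute[OF C CC(1) _ ord(1)] ord(3) by (simp add: coprime_commute)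
  then have "y = x" using c(1) C CC by (simp flip: conj_by_eq_self_iff)
  then show False using quat_simps(7)[OF q] by (simp add: generate.incl)
qed

text \<open>Let u be the image of x under d. The relation d c = c^-1 d gives the images of y and x y
  as those of u under c^-1 and c^-2, so multiplicativity becomes a condition on u alone. It excludes
  x, y and x y; for their inverses the stated formulas hold once the generators are rotated by
  c.\<close>

lemma q8_inverted_action:
  assumes q: "quat_gens G Q 3 x y" and C: "c \<in> carrier G" "d \<in> carrier G"
    and c: "conj_by G c x = y" "conj_by G c y = x \<otimes> y"
    and d: "\<And>t. t \<in> Q \<Longrightarrow> conj_by G d t \<in> Q" "conj_by G d c = inv c"
  shows "\<exists>x y. quat_gens G Q 3 x y \<and> conj_by G c x = y \<and> conj_by G c y = x \<otimes> y \<and>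
    conj_by G d x = inv x \<and> conj_by G d y = inv (x \<otimes> y)"
proof -
  let ?z = "x \<otimes> x" and ?w = "x \<otimes> y"
  note QC = q8_subset[OF q] and z = q8_center[OF q] and CC = quat_simps(10,11)[OF q]
  note Q = quat_simps(1,4,5)[OF q]
  have mQ: "s \<otimes> t \<in> Q" if "s \<in> Q" "t \<in> Q" for s t
    using Q(1) that by (simp add: subgroup.m_closed)
  have yy: "y \<otimes> y = ?z" using quat_simps(9)[OF q] CC by (simp add: numeral_2_eq_2)
  have cw: "conj_by G c ?w = x" using c C CC q8_yxy[OF q] by (simp add: conj_by_mult)
  have swap: "conj_by G d (conj_by G c t) = conj_by G (inv c) (conj_by G d t)" if "t \<in> Q" for t
  proof -
    have "d \<otimes> c = inv c \<otimes> d" using d(2) C by (metis conj_by_mult_right)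
    then show ?thesis using C QC[OF that] by (simp flip: conj_by_conj_by)
  qed
  have zt: "?z \<otimes> (?z \<otimes> t) = t" if "t \<in> carrier G" for t
    using z(2,3) that by (simp flip: m_assoc[of ?z ?z t])
  have ci: "conj_by G (inv c) y = x" "conj_by G (inv c) ?w = y" "conj_by G (inv c) x = ?w"
    using conj_by_inv_cancel(1)[OF C(1) CC(1)] conj_by_inv_cancel(1)[OF C(1) CC(2)]
      conj_by_inv_cancel(1)[OF C(1), of ?w] c cw CC by simp_all
  have cz: "conj_by G (inv c) ?z = ?z"
  proof -
    have "conj_by G (inv c) (y \<otimes> y) = ?z" using ci(1) C CC by (simp add: conj_by_mult)
    then show ?thesis by (simp add: yy)
  qed
  have ciz: "conj_by G (inv c) (?z \<otimes> t) = ?z \<otimes> conj_by G (inv c) t" if "t \<in> carrier G" for t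
    using cz C z(2) that by (simp add: conj_by_mult)
  define u where "u = conj_by G d x"
  have uQ: "u \<in> Q" using d(1) Q by (simp add: u_def)
  note uC = QC[OF uQ]
  have dy: "conj_by G d y = conj_by G (inv c) u"
    using swap[OF Q(2)] c(1) by (simp add: u_def)
  have dw: "conj_by G d ?w = conj_by G (inv c) (conj_by G (inv c) u)"
    using swap[OF Q(3)] c(2) dy by simp
  have rel: "u \<otimes> conj_by G (inv c) u = conj_by G (inv c) (conj_by G (inv c) u)"
    using conj_by_mult[OF C(2) CC] unfolding dw dy u_def[symmetric] by (rule sym)
  have nz: "?z \<otimes> t \<noteq> t" if "t \<in> carrier G" for t
    using right_cancel[OF that z(2) one_closed] z(4) that by simp
  have inv: "inv t = ?z \<otimes> t" if "t \<in> Q" "t \<noteq> \<one>" "t \<noteq> ?z" for t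
  proof (rule inv_equality)
    have "?z \<otimes> t \<otimes> t = ?z \<otimes> (t \<otimes> t)" using z(2) QC[OF that(1)] by (simp only: m_assoc)
    then show "?z \<otimes> t \<otimes> t = \<one>" using q8_square[OF q that] z(3) by simp
  qed (use z(2) QC[OF that(1)] in auto)
  have gx: "x \<in> generate G {x}" "\<one> \<in> generate G {x}" "?z \<in> generate G {x}" "inv x \<in> generate G {x}"
    by (auto intro: generate.intros)
  have x: "x \<noteq> \<one>" "x \<noteq> ?z" using z(4) CC right_cancel[of x \<one> x] by auto
  have y: "y \<noteq> \<one>" "y \<noteq> ?z" "y \<noteq> x" "y \<noteq> inv x" using gx quat_simps(7)[OF q] by auto
  have w: "?w \<noteq> \<one>" "?w \<noteq> ?z"
    using y(3,4) CC inv_comm[of x y] inv_equality[of y x] Units_l_cancel[of x y x] by auto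
  have u1: "u \<noteq> \<one>" "u \<noteq> ?z"
  proof -
    have "u \<otimes> u = conj_by G d ?z" using C CC by (simp add: u_def conj_by_mult)
    moreover have "conj_by G d ?z \<noteq> \<one>"
      using conj_by_inj[OF C(2) z(2) one_closed] z(4) C by auto
    ultimately show "u \<noteq> ?z" using z(3) by auto
    show "u \<noteq> \<one>" unfolding u_def using conj_by_inj[OF C(2) CC(1) one_closed] x C by auto
  qed
  have "?w \<noteq> x" "?w \<noteq> y"
    using x(1) y(1) CC Units_l_cancel[of x y \<one>] right_cancel[of y x \<one>] by auto
  moreover have "x \<noteq> ?z \<otimes> ?w" "?w \<noteq> ?z \<otimes> y"
  proof
    assume "x = ?z \<otimes> ?w"
    also have "\<dots> = ?w \<otimes> ?z" by (rule z(6)[OF mQ[OF Q(2,3)]])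
    finally have "x \<otimes> \<one> = x \<otimes> (y \<otimes> ?z)" using CC by (simp add: m_assoc)
    then have "y \<otimes> ?z = \<one>" using CC by (metis Units_eq Units_l_cancel m_closed one_closed)
    then have "?z \<otimes> (?z \<otimes> y) = ?z" using z(2) z(6)[OF Q(3)] by simp
    then show False using zt[OF CC(2)] y(2) by simp
  next
    show "?w \<noteq> ?z \<otimes> y" using x(2) CC z(2) by simp
  qed
  ultimately have q2: "quat_gens G Q 3 ?w x" "quat_gens G Q 3 y ?w"
    using q8_change[OF q mQ[OF Q(2,3)] w Q(2) x] q8_change[OF q Q(3) y(1,2) mQ[OF Q(2,3)] w] by simp_all
  have wx: "?w \<otimes> x = y"
  proof -
    have "?w \<otimes> x = x \<otimes> (?z \<otimes> ?w)" using CC by (simp add: m_assoc z(5))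
    also have "\<dots> = (?z \<otimes> ?z) \<otimes> y" using CC by (simp add: m_assoc)
    finally show ?thesis using z(3) CC by simp
  qed
  note yw = q8_yxy[OF q]
  have iw: "inv x = ?z \<otimes> x" "inv y = ?z \<otimes> y" "inv ?w = ?z \<otimes> ?w"
    using inv[OF Q(2) x] inv[OF Q(3) y(1,2)] inv[OF mQ[OF Q(2,3)] w] .
  have "u \<in> {\<one>, ?z, x, ?z \<otimes> x, y, ?z \<otimes> y, ?w, ?z \<otimes> ?w}"
    using q8_cases[OF q uQ] .
  then consider "u = x" | "u = y" | "u = ?w" | "u = ?z \<otimes> x" | "u = ?z \<otimes> y" | "u = ?z \<otimes> ?w"
    using u1 by blast
  then show ?thesis
  proof cases
    case 1
    then have "x \<otimes> ?w = y" using rel ci by simp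
    then show ?thesis using nz[OF CC(2)] CC by (simp add: m_assoc)
  next
    case 2
    then have "y \<otimes> x = ?w" using rel ci by simp
    then show ?thesis using nz[of ?w] CC by (simp add: z(5))
  next
    case 3
    then have "?w \<otimes> y = x" using rel ci by simp
    then have "x \<otimes> ?z = x" using CC by (simp add: m_assoc yy)
    then show ?thesis using nz[OF CC(1)] z(6)[OF Q(2)] by simp
  next
    case 4
    then have "conj_by G d x = inv x" "conj_by G d y = inv ?w"
      using dy ciz[OF CC(1)] ci iw by (simp_all add: u_def)
    then show ?thesis using q c by blast
  next
    case 5
    then have "conj_by G d ?w = inv ?w" "conj_by G d x = inv (?w \<otimes> x)"
      using dw ciz[OF CC(2)] ciz[OF CC(1)] ci iw wx by (simp_all add: u_def)
    then show ?thesis using q2(1) cw c(1) wx by metis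
  next
    case 6
    then have "conj_by G d y = inv y" "conj_by G d ?w = inv (y \<otimes> ?w)"
      using dy dw ciz[OF CC(2)] ciz[of ?w] CC ci iw yw by (simp_all add: u_def)
    then show ?thesis using q2(2) cw c(2) yw by metis
  qed
qed

end

section \<open>Pairs of elements with the same action\<close>

definition same_action ::
  "('a, 'c) monoid_scheme \<Rightarrow> 'a \<Rightarrow> ('b, 'd) monoid_scheme \<Rightarrow> 'b \<Rightarrow> ('a \<times> 'b) set" where
  "same_action G a G' a' = {(g, g'). g \<in> carrier G \<and> g' \<in> carrier G' \<and>
     (\<exists>u::nat. conj_by G g a = a [^]\<^bsub>G\<^esub> u \<and> conj_by G' g' a' = a' [^]\<^bsub>G'\<^esub> u)}"

lemma same_action_subgroup:
  assumes "finite_group G" "finite_group G'" "a \<in> carrier G" "a' \<in> carrier G'"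
  shows "subgroup (same_action G a G' a') (G \<times>\<times> G')"
proof -
  interpret G: finite_group G by fact
  interpret G': finite_group G' by fact
  interpret P: finite_group "G \<times>\<times> G'" by (rule finite_group_DirProd) fact+
  show ?thesis
  proof (rule P.finite_subgroupI)
    show "\<one>\<^bsub>G \<times>\<times> G'\<^esub> \<in> same_action G a G' a'"
      using assms by (auto simp: same_action_def intro!: exI[of _ 1])
    fix p q assume p: "p \<in> same_action G a G' a'" and q: "q \<in> same_action G a G' a'"
    obtain g g' u where g: "p = (g, g')" "g \<in> carrier G" "g' \<in> carrier G'"
      "conj_by G g a = a [^]\<^bsub>G\<^esub> (u::nat)" "conj_by G' g' a' = a' [^]\<^bsub>G'\<^esub> u"
      using p by (auto simp: same_action_def)
    obtain h h' v where h: "q = (h, h')" "h \<in> carrier G" "h' \<in> carrier G'"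
      "conj_by G h a = a [^]\<^bsub>G\<^esub> (v::nat)" "conj_by G' h' a' = a' [^]\<^bsub>G'\<^esub> v"
      using q by (auto simp: same_action_def)
    have "conj_by G (g \<otimes>\<^bsub>G\<^esub> h) a = a [^]\<^bsub>G\<^esub> (u * v)"
      using g h assms by (simp add: G.conj_by_conj_by G.conj_by_pow G.nat_pow_pow)
    moreover have "conj_by G' (g' \<otimes>\<^bsub>G'\<^esub> h') a' = a' [^]\<^bsub>G'\<^esub> (u * v)"
      using g h assms by (simp add: G'.conj_by_conj_by G'.conj_by_pow G'.nat_pow_pow)
    ultimately show "p \<otimes>\<^bsub>G \<times>\<times> G'\<^esub> q \<in> same_action G a G' a'"
      using g h by (auto simp: same_action_def)
  qed (auto simp: same_action_def)
qed

text \<open>A pair of groups with a subgroup \<open>E\<close> of their product; \<open>E\<close> will be \<^const>\<open>same_action\<close>,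
  the fibre product of the two groups over their common image in \<open>Aut(A)\<close>.\<close>

locale group_pair = G: finite_group G + G': finite_group G'
  for G :: "('a, 'c) monoid_scheme" and G' :: "('b, 'd) monoid_scheme" +
  fixes E :: "('a \<times> 'b) set"
  assumes E: "subgroup E (G \<times>\<times> G')"
begin

sublocale P: finite_group "G \<times>\<times> G'"
  by (rule finite_group_DirProd) unfold_locales

lemma E_carrier: "(g, g') \<in> E \<Longrightarrow> g \<in> carrier G" "(g, g') \<in> E \<Longrightarrow> g' \<in> carrier G'"
  using subgroup.subset[OF E] by auto

lemma E_mult: "(g, g') \<in> E \<Longrightarrow> (h, h') \<in> E \<Longrightarrow> (g \<otimes>\<^bsub>G\<^esub> h, g' \<otimes>\<^bsub>G'\<^esub> h') \<in> E"
  using subgroup.m_closed[OF E] by fastforce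

lemma E_pow: "(g, g') \<in> E \<Longrightarrow> (g [^]\<^bsub>G\<^esub> n, g' [^]\<^bsub>G'\<^esub> (n::nat)) \<in> E"
  using P.subgroup_pow_closed[OF E] by (fastforce simp: pow_DirProd)

lemma E_inv: "(g, g') \<in> E \<Longrightarrow> (inv\<^bsub>G\<^esub> g, inv\<^bsub>G'\<^esub> g') \<in> E"
  using subgroup.m_inv_closed[OF E, of "(g, g')"] E_carrier
  by (simp add: inv_DirProd[OF G.is_group G'.is_group])

lemma E_one: "(\<one>\<^bsub>G\<^esub>, \<one>\<^bsub>G'\<^esub>) \<in> E"
  using subgroup.one_closed[OF E] by simp

lemma E_cancel_right:
  assumes "(g \<otimes>\<^bsub>G\<^esub> h, g' \<otimes>\<^bsub>G'\<^esub> h') \<in> E" "(h, h') \<in> E" "g \<in> carrier G" "g' \<in> carrier G'"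
  shows "(g, g') \<in> E"
  using E_mult[OF assms(1) E_inv[OF assms(2)]] E_carrier[OF assms(2)] assms(3,4)
  by (simp add: G.m_assoc G'.m_assoc)

lemma E_cancel_left:
  assumes "(g \<otimes>\<^bsub>G\<^esub> h, g' \<otimes>\<^bsub>G'\<^esub> h') \<in> E" "(g, g') \<in> E" "h \<in> carrier G" "h' \<in> carrier G'"
  shows "(h, h') \<in> E"
  using E_mult[OF E_inv[OF assms(2)] assms(1)] E_carrier[OF assms(2)] assms(3,4)
  by simp

text \<open>The m-th power of (g, b') lies in \<open>E\<close> because that of t' can be cancelled,
  and its n-th power is trivial; coprimality recovers (g, b'). In this way a partner of g is cut
  down to the component whose order matches that of g.\<close>

lemma E_coprime_part:
  assumes "(g, b' \<otimes>\<^bsub>G'\<^esub> t') \<in> E" "b' \<in> carrier G'" "t' \<in> carrier G'" "b' \<otimes>\<^bsub>G'\<^esub> t' = t' \<otimes>\<^bsub>G'\<^esub> b'"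
    and "g [^]\<^bsub>G\<^esub> n = \<one>\<^bsub>G\<^esub>" "b' [^]\<^bsub>G'\<^esub> n = \<one>\<^bsub>G'\<^esub>" "(\<one>\<^bsub>G\<^esub>, t' [^]\<^bsub>G'\<^esub> m) \<in> E" "coprime n (m::nat)"
  shows "(g, b') \<in> E"
proof -
  have C: "g \<in> carrier G" using E_carrier(1)[OF assms(1)] .
  have "(g [^]\<^bsub>G\<^esub> m, b' [^]\<^bsub>G'\<^esub> m \<otimes>\<^bsub>G'\<^esub> t' [^]\<^bsub>G'\<^esub> m) \<in> E"
    using E_pow[OF assms(1), of m] G'.pow_mult_distrib[OF assms(4,2,3)] by simp
  then have "(g [^]\<^bsub>G\<^esub> m \<otimes>\<^bsub>G\<^esub> \<one>\<^bsub>G\<^esub>, b' [^]\<^bsub>G'\<^esub> m \<otimes>\<^bsub>G'\<^esub> t' [^]\<^bsub>G'\<^esub> m) \<in> E"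
    using C by simp
  then have "(g, b') [^]\<^bsub>G \<times>\<times> G'\<^esub> m \<in> E"
    unfolding pow_DirProd by (rule E_cancel_right[OF _ assms(7)]) (use C assms(2) in simp_all)
  moreover have "(g, b') [^]\<^bsub>G \<times>\<times> G'\<^esub> n \<in> E"
    unfolding pow_DirProd assms(5,6) by (rule E_one)
  ultimately show ?thesis
    using P.coprime_pow_mem[OF E, of "(g, b')" n m] C assms(2,8) by simp
qed

text \<open>The two relations give (1, b'^d) in \<open>E\<close> with d = i j - 1, and j is prime to
  d. So j can be moved within its class modulo d to an exponent prime to the order of b', for which
  the power of b' is again a generator.\<close>

lemma cyclic_lift:
  assumes b: "b \<in> carrier G" "b' \<in> carrier G'" and "(b, b' [^]\<^bsub>G'\<^esub> (j::nat)) \<in> E" "(b [^]\<^bsub>G\<^esub> (i::nat), b') \<in> E"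
  shows "\<exists>k. coprime k (G'.ord b') \<and> (b, b' [^]\<^bsub>G'\<^esub> (k::nat)) \<in> E"
proof -
  \<comment> \<open>Adding the orders changes neither power and makes both exponents positive, so
    that the subtraction of 1 below is not truncated.\<close>
  define i' where "i' = i + G.ord b"
  define j' where "j' = j + G'.ord b'"
  have pos: "i' > 0" "j' > 0" using G.ord_pos[OF b(1)] G'.ord_pos[OF b(2)] by (simp_all add: i'_def j'_def)
  have j: "(b, b' [^]\<^bsub>G'\<^esub> j') \<in> E" and i: "(b [^]\<^bsub>G\<^esub> i', b') \<in> E"
    using assms by (simp_all add: i'_def j'_def flip: G.nat_pow_mult G'.nat_pow_mult)
  define d where "d = i' * j' - 1"
  have d: "j' * i' = Suc d" using pos by (simp add: d_def mult.commute)
  have "(b [^]\<^bsub>G\<^esub> i', b' [^]\<^bsub>G'\<^esub> d \<otimes>\<^bsub>G'\<^esub> b') \<in> E"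
    using E_pow[OF j, of i'] b by (simp add: G'.nat_pow_pow d)
  then have "(\<one>\<^bsub>G\<^esub> \<otimes>\<^bsub>G\<^esub> b [^]\<^bsub>G\<^esub> i', b' [^]\<^bsub>G'\<^esub> d \<otimes>\<^bsub>G'\<^esub> b') \<in> E"
    using b by simp
  then have k: "(\<one>\<^bsub>G\<^esub>, b' [^]\<^bsub>G'\<^esub> d) \<in> E"
    by (rule E_cancel_right[OF _ i]) (use b in simp_all)
  have "coprime j' d"
  proof (rule coprimeI)
    fix p assume p: "p dvd j'" "p dvd d"
    then have "p dvd Suc d" using d by (metis dvd_mult2)
    then show "is_unit p" using p(2) dvd_diff_nat[of p "Suc d" d] by simp
  qed
  then obtain t where t: "coprime (j' + d * t) (G'.ord b')"
    using coprime_add_multiple G'.ord_pos[OF b(2)] by blast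
  have "(b, b' [^]\<^bsub>G'\<^esub> (j' + d * t)) \<in> E"
    using E_mult[OF j E_pow[OF k, of t]] b by (simp add: G'.nat_pow_pow G'.nat_pow_mult)
  then show ?thesis using t by blast
qed



text \<open>Squares are paired with 1, so \<open>E\<close> is a relation between the Klein
  four-groups obtained from T and T' modulo squares, and only parities of exponents count. A
  relation with full projections on both sides can be met by suitable generators. For m at least 4
  the class of x is distinguished by the order of its elements, so x has to be matched with powers
  of x'.\<close>

lemma quaternion_lift:
  assumes q: "quat_gens G T m x y" and q': "quat_gens G' T' m x' y'"
    and T: "\<And>t. t \<in> T \<Longrightarrow> \<exists>t'\<in>T'. (t, t') \<in> E" "\<And>t'. t' \<in> T' \<Longrightarrow> \<exists>t\<in>T. (t, t') \<in> E"
    and sq: "\<And>t. t \<in> T \<Longrightarrow> (t \<otimes>\<^bsub>G\<^esub> t, \<one>\<^bsub>G'\<^esub>) \<in> E" "\<And>t'. t' \<in> T' \<Longrightarrow> (\<one>\<^bsub>G\<^esub>, t' \<otimes>\<^bsub>G'\<^esub> t') \<in> E"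
    and X: "m \<ge> 4 \<Longrightarrow> \<exists>j::nat. (x, x' [^]\<^bsub>G'\<^esub> j) \<in> E" "m \<ge> 4 \<Longrightarrow> \<exists>i::nat. (x [^]\<^bsub>G\<^esub> i, x') \<in> E"
  shows "\<exists>x'' y''. quat_gens G' T' m x'' y'' \<and> (x, x'') \<in> E \<and> (y, y'') \<in> E"
proof -
  note Q = G.quat_simps[OF q] and Q' = G'.quat_simps[OF q']
  have TC: "t \<in> carrier G" if "t \<in> T" for t using that subgroup.subset[OF Q(1)] by blast
  have TC': "t \<in> carrier G'" if "t \<in> T'" for t using that subgroup.subset[OF Q'(1)] by blast
  have m': "s \<otimes>\<^bsub>G'\<^esub> t \<in> T'" if "s \<in> T'" "t \<in> T'" for s t
    using Q'(1) that by (simp add: subgroup.m_closed)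
  have even': "(\<one>\<^bsub>G\<^esub>, t [^]\<^bsub>G'\<^esub> (2 * k::nat)) \<in> E" if "t \<in> T'" for t k
  proof -
    have "t [^]\<^bsub>G'\<^esub> (2 * k) = (t \<otimes>\<^bsub>G'\<^esub> t) [^]\<^bsub>G'\<^esub> k"
      using TC'[OF that] G'.pow_mult_distrib[of t t k] by (simp add: G'.nat_pow_mult mult_2)
    then show ?thesis using E_pow[OF sq(2)[OF that], of k] by simp
  qed
  have red': "(g, t) \<in> E" if "(g, t [^]\<^bsub>G'\<^esub> (Suc (2 * k))) \<in> E" "t \<in> T'" for g t k
  proof -
    have "(\<one>\<^bsub>G\<^esub> \<otimes>\<^bsub>G\<^esub> g, t [^]\<^bsub>G'\<^esub> (2 * k) \<otimes>\<^bsub>G'\<^esub> t) \<in> E"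
      using that E_carrier(1)[OF that(1)] by simp
    then show ?thesis
      by (rule E_cancel_left[OF _ even'[OF that(2)]]) (use E_carrier(1)[OF that(1)] TC'[OF that(2)] in auto)
  qed
  have red0': "(g, \<one>\<^bsub>G'\<^esub>) \<in> E" if "(g, t [^]\<^bsub>G'\<^esub> (2 * k::nat)) \<in> E" "t \<in> T'" for g t k
  proof -
    have "(\<one>\<^bsub>G\<^esub> \<otimes>\<^bsub>G\<^esub> g, t [^]\<^bsub>G'\<^esub> (2 * k) \<otimes>\<^bsub>G'\<^esub> \<one>\<^bsub>G'\<^esub>) \<in> E"
      using that E_carrier[OF that(1)] TC'[OF that(2)] by simp
    then show ?thesis
      by (rule E_cancel_left[OF _ even'[OF that(2)]]) (use E_carrier(1)[OF that(1)] in auto)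
  qed
  have prod: "(g, t) \<in> E" if "(g, \<one>\<^bsub>G'\<^esub>) \<in> E" "(\<one>\<^bsub>G\<^esub>, t) \<in> E" for g t
    using E_mult[OF that] E_carrier that by simp
  have one_of: "(\<one>\<^bsub>G\<^esub>, t) \<in> E" if "(x [^]\<^bsub>G\<^esub> (i::nat), t) \<in> E" "(x, \<one>\<^bsub>G'\<^esub>) \<in> E" for i t
  proof -
    have "(x [^]\<^bsub>G\<^esub> i \<otimes>\<^bsub>G\<^esub> \<one>\<^bsub>G\<^esub>, \<one>\<^bsub>G'\<^esub> \<otimes>\<^bsub>G'\<^esub> t) \<in> E"
      using that E_carrier[OF that(1)] by simp
    then show ?thesis
      by (rule E_cancel_left) (use E_pow[OF that(2), of i] E_carrier[OF that(1)] in auto)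
  qed
  have step1: "\<exists>x'' y''. quat_gens G' T' m x'' y'' \<and> (x, x'') \<in> E"
  proof (cases "m \<ge> 4")
    case True
    obtain j :: nat where j: "(x, x' [^]\<^bsub>G'\<^esub> j) \<in> E" using X(1)[OF True] by blast
    obtain i :: nat where i: "(x [^]\<^bsub>G\<^esub> i, x') \<in> E" using X(2)[OF True] by blast
    have "(x, x') \<in> E"
    proof (cases "even j")
      case True
      then obtain k where "j = 2 * k" by blast
      then have x1: "(x, \<one>\<^bsub>G'\<^esub>) \<in> E" using red0'[OF _ Q'(4)] j by simp
      show ?thesis using prod[OF x1 one_of[OF i x1]] .
    next
      case False
      then obtain k where "j = Suc (2 * k)" using oddE by fastforce
      then show ?thesis using red'[OF _ Q'(4)] j by blast
    qed
    then show ?thesis using q' by blast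
  next
    case False
    then have m3: "m = 3" using Q(2) by simp
    have q3: "quat_gens G' T' 3 x' y'" using q' m3 by simp
    let ?z = "x' \<otimes>\<^bsub>G'\<^esub> x'"
    note z = G'.q8_center[OF q3]
    have gx: "x' \<in> generate G' {x'}" "\<one>\<^bsub>G'\<^esub> \<in> generate G' {x'}" "?z \<in> generate G' {x'}" "?z \<otimes>\<^bsub>G'\<^esub> x' \<in> generate G' {x'}"
      by (auto intro: generate.intros)
    have x: "x' \<noteq> \<one>\<^bsub>G'\<^esub>" "x' \<noteq> ?z" using z(4) Q'(10) by auto
    have swap: "quat_gens G' T' 3 w x'" if w: "w \<in> T'" "w \<notin> generate G' {x'}" for w
    proof (rule G'.q8_change[OF q3 w(1) _ _ Q'(4) x])
      show "w \<noteq> \<one>\<^bsub>G'\<^esub>" "w \<noteq> ?z" "x' \<noteq> w" using w(2) gx by auto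
      show "x' \<noteq> ?z \<otimes>\<^bsub>G'\<^esub> w"
      proof
        assume "x' = ?z \<otimes>\<^bsub>G'\<^esub> w"
        then have "?z \<otimes>\<^bsub>G'\<^esub> x' = (?z \<otimes>\<^bsub>G'\<^esub> ?z) \<otimes>\<^bsub>G'\<^esub> w"
          using z(2) TC'[OF w(1)] by (simp add: G'.m_assoc)
        then show False using z(3) TC'[OF w(1)] w(2) gx(4) by simp
      qed
    qed
    obtain s where s: "s \<in> T'" "(x, s) \<in> E" using T(1)[OF Q(4)] by blast
    show ?thesis
    proof (cases "s \<in> generate G' {x'}")
      case False
      then show ?thesis using swap[OF s(1)] s(2) m3 by blast
    next
      case True
      then obtain j :: nat where j: "s = x' [^]\<^bsub>G'\<^esub> j" using Q'(10) by (auto simp: G'.generate_singleton)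
      show ?thesis
      proof (cases "even j")
        case False
        then obtain k where "j = Suc (2 * k)" using oddE by fastforce
        then have "(x, x') \<in> E" using red'[OF _ Q'(4)] j s(2) by blast
        then show ?thesis using q' by blast
      next
        case True
        then obtain k where "j = 2 * k" by blast
        then have x1: "(x, \<one>\<^bsub>G'\<^esub>) \<in> E" using red0'[OF _ Q'(4)] j s(2) by simp
        \<comment> \<open>Here x itself is paired with 1, so some element of T' outside the squares
          must be paired with 1 as well. Each element of T' is paired with 1 or with y, and if x'
          and y' both go with y, then their product goes with 1.\<close>
        have alt: "(\<one>\<^bsub>G\<^esub>, t) \<in> E \<or> (y, t) \<in> E" if t: "t \<in> T'" for t
        proof -
          obtain r where r: "r \<in> T" "(r, t) \<in> E" using T(2)[OF t] by blast
          obtain i :: nat where "r = x [^]\<^bsub>G\<^esub> i \<or> r = x [^]\<^bsub>G\<^esub> i \<otimes>\<^bsub>G\<^esub> y"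
            using G.quat_elements[OF q r(1)] by blast
          then show ?thesis
          proof
            assume "r = x [^]\<^bsub>G\<^esub> i"
            then show ?thesis using one_of[OF _ x1] r(2) by blast
          next
            assume "r = x [^]\<^bsub>G\<^esub> i \<otimes>\<^bsub>G\<^esub> y"
            then have "(x [^]\<^bsub>G\<^esub> i \<otimes>\<^bsub>G\<^esub> y, \<one>\<^bsub>G'\<^esub> \<otimes>\<^bsub>G'\<^esub> t) \<in> E" using r(2) TC'[OF t] by simp
            then have "(y, t) \<in> E"
              by (rule E_cancel_left) (use E_pow[OF x1, of i] TC'[OF t] Q(11) in auto)
            then show ?thesis ..
          qed
        qed
        consider "(\<one>\<^bsub>G\<^esub>, x') \<in> E" | "(\<one>\<^bsub>G\<^esub>, y') \<in> E" | "(y, x') \<in> E" "(y, y') \<in> E"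
          using alt[OF Q'(4)] alt[OF Q'(5)] by blast
        then show ?thesis
        proof cases
          case 1
          then show ?thesis using prod[OF x1] q' by blast
        next
          case 2
          then show ?thesis using prod[OF x1] swap[OF Q'(5,7)] m3 by blast
        next
          case 3
          have "(y \<otimes>\<^bsub>G\<^esub> y \<otimes>\<^bsub>G\<^esub> \<one>\<^bsub>G\<^esub>, \<one>\<^bsub>G'\<^esub> \<otimes>\<^bsub>G'\<^esub> (x' \<otimes>\<^bsub>G'\<^esub> y')) \<in> E"
            using E_mult[OF 3] Q(11) Q'(10,11) by simp
          then have "(\<one>\<^bsub>G\<^esub>, x' \<otimes>\<^bsub>G'\<^esub> y') \<in> E"
            by (rule E_cancel_left[OF _ sq(1)[OF Q(5)]]) (use Q'(10,11) in auto)
          moreover have "x' \<otimes>\<^bsub>G'\<^esub> y' \<notin> generate G' {x'}"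
          proof
            assume a: "x' \<otimes>\<^bsub>G'\<^esub> y' \<in> generate G' {x'}"
            have "subgroup (generate G' {x'}) G'" using Q'(10) by (intro G'.generate_is_subgroup) simp
            from subgroup.m_closed[OF this subgroup.m_inv_closed[OF this gx(1)] a] Q'(7,10,11)
            show False by simp
          qed
          ultimately show ?thesis using prod[OF x1] swap[OF m'[OF Q'(4,5)]] m3 by blast
        qed
      qed
    qed
  qed
  then obtain x2 y1 where q2: "quat_gens G' T' m x2 y1" and x2: "(x, x2) \<in> E" by blast
  note Q2 = G'.quat_simps[OF q2]
  have X2: "subgroup (generate G' {x2}) G'" using Q2(10) by (intro G'.generate_is_subgroup) simp
  obtain w where w: "w \<in> T'" "(y, w) \<in> E" using T(1)[OF Q(5)] by blast
  show ?thesis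
  proof (cases "w \<in> generate G' {x2}")
    case False
    then show ?thesis using G'.quat_change_y[OF q2 w(1)] x2 w(2) by blast
  next
    case True
    obtain r where r: "r \<in> T" "(r, y1) \<in> E" using T(2)[OF Q2(5)] by blast
    obtain k :: nat where k: "r = x [^]\<^bsub>G\<^esub> k \<or> r = x [^]\<^bsub>G\<^esub> k \<otimes>\<^bsub>G\<^esub> y"
      using G.quat_elements[OF q r(1)] by blast
    \<comment> \<open>The partner w of y lies among the powers of x2, and y1 is used to leave them.
      Removing the power of x from the partner r of y1 shows that u y1 is paired with 1 or with y;
      in the first case multiplying by w gives the partner of y that is wanted.\<close>
    define u where "u = inv\<^bsub>G'\<^esub> (x2 [^]\<^bsub>G'\<^esub> k)"
    have xk: "x2 [^]\<^bsub>G'\<^esub> k \<in> generate G' {x2}"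
      by (rule G'.subgroup_pow_closed[OF X2]) (simp add: generate.incl)
    have u: "u \<in> generate G' {x2}" "u \<in> T'"
      unfolding u_def
      by (rule subgroup.m_inv_closed[OF X2 xk], rule subgroup.m_inv_closed[OF Q2(1) G'.subgroup_pow_closed[OF Q2(1,4)]])
    note uC = TC'[OF u(2)]
    have ur: "(inv\<^bsub>G\<^esub> (x [^]\<^bsub>G\<^esub> k) \<otimes>\<^bsub>G\<^esub> r, u \<otimes>\<^bsub>G'\<^esub> y1) \<in> E"
      unfolding u_def by (rule E_mult[OF E_inv[OF E_pow[OF x2]] r(2)])
    have out: "v \<otimes>\<^bsub>G'\<^esub> y1 \<notin> generate G' {x2}" if v: "v \<in> generate G' {x2}" for v
    proof
      assume a: "v \<otimes>\<^bsub>G'\<^esub> y1 \<in> generate G' {x2}"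
      have "v \<in> carrier G'" using v subgroup.subset[OF X2] by blast
      then show False
        using subgroup.m_closed[OF X2 subgroup.m_inv_closed[OF X2 v] a] Q2(7,11) by simp
    qed
    have "\<exists>v\<in>generate G' {x2}. v \<in> T' \<and> (y, v \<otimes>\<^bsub>G'\<^esub> y1) \<in> E"
      using k
    proof
      assume "r = x [^]\<^bsub>G\<^esub> k"
      then have "(\<one>\<^bsub>G\<^esub>, u \<otimes>\<^bsub>G'\<^esub> y1) \<in> E" using ur Q(10) by simp
      then have "(y, (w \<otimes>\<^bsub>G'\<^esub> u) \<otimes>\<^bsub>G'\<^esub> y1) \<in> E"
        using E_mult[OF w(2)] Q(11) TC'[OF w(1)] uC Q2(11) by (fastforce simp: G'.m_assoc)
      then show ?thesis
        using subgroup.m_closed[OF X2 True u(1)] m'[OF w(1) u(2)] by blast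
    next
      assume "r = x [^]\<^bsub>G\<^esub> k \<otimes>\<^bsub>G\<^esub> y"
      then have "(y, u \<otimes>\<^bsub>G'\<^esub> y1) \<in> E" using ur Q(10,11) by simp
      then show ?thesis using u by blast
    qed
    then obtain v where v: "v \<in> generate G' {x2}" "v \<in> T'" "(y, v \<otimes>\<^bsub>G'\<^esub> y1) \<in> E" by blast
    then show ?thesis
      using G'.quat_change_y[OF q2 m'[OF v(2) Q2(5)] out[OF v(1)]] x2 by blast
  qed
qed

end

section \<open>Structure of the six types\<close>

lemma acts_trivially_iff: "acts_trivially G x N \<longleftrightarrow> (\<forall>n\<in>N. conj_by G x n = n)"
  by (simp add: acts_trivially_def conj_map_def conj_by_def)

lemma acts_by_inversion_iff: "acts_by_inversion G x N \<longleftrightarrow> (\<forall>n\<in>N. conj_by G x n = inv\<^bsub>G\<^esub> n)"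
  by (simp add: acts_by_inversion_def conj_map_def conj_by_def)

lemma acts_by_outer_auto_maps:
  assumes "acts_by_outer_auto G x N" "n \<in> N"
  shows "conj_by G x n \<in> N"
proof -
  have "conj_map G N x \<in> N \<rightarrow> N"
    using assms(1) by (simp add: acts_by_outer_auto_def auto_def hom_def)
  then have "conj_map G N x n \<in> N" using assms(2) by (rule funcset_mem)
  then show ?thesis using assms(2) by (simp add: conj_map_def conj_by_def)
qed

text \<open>The common shape in which the six types act on A, with z collecting what centralizes A.
  T is the 2-group in types I and II, \<open>\<Theta>\<close> in type III, the group generated by an
  element of order 4 in types IV and VI, and trivial in type V.\<close>

definition action_split :: "('a, 'c) monoid_scheme \<Rightarrow> 'a set \<Rightarrow> 'a set \<Rightarrow> 'a set \<Rightarrow> bool" where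
  "action_split G A B T \<longleftrightarrow>
     A \<lhd> G \<and> cyclic_group (G\<lparr>carrier := A\<rparr>) \<and> subgroup B G \<and> cyclic_group (G\<lparr>carrier := B\<rparr>) \<and>
     subgroup T G \<and> coprime (card B) (card T) \<and> (\<forall>b\<in>B. \<forall>t\<in>T. b \<otimes>\<^bsub>G\<^esub> t = t \<otimes>\<^bsub>G\<^esub> b) \<and>
     (\<forall>g\<in>carrier G. \<exists>z\<in>carrier G. (\<forall>a\<in>A. conj_by G z a = a) \<and>
        (\<exists>b\<in>B. \<exists>t\<in>T. g = z \<otimes>\<^bsub>G\<^esub> (b \<otimes>\<^bsub>G\<^esub> t)))"

text \<open>Together with \<open>A\<close> being a normal Hall subgroup, the last clause characterises \<open>A\<close> among the
  subgroups of \<open>G\<close>.\<close>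

definition char_A :: "('a, 'c) monoid_scheme \<Rightarrow> 'a set \<Rightarrow> bool" where
  "char_A G A \<longleftrightarrow> A \<lhd> G \<and> odd (card A) \<and> cyclic_group (G\<lparr>carrier := A\<rparr>) \<and>
     coprime (card A) (order G div card A) \<and>
     (\<forall>p N. Factorial_Ring.prime p \<and> odd p \<and> p dvd order G div card A \<and> N \<lhd> G \<longrightarrow>
        card N \<noteq> p ^ multiplicity p (order G))"

section \<open>Elementwise consequences of the six structures\<close>

context finite_group
begin

lemma AB_conditionsD:
  assumes "AB_conditions G A B"
  shows "subgroup A G" "subgroup B G" "cyclic_group (G\<lparr>carrier := A\<rparr>)" "cyclic_group (G\<lparr>carrier := B\<rparr>)"
    "odd (card A)" "odd (card B)" "coprime (card A) (card B)"
    "\<And>p P. is_sylow_of G p P B \<Longrightarrow> P \<noteq> {\<one>} \<Longrightarrow> \<exists>x\<in>P. \<exists>a\<in>A. conj_by G x a \<noteq> a"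
  using assms by (simp_all add: AB_conditions_def acts_trivially_iff)

lemma cyclic_commute:
  assumes "subgroup A G" "cyclic_group (G\<lparr>carrier := A\<rparr>)" "x \<in> A" "y \<in> A"
  shows "x \<otimes> y = y \<otimes> x"
proof -
  obtain a where a: "a \<in> A" "a \<in> carrier G" "generate G {a} = A"
    using cyclic_subgroupE[OF assms(1,2)] by metis
  then obtain i j :: nat where "x = a [^] i" "y = a [^] j"
    using assms(3,4) generate_singleton[OF a(2)] by blast
  then show ?thesis using nat_pow_comm[OF a(2)] by simp
qed

lemma subgroup_mem_carrier: "subgroup H G \<Longrightarrow> x \<in> H \<Longrightarrow> x \<in> carrier G"
  using subgroup.subset by blast

lemma coprime_subgroups_Int:
  assumes "subgroup H G" "subgroup K G" "coprime (card H) (card K)"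
  shows "H \<inter> K = {\<one>}"
proof -
  have "x = \<one>" if "x \<in> H" "x \<in> K" for x
  proof -
    have C: "x \<in> carrier G" using assms(1) that(1) by (rule subgroup_mem_carrier)
    have "ord x dvd card H" "ord x dvd card K"
      using pow_card_subgroup[OF assms(1) that(1)] pow_card_subgroup[OF assms(2) that(2)]
      by (simp_all only: pow_eq_id[OF C])
    then have "ord x = 1" using assms(3) coprime_common_divisor_nat by blast
    then show ?thesis using ord_eq_1[OF C] by simp
  qed
  then show ?thesis using assms(1,2) by (auto simp: subgroup.one_closed)
qed

lemma type_I_II_D:
  assumes AB: "AB_conditions G A B" and BT: "internal_direct G BT B T"
    and G: "internal_semidirect G (carrier G) A BT"
  shows "A \<lhd> G" "subgroup T G" "order G = card A * (card B * card T)"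
    "\<And>b t. b \<in> B \<Longrightarrow> t \<in> T \<Longrightarrow> b \<otimes> t = t \<otimes> b"
    "\<And>g. g \<in> carrier G \<Longrightarrow> \<exists>a\<in>A. \<exists>b\<in>B. \<exists>t\<in>T. g = a \<otimes> (b \<otimes> t)"
proof -
  note sd = internal_semidirectD[OF G] and d = internal_directD[OF BT]
  note dd = internal_semidirectD[OF d(1)]
  show "A \<lhd> G" using sd(2,7) by (simp add: normal_iff_conj)
  show "subgroup T G" by (rule dd(3))
  show "order G = card A * (card B * card T)" using sd(9) dd(9) by (simp add: order_def)
  show "\<And>b t. b \<in> B \<Longrightarrow> t \<in> T \<Longrightarrow> b \<otimes> t = t \<otimes> b" by (rule d(3))
  show "\<And>g. g \<in> carrier G \<Longrightarrow> \<exists>a\<in>A. \<exists>b\<in>B. \<exists>t\<in>T. g = a \<otimes> (b \<otimes> t)"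
    using sd(8) dd(8) by metis
qed

text \<open>Q and A are stable under H because their orders, 8 and an odd number, are coprime and
  their product is normal in H. B centralizes Q because its order is prime to 6.\<close>

lemma type_III_D:
  assumes "type_III_decomposition G H Q A \<Theta> B"
  shows "AB_conditions G A B" "subgroup H G" "subgroup Q G" "subgroup \<Theta> G"
    "Q \<subseteq> H" "A \<subseteq> H" "\<Theta> \<subseteq> H" "B \<subseteq> H" "card H = 8 * card A * (card \<Theta> * card B)" "card Q = 8"
    "\<exists>x y. quat_gens G Q 3 x y" "cyclic_group (G\<lparr>carrier := \<Theta>\<rparr>)" "\<exists>k. card \<Theta> = 3 ^ k"
    "\<exists>c\<in>\<Theta>. \<exists>q\<in>Q. conj_by G c q \<noteq> q" "coprime (card A) 3" "coprime (card B) 3"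
    "\<And>h q. h \<in> H \<Longrightarrow> q \<in> Q \<Longrightarrow> conj_by G h q \<in> Q"
    "\<And>h a. h \<in> H \<Longrightarrow> a \<in> A \<Longrightarrow> conj_by G h a \<in> A"
    "\<And>q a. q \<in> Q \<Longrightarrow> a \<in> A \<Longrightarrow> q \<otimes> a = a \<otimes> q"
    "\<And>c b. c \<in> \<Theta> \<Longrightarrow> b \<in> B \<Longrightarrow> c \<otimes> b = b \<otimes> c"
    "\<And>q b. q \<in> Q \<Longrightarrow> b \<in> B \<Longrightarrow> conj_by G b q = q"
    "\<And>h. h \<in> H \<Longrightarrow> \<exists>q\<in>Q. \<exists>a\<in>A. \<exists>c\<in>\<Theta>. \<exists>b\<in>B. h = (q \<otimes> a) \<otimes> (c \<otimes> b)"
proof -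
  obtain QA \<Theta>B where AB: "AB_conditions G A B" and QA: "internal_direct G QA Q A"
    and TB: "internal_direct G \<Theta>B \<Theta> B" and HH: "internal_semidirect G H QA \<Theta>B"
    and q8: "is_quaternionic 8 (G\<lparr>carrier := Q\<rparr>)"
    and rest: "cyclic_group (G\<lparr>carrier := \<Theta>\<rparr>)" "\<exists>k. card \<Theta> = 3 ^ k"
      "\<exists>c\<in>\<Theta>. \<exists>q\<in>Q. conj_by G c q \<noteq> q" "coprime (card A) 3" "coprime (card B) 3"
    using assms by (auto simp: type_III_decomposition_def acts_trivially_iff)
  show "AB_conditions G A B" by fact
  note ab = AB_conditionsD[OF AB]
  show "cyclic_group (G\<lparr>carrier := \<Theta>\<rparr>)" "\<exists>k. card \<Theta> = 3 ^ k"
    "\<exists>c\<in>\<Theta>. \<exists>q\<in>Q. conj_by G c q \<noteq> q" "coprime (card A) 3" "coprime (card B) 3" by fact+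
  note h = internal_semidirectD[OF HH]
  note qa = internal_semidirectD[OF internal_directD(1)[OF QA]]
  note tb = internal_semidirectD[OF internal_directD(1)[OF TB]]
  show "subgroup H G" by (rule h(1))
  show Q: "subgroup Q G" by (rule qa(2))
  show T: "subgroup \<Theta> G" by (rule tb(2))
  show QH: "Q \<subseteq> H" and AH: "A \<subseteq> H" and "\<Theta> \<subseteq> H" and BH: "B \<subseteq> H"
    using h(4,5) qa(4,5) tb(4,5) by blast+
  obtain m x y where qg: "quat_gens G Q m x y" "8 = (2::nat) ^ m" using quat_gensE[OF Q q8] by blast
  have "(2::nat) ^ m = 2 ^ 3" using qg(2) by simp
  then have "m = 3" using power_inject_exp[of "2::nat" m 3] by simp
  then show qe: "\<exists>x y. quat_gens G Q 3 x y" using qg(1) by blast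
  show c8: "card Q = 8" using qg by (simp add: quat_gens_def)
  show "card H = 8 * card A * (card \<Theta> * card B)"
    using h(9) qa(9) tb(9) c8 by simp
  have cop: "coprime 8 (card A)" using ab(5) coprime_power_left_iff[of 2 3 "card A"] by simp
  have QAH: "conj_by G g z \<in> QA" if "g \<in> H" "z \<in> QA" for g z using h(7) that by blast
  show nQ: "conj_by G g q \<in> Q" if "g \<in> H" "q \<in> Q" for g q
  proof (rule hall_mem_subgroup[OF qa(1) Q qa(4) qa(7)])
    have C: "g \<in> carrier G" "q \<in> carrier G" using that h(1) Q subgroup_mem_carrier by blast+
    show "conj_by G g q \<in> QA" using QAH that qa(4) by blast
    show "conj_by G g q [^] (8::nat) = \<one>"
      using C pow_card_subgroup[OF Q that(2)] c8 by (simp flip: conj_by_pow)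
  qed (use qa(9) cop in auto)
  show "conj_by G g a \<in> A" if "g \<in> H" "a \<in> A" for g a
  proof (rule hall_mem_subgroup[OF qa(1) ab(1) qa(5) internal_directD(2)[OF QA]])
    have C: "g \<in> carrier G" "a \<in> carrier G" using that h(1) ab(1) subgroup_mem_carrier by blast+
    show "conj_by G g a \<in> QA" using QAH that qa(5) by blast
    show "conj_by G g a [^] card A = \<one>"
      using C pow_card_subgroup[OF ab(1) that(2)] by (simp flip: conj_by_pow)
    show "card QA = card A * 8" using qa(9) c8 by simp
    show "coprime (card A) 8" using cop by (simp add: coprime_commute)
  qed
  show "q \<otimes> a = a \<otimes> q" if "q \<in> Q" "a \<in> A" for q a using internal_directD(3)[OF QA] that by blast
  show "c \<otimes> b = b \<otimes> c" if "c \<in> \<Theta>" "b \<in> B" for c b using internal_directD(3)[OF TB] that by blast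
  show "conj_by G b q = q" if "q \<in> Q" "b \<in> B" for q b
  proof -
    obtain x y where xy: "quat_gens G Q 3 x y" using qe by blast
    show ?thesis
    proof (rule q8_coprime_6_action[OF xy])
      show "b \<in> carrier G" using ab(2) that subgroup_mem_carrier by blast
      show "b [^] card B = \<one>" using pow_card_subgroup[OF ab(2) that(2)] .
    qed (use nQ BH that ab(6) rest(5) in auto)
  qed
  show "\<exists>q\<in>Q. \<exists>a\<in>A. \<exists>c\<in>\<Theta>. \<exists>b\<in>B. g = (q \<otimes> a) \<otimes> (c \<otimes> b)" if "g \<in> H" for g
    using h(8)[OF that] qa(8) tb(8) by metis
qed

text \<open>A is stable under H because Q commutes with A : B elementwise, so that conjugating A by
  an element of H has the same effect as conjugating it by an element of A : B.\<close>

lemma type_V_D: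
  assumes "type_V_decomposition G H Q A B"
  shows "AB_conditions G A B" "subgroup H G" "subgroup Q G" "Q \<subseteq> H" "A \<subseteq> H" "B \<subseteq> H"
    "card H = 120 * (card A * card B)" "card Q = 120" "G\<lparr>carrier := Q\<rparr> \<cong> SL2_F5"
    "coprime (card A) 15" "coprime (card B) 15"
    "\<And>h q. h \<in> H \<Longrightarrow> q \<in> Q \<Longrightarrow> conj_by G h q \<in> Q"
    "\<And>h a. h \<in> H \<Longrightarrow> a \<in> A \<Longrightarrow> conj_by G h a \<in> A"
    "\<And>q a. q \<in> Q \<Longrightarrow> a \<in> A \<Longrightarrow> q \<otimes> a = a \<otimes> q"
    "\<And>q b. q \<in> Q \<Longrightarrow> b \<in> B \<Longrightarrow> q \<otimes> b = b \<otimes> q"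
    "\<And>h. h \<in> H \<Longrightarrow> \<exists>q\<in>Q. \<exists>a\<in>A. \<exists>b\<in>B. h = q \<otimes> (a \<otimes> b)"
proof -
  obtain AB where ABc: "AB_conditions G A B" and AB: "internal_semidirect G AB A B"
    and HH: "internal_direct G H Q AB" and rest: "G\<lparr>carrier := Q\<rparr> \<cong> SL2_F5"
      "coprime (card A) 15" "coprime (card B) 15"
    using assms by (auto simp: type_V_decomposition_def)
  show "AB_conditions G A B" "G\<lparr>carrier := Q\<rparr> \<cong> SL2_F5" "coprime (card A) 15" "coprime (card B) 15" by fact+
  note ab = AB_conditionsD[OF ABc]
  note h = internal_semidirectD[OF internal_directD(1)[OF HH]]
  note s = internal_semidirectD[OF AB]
  show "subgroup H G" by (rule h(1))
  show Q: "subgroup Q G" by (rule h(2))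
  show "Q \<subseteq> H" "A \<subseteq> H" "B \<subseteq> H" using h(4,5) s(4,5) by blast+
  show c: "card Q = 120" using iso_same_card[OF rest(1)] order_SL2 by (simp add: order_def)
  show "card H = 120 * (card A * card B)" using h(9) s(9) c by simp
  show "conj_by G g q \<in> Q" if "g \<in> H" "q \<in> Q" for g q using h(7) that by blast
  have com: "q \<otimes> n = n \<otimes> q" if "q \<in> Q" "n \<in> AB" for q n using internal_directD(3)[OF HH that] .
  show "q \<otimes> a = a \<otimes> q" if "q \<in> Q" "a \<in> A" for q a using com that s(4) by blast
  show "q \<otimes> b = b \<otimes> q" if "q \<in> Q" "b \<in> B" for q b using com that s(5) by blast
  show "conj_by G g a \<in> A" if ga: "g \<in> H" "a \<in> A" for g a
  proof -
    obtain q n where qn: "q \<in> Q" "n \<in> AB" "g = q \<otimes> n" using h(8)[OF ga(1)] by blast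
    have C: "q \<in> carrier G" "n \<in> carrier G" "a \<in> carrier G"
      using qn ga Q s(1) ab(1) subgroup_mem_carrier by blast+
    have n: "conj_by G n a \<in> A" using s(7)[OF qn(2) ga(2)] .
    then have "q \<otimes> conj_by G n a = conj_by G n a \<otimes> q" using com[OF qn(1)] s(4) by blast
    then have "conj_by G g a = conj_by G n a"
      using qn C by (simp add: conj_by_conj_by conj_by_eq_self_iff)
    then show ?thesis using n by simp
  qed
  show "\<exists>q\<in>Q. \<exists>a\<in>A. \<exists>b\<in>B. g = q \<otimes> (a \<otimes> b)" if "g \<in> H" for g
    using h(8)[OF that] s(8) by metis
qed

text \<open>An element f of \<open>\<Phi>\<close> that corresponds to 1 in the integers mod 4
  represents the nontrivial coset: even powers of f lie in H, so every coset of H is that of 1 or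
  that of f.\<close>

lemma nonsplit_extension_D:
  assumes "nonsplit_extension_by_2 G H \<Phi>"
  shows "H \<lhd> G" "order G = 2 * card H"
    "\<exists>f\<in>\<Phi>. f \<in> carrier G \<and> ord f = 4 \<and> f \<notin> H \<and> f \<otimes> f \<in> H \<and>
       (\<forall>g\<in>carrier G. \<exists>h\<in>H. g = h \<or> g = h \<otimes> f)"
proof -
  have H: "H \<lhd> G" and i2: "G Mod H \<cong> integer_mod_group 2" and P: "subgroup \<Phi> G"
    and i4: "G\<lparr>carrier := \<Phi>\<rparr> \<cong> integer_mod_group 4"
    and im: "(\<lambda>x. H #> x) ` \<Phi> = carrier (G Mod H)"
    using assms by (auto simp: nonsplit_extension_by_2_def)
  show "H \<lhd> G" by fact
  interpret H: normal H G by fact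
  have S: "subgroup H G" by (rule H.subgroup_axioms)
  have c2: "card (rcosets H) = 2"
    using iso_same_card[OF i2] by (simp add: FactGroup_def carrier_integer_mod_group)
  then show "order G = 2 * card H" using lagrange[OF S] by simp
  interpret P: group "G\<lparr>carrier := \<Phi>\<rparr>" using P by (rule subgroup_imp_group)
  obtain h where h: "h \<in> iso (G\<lparr>carrier := \<Phi>\<rparr>) (integer_mod_group 4)" using i4 by (auto simp: is_iso_def)
  interpret h: group_hom "G\<lparr>carrier := \<Phi>\<rparr>" "integer_mod_group 4" h
    using h by (simp add: group_hom_def group_hom_axioms_def P.is_group iso_def)
  have bij: "bij_betw h \<Phi> {0..<4}" using h by (simp add: iso_def carrier_integer_mod_group)
  then have "1 \<in> h ` \<Phi>" by (simp add: bij_betw_def)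
  then obtain f where f: "f \<in> \<Phi>" "h f = 1" by (metis imageE)
  have fC: "f \<in> carrier G" using P f(1) by (rule subgroup_mem_carrier)
  have hp: "h (f [^] (k::nat)) = int k mod 4" for k
    using h.hom_nat_pow[of f k] f by (simp flip: nat_pow_consistent)
  have inj: "f [^] (k::nat) = f [^] (l::nat)" if "int k mod 4 = int l mod 4" for k l
    using bij hp that subgroup_pow_closed[OF P f(1)] unfolding bij_betw_def by (metis inj_onD)
  have "f [^] k = \<one> \<longleftrightarrow> 4 dvd k" for k :: nat
  proof
    assume "f [^] k = \<one>"
    then have "int k mod 4 = 0" using hp[of k] h.hom_one by simp
    then show "4 dvd k" by presburger
  next
    assume "4 dvd k"
    then have "int k mod 4 = int 0 mod 4" by presburger
    then show "f [^] k = \<one>" using inj[of k 0] by simp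
  qed
  then have ord: "ord f = 4" using ord_unique[OF fC] by blast
  have gen: "\<exists>k::nat. p = f [^] k" if "p \<in> \<Phi>" for p
  proof -
    have "h p \<in> {0..<4}" using bij that by (auto simp: bij_betw_def)
    then have "h (f [^] nat (h p)) = h p" unfolding hp by simp
    then show ?thesis
      using bij that subgroup_pow_closed[OF P f(1)] unfolding bij_betw_def by (metis inj_onD)
  qed
  have ff: "f \<otimes> f \<in> H"
  proof -
    interpret F: group "G Mod H" by (rule H.factorgroup_is_group)
    have "(H #> f) [^]\<^bsub>G Mod H\<^esub> order (G Mod H) = \<one>\<^bsub>G Mod H\<^esub>"
      using fC by (intro F.pow_order_eq_1) (auto simp: carrier_FactGroup)
    then have "H #> (f [^] (2::nat)) = H"
      using H.FactGroup_pow[OF fC, of 2] c2 by (simp add: order_def FactGroup_def)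
    then show ?thesis using rcos_self[OF _ S, of "f [^] (2::nat)"] fC by (simp add: numeral_2_eq_2)
  qed
  have dec: "\<exists>h\<in>H. g = h \<or> g = h \<otimes> f" if g: "g \<in> carrier G" for g
  proof -
    have "H #> g \<in> (\<lambda>x. H #> x) ` \<Phi>" using im g by (auto simp: carrier_FactGroup)
    then obtain p where p: "p \<in> \<Phi>" "H #> g = H #> p" by blast
    obtain k :: nat where k: "p = f [^] k" using gen p(1) by blast
    have "g \<in> H #> p" using p(2) rcos_self[OF g S] by simp
    then obtain u where u: "u \<in> H" "g = u \<otimes> p" by (auto simp: r_coset_def)
    have ev: "f [^] (2 * l) \<in> H" for l :: nat
    proof -
      have "f [^] (2 * l) = (f \<otimes> f) [^] l"
        using fC pow_mult_distrib[of f f l] by (simp add: nat_pow_mult mult_2)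
      then show ?thesis using subgroup_pow_closed[OF S ff] by simp
    qed
    have HC: "v \<in> carrier G" if "v \<in> H" for v using S that by (rule subgroup_mem_carrier)
    show ?thesis
    proof (cases "even k")
      case True
      then obtain l where "k = 2 * l" by blast
      then show ?thesis using u k ev S by (auto intro: subgroup.m_closed)
    next
      case False
      then obtain l where "k = Suc (2 * l)" using oddE by fastforce
      then have "g = (u \<otimes> f [^] (2 * l)) \<otimes> f" using u k fC HC by (simp add: m_assoc)
      then show ?thesis using subgroup.m_closed[OF S u(1) ev] by blast
    qed
  qed
  have "f \<notin> H"
  proof
    assume "f \<in> H"
    then have "carrier G \<subseteq> H" using dec S by (auto dest: subgroup.m_closed)
    then have "card H = order G" using subgroup.subset[OF S] by (simp add: order_def antisym)
    then show False using \<open>order G = 2 * card H\<close> order_pos by simp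
  qed
  then show "\<exists>f\<in>\<Phi>. f \<in> carrier G \<and> ord f = 4 \<and> f \<notin> H \<and> f \<otimes> f \<in> H \<and>
       (\<forall>g\<in>carrier G. \<exists>h\<in>H. g = h \<or> g = h \<otimes> f)"
    using f(1) fC ord ff dec by blast
qed

text \<open>Suppose p divides |A| and the index of A'. The Sylow p-subgroup of the cyclic group A is
  normal in G, as conjugation raises its elements to powers, and it is a Sylow subgroup of G since A
  is a Hall subgroup; this contradicts the last clause for A'. So |A| is prime to the index of A',
  and A lies in A'.\<close>

lemma char_A_unique_aux:
  assumes "char_A G A" "char_A G A'"
  shows "A \<subseteq> A'"
proof -
  note A = assms(1)[unfolded char_A_def] and A' = assms(2)[unfolded char_A_def]
  have S: "subgroup A G" "subgroup A' G" using A A' normal_imp_subgroup by blast+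
  define m' where "m' = order G div card A'"
  have o: "order G = card A * (order G div card A)" "order G = card A' * m'"
    using card_subgroup_dvd S by (simp_all add: m'_def)
  have "coprime (card A) m'"
  proof (rule ccontr)
    assume "\<not> coprime (card A) m'"
    then have "gcd (card A) m' \<noteq> 1" by (simp add: coprime_iff_gcd_eq_1)
    then obtain p where "prime p" "p dvd gcd (card A) m'" using prime_factor_nat by blast
    then have p: "prime p" "p dvd card A" "p dvd m'" by auto
    have "odd p" using p(2) A by (meson dvd_trans)
    have np: "\<not> p dvd order G div card A"
      using p(1,2) A coprime_common_divisor_nat[of "card A" "order G div card A" p] by auto
    have nz: "card A \<noteq> 0" "order G div card A \<noteq> 0" using card_subgroup_pos[OF S(1)] o(1) order_pos by (simp, metis mult_0_right neq0_conv)
    have mult: "multiplicity p (order G) = multiplicity p (card A)"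
      using prime_elem_multiplicity_mult_distrib[of p "card A" "order G div card A"] nz p(1) o(1)
        not_dvd_imp_multiplicity_0[OF np] by simp
    obtain r where r: "card A = p ^ multiplicity p (card A) * r"
      using multiplicity_dvd by blast
    interpret AA: finite_group "G\<lparr>carrier := A\<rparr>" by (rule subgroup_finite_group[OF S(1)])
    have "order (G\<lparr>carrier := A\<rparr>) = p ^ multiplicity p (card A) * r" using r by (simp add: order_def)
    from sylow_thm[OF p(1) AA.is_group this AA.fin] obtain N
      where N: "subgroup N (G\<lparr>carrier := A\<rparr>)" "card N = p ^ multiplicity p (card A)" by blast
    have NG: "subgroup N G" using incl_subgroup[OF S(1) N(1)] .
    have NA: "N \<subseteq> A" using subgroup.subset[OF N(1)] by simp
    obtain a where a: "a \<in> A" "a \<in> carrier G" "generate G {a} = A"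
      using cyclic_subgroupE[OF S(1)] A by metis
    have "N \<lhd> G" unfolding normal_iff_conj
    proof (intro conjI ballI)
      fix g n assume g: "g \<in> carrier G" and n: "n \<in> N"
      have "conj_by G g a \<in> A" using A normal_conj_closed g a(1) by blast
      then obtain u :: nat where u: "conj_by G g a = a [^] u"
        using a generate_singleton by blast
      obtain k :: nat where k: "n = a [^] k" using n NA a generate_singleton by blast
      have "conj_by G g n = n [^] u"
        unfolding k using u a(2) g by (simp add: conj_by_pow nat_pow_pow mult.commute)
      then show "conj_by G g n \<in> N" using subgroup_pow_closed[OF NG n] by simp
    qed (rule NG)
    then show False
      using A' p(1,3) \<open>odd p\<close> N(2) mult unfolding m'_def by metis
  qed
  then show "A \<subseteq> A'"
    using hall_mem[of A' m' _ "card A"] A' o(2) pow_card_subgroup[OF S(1)] subgroup_mem_carrier[OF S(1)]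
    by blast
qed

lemma char_A_unique: "char_A G A \<Longrightarrow> char_A G A' \<Longrightarrow> A = A'"
  using char_A_unique_aux by blast

text \<open>For a prime p dividing |B|, a normal Sylow p-subgroup of G would contain a Sylow
  p-subgroup of B and meet A trivially, hence centralize A, against the condition on B. The primes
  dividing m depend on the type and are left to the hypothesis \<open>np\<close>.\<close>

lemma char_AI:
  assumes AB: "AB_conditions G A B" and nA: "A \<lhd> G" and o: "order G = card A * (card B * m)"
    and m: "coprime (card A) m"
    and np: "\<And>p N. Factorial_Ring.prime p \<Longrightarrow> odd p \<Longrightarrow> p dvd m \<Longrightarrow> N \<lhd> G \<Longrightarrow>
      card N = p ^ multiplicity p (order G) \<Longrightarrow> False"
  shows "char_A G A"
proof -
  note ab = AB_conditionsD[OF AB]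
  have d: "order G div card A = card B * m"
    using o card_subgroup_pos[OF ab(1)] by simp
  have "coprime (card A) (card B * m)" using ab(7) m by simp
  moreover have "card N \<noteq> p ^ multiplicity p (order G)"
    if p: "Factorial_Ring.prime p" "odd p" "p dvd card B * m" and N: "N \<lhd> G" for p N
  proof
    assume c: "card N = p ^ multiplicity p (order G)"
    have "p dvd card B" using p np[OF p(1,2) _ N c] by (auto simp: prime_dvd_mult_iff)
    note SN = normal_imp_subgroup[OF N]
    have pA: "\<not> p dvd card A"
      using \<open>p dvd card B\<close> ab(7) p(1) coprime_common_divisor_nat[of "card A" "card B" p] by auto
    obtain r where r: "card B = p ^ multiplicity p (card B) * r" using multiplicity_dvd by blast
    interpret BB: finite_group "G\<lparr>carrier := B\<rparr>" by (rule subgroup_finite_group[OF ab(2)])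
    have "order (G\<lparr>carrier := B\<rparr>) = p ^ multiplicity p (card B) * r" using r by (simp add: order_def)
    from sylow_thm[OF p(1) BB.is_group this BB.fin] obtain P
      where P: "subgroup P (G\<lparr>carrier := B\<rparr>)" "card P = p ^ multiplicity p (card B)" by blast
    have PG: "subgroup P G" using incl_subgroup[OF ab(2) P(1)] .
    have "multiplicity p (card B) > 0"
      using \<open>p dvd card B\<close> p(1) card_subgroup_pos[OF ab(2)] by (simp add: prime_multiplicity_gt_zero_iff)
    then have "card P > 1" using P(2) one_less_power[OF prime_gt_1_nat[OF p(1)]] by simp
    then have "P \<noteq> {\<one>}" by auto
    then obtain x a where x: "x \<in> P" "a \<in> A" "conj_by G x a \<noteq> a"
      using ab(8)[of p P] P p(1) by (auto simp: is_sylow_of_def)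
    have C: "x \<in> carrier G" "a \<in> carrier G"
      using x PG ab(1) subgroup_mem_carrier by blast+
    obtain s where s: "order G = card N * s" using card_subgroup_dvd[OF SN] by blast
    have "\<not> p dvd s"
    proof
      assume "p dvd s"
      then have "p ^ Suc (multiplicity p (order G)) dvd order G"
        unfolding s using c s by (metis mult.commute mult_dvd_mono dvd_refl power_Suc)
      then show False
        using order_pos p(1) by (metis Suc_n_not_le_n multiplicity_geI not_prime_unit neq0_conv)
    qed
    then have "coprime (card P) s"
      using P(2) p(1) by (simp add: prime_imp_coprime)
    then have "x \<in> N" using hall_mem[OF N s C(1) pow_card_subgroup[OF PG x(1)]] by blast
    have "coprime (card N) (card A)" using c pA p(1) by (simp add: prime_imp_coprime)
    then have "N \<inter> A = {\<one>}" using coprime_subgroups_Int[OF SN ab(1)] by blast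
    then have "x \<otimes> a = a \<otimes> x"
      using disjoint_normal_commute[OF SN \<open>x \<in> N\<close> _ ab(1) x(2)] normal_conj_closed[OF N C(2) \<open>x \<in> N\<close>]
        normal_conj_closed[OF nA C(1) x(2)] by blast
    then show False using x(3) C by (simp add: conj_by_eq_self_iff)
  qed
  ultimately show ?thesis
    unfolding char_A_def d using nA ab(3,5) by blast
qed

end

section \<open>Isomorphism invariance of the type\<close>

definition has_normal_2_complement :: "('a, 'c) monoid_scheme \<Rightarrow> bool" where
  "has_normal_2_complement G \<longleftrightarrow> (\<exists>N. N \<lhd> G \<and> odd (card N) \<and> (\<exists>k. order G = card N * 2 ^ k))"

text \<open>Encoded by one element whose order is the full power of 2 dividing the group order, so
  that transport along an isomorphism only concerns orders of elements.\<close>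

definition has_cyclic_2_sylow :: "('a, 'c) monoid_scheme \<Rightarrow> bool" where
  "has_cyclic_2_sylow G \<longleftrightarrow> (\<exists>t\<in>carrier G. \<exists>k. group.ord G t = 2 ^ k \<and> odd (order G div 2 ^ k))"

definition has_normal_8 :: "('a, 'c) monoid_scheme \<Rightarrow> bool" where
  "has_normal_8 G \<longleftrightarrow> (\<exists>N. N \<lhd> G \<and> card N = 8)"

text \<open>In types I and II the 2-group T is a complement of the odd normal subgroup A B, cyclic
  or quaternion. In types III and IV the quaternion group Q is normal of order 8; in types V and VI
  a normal subgroup of order 8 would meet H in the centre of 2A_5, of order 2, and so have at most 4
  elements. The extensions by 2 raise the 2-part from 8 to 16.\<close>

definition type_of :: "('a, 'c) monoid_scheme \<Rightarrow> sf_type" where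
  "type_of G =
     (if has_normal_2_complement G then if has_cyclic_2_sylow G then Type_I else Type_II
      else if has_normal_8 G then if 16 dvd order G then Type_IV else Type_III
      else if 16 dvd order G then Type_VI else Type_V)"

context finite_group
begin

text \<open>A normal Hall subgroup of H contains all elements of H killed by its order, and
  conjugation in G preserves both H and that property.\<close>

lemma hall_normal:
  assumes "H \<lhd> G" "subgroup N G" "N \<subseteq> H" "\<And>h n. h \<in> H \<Longrightarrow> n \<in> N \<Longrightarrow> conj_by G h n \<in> N"
    and "card H = card N * m" "coprime (card N) m"
  shows "N \<lhd> G"
  unfolding normal_iff_conj
proof (intro conjI ballI)
  fix g n assume g: "g \<in> carrier G" and n: "n \<in> N"
  have C: "n \<in> carrier G" using assms(2) n by (rule subgroup_mem_carrier)
  show "conj_by G g n \<in> N"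
  proof (rule hall_mem_subgroup[OF normal_imp_subgroup[OF assms(1)] assms(2-5)])
    show "conj_by G g n \<in> H" using normal_conj_closed[OF assms(1) g] assms(3) n by blast
    show "conj_by G g n [^] card N = \<one>"
      using pow_card_subgroup[OF assms(2) n] g C by (simp flip: conj_by_pow)
  qed (use assms(6) in auto)
qed (rule assms(2))

lemma not_dvd_cofactor:
  assumes "Factorial_Ring.prime p" "order G = p ^ multiplicity p (order G) * s"
  shows "\<not> p dvd s"
proof
  assume "p dvd s"
  then have "p ^ Suc (multiplicity p (order G)) dvd order G"
    using assms(2) by (metis mult.commute mult_dvd_mono dvd_refl power_Suc)
  then show False
    using order_pos assms(1) by (metis Suc_n_not_le_n multiplicity_geI not_prime_unit neq0_conv)
qed

text \<open>The witness is A B: T normalizes A and centralizes B, so the product is normal, and its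
  order is odd.\<close>

lemma odd_complement:
  assumes AB: "AB_conditions G A B" and BT: "internal_direct G BT B T"
    and G: "internal_semidirect G (carrier G) A BT"
  shows "\<exists>N. N \<lhd> G \<and> A \<subseteq> N \<and> B \<subseteq> N \<and> odd (card N) \<and> order G = card N * card T \<and>
    (\<forall>g\<in>carrier G. \<exists>n\<in>N. \<exists>t\<in>T. g = n \<otimes> t) \<and> (\<forall>n\<in>N. \<exists>a\<in>A. \<exists>b\<in>B. n = a \<otimes> b)"
proof -
  note ab = AB_conditionsD[OF AB] and D = type_I_II_D[OF AB BT G]
  define N where "N = A <#> B"
  have N: "n \<in> N \<longleftrightarrow> (\<exists>a\<in>A. \<exists>b\<in>B. n = a \<otimes> b)" for n by (auto simp: N_def set_mult_def)
  have AC: "a \<in> carrier G" if "a \<in> A" for a using ab(1) that by (rule subgroup_mem_carrier)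
  have BC: "b \<in> carrier G" if "b \<in> B" for b using ab(2) that by (rule subgroup_mem_carrier)
  have TC: "t \<in> carrier G" if "t \<in> T" for t using D(2) that by (rule subgroup_mem_carrier)
  have SN: "subgroup N G"
  proof (rule finite_subgroupI)
    show "N \<subseteq> carrier G" using AC BC N by auto
    show "\<one> \<in> N" using N subgroup.one_closed[OF ab(1)] subgroup.one_closed[OF ab(2)] by force
    fix n n' assume "n \<in> N" "n' \<in> N"
    then obtain a b a' b' where n: "n = a \<otimes> b" "n' = a' \<otimes> b'" "a \<in> A" "b \<in> B" "a' \<in> A" "b' \<in> B"
      by (auto simp: N)
    have "n \<otimes> n' = (a \<otimes> conj_by G b a') \<otimes> (b \<otimes> b')"
      using n AC BC by (simp add: conj_by_def m_assoc)
    moreover have "a \<otimes> conj_by G b a' \<in> A"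
      using n normal_conj_closed[OF D(1) BC] ab(1) by (simp add: subgroup.m_closed)
    moreover have "b \<otimes> b' \<in> B" using n ab(2) by (simp add: subgroup.m_closed)
    ultimately show "n \<otimes> n' \<in> N" using N by blast
  qed
  have dec: "\<exists>n\<in>N. \<exists>t\<in>T. g = n \<otimes> t" if gC: "g \<in> carrier G" for g
  proof -
    obtain a b t where g: "a \<in> A" "b \<in> B" "t \<in> T" "g = a \<otimes> (b \<otimes> t)" using D(5)[OF gC] by blast
    then have "g = (a \<otimes> b) \<otimes> t" using AC BC TC by (simp add: m_assoc)
    then show ?thesis using g N by blast
  qed
  have "N \<lhd> G" unfolding normal_iff_conj
  proof (intro conjI ballI)
    fix g n assume g: "g \<in> carrier G" and n: "n \<in> N"
    obtain n' t where t: "n' \<in> N" "t \<in> T" "g = n' \<otimes> t" using dec[OF g] by blast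
    obtain a b where ab': "n = a \<otimes> b" "a \<in> A" "b \<in> B" using n N by blast
    have "conj_by G t b = b" using D(4)[OF ab'(3) t(2)] BC TC ab' t by (simp add: conj_by_eq_self_iff)
    then have "conj_by G t n = conj_by G t a \<otimes> b" using ab' AC BC TC t(2) by (simp add: conj_by_mult)
    then have "conj_by G t n \<in> N"
      using N ab' normal_conj_closed[OF D(1) TC[OF t(2)]] by blast
    then have "conj_by G n' (conj_by G t n) \<in> N" using subgroup_conj_closed[OF SN t(1)] by blast
    then show "conj_by G g n \<in> N"
      using t n TC subgroup_mem_carrier[OF SN] by (simp add: conj_by_conj_by)
  qed (rule SN)
  moreover have "card N = card A * card B"
    unfolding N_def by (rule card_set_mult[OF ab(1,2) coprime_subgroups_Int[OF ab(1,2,7)]])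
  moreover have "A \<subseteq> N"
  proof
    fix a assume "a \<in> A"
    then show "a \<in> N" using N subgroup.one_closed[OF ab(2)] AC[of a] r_one[of a] by metis
  qed
  moreover have "B \<subseteq> N"
  proof
    fix b assume "b \<in> B"
    then show "b \<in> N" using N subgroup.one_closed[OF ab(1)] BC[of b] l_one[of b] by metis
  qed
  ultimately show ?thesis
    using D(3) ab(5,6) dec N by (intro exI[of _ N]) simp
qed

lemma type_I_II_char_A:
  assumes AB: "AB_conditions G A B" and BT: "internal_direct G BT B T"
    and G: "internal_semidirect G (carrier G) A BT" and T: "card T = 2 ^ k"
  shows "char_A G A" "has_normal_2_complement G"
proof -
  note ab = AB_conditionsD[OF AB] and D = type_I_II_D[OF AB BT G]
  show "has_normal_2_complement G"
    using odd_complement[OF AB BT G] T unfolding has_normal_2_complement_def by metis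
  show "char_A G A"
  proof (rule char_AI[OF AB D(1,3)])
    show "coprime (card A) (card T)" using ab(5) T by simp
    fix p :: nat and N assume "Factorial_Ring.prime p" "odd p" "p dvd card T"
    then show False using T prime_dvd_power[of p 2 k] primes_dvd_imp_eq[of p 2] by auto
  qed
qed

lemma type_I_invariants:
  assumes "type_I_structure G A"
  shows "type_of G = Type_I" "char_A G A"
proof -
  obtain B T BT k where AB: "AB_conditions G A B" and BT: "internal_direct G BT B T"
    and G: "internal_semidirect G (carrier G) A BT" and T: "cyclic_group (G\<lparr>carrier := T\<rparr>)" "card T = 2 ^ k"
    using assms by (auto simp: type_I_structure_def)
  note ab = AB_conditionsD[OF AB] and D = type_I_II_D[OF AB BT G]
  show "char_A G A" by (rule type_I_II_char_A[OF AB BT G T(2)])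
  obtain t where t: "t \<in> carrier G" "ord t = card T" using cyclic_subgroupE[OF D(2) T(1)] by metis
  have "order G div 2 ^ k = card A * card B" using D(3) T(2) by simp
  then have "has_cyclic_2_sylow G"
    unfolding has_cyclic_2_sylow_def using t T(2) ab(5,6) by (intro bexI[of _ t] exI[of _ k]) auto
  then show "type_of G = Type_I"
    using type_I_II_char_A(2)[OF AB BT G T(2)] by (simp add: type_of_def)
qed

lemma quat_exponent:
  assumes q: "quat_gens G T m x y" and t: "t \<in> T"
  shows "t [^] ((2::nat) ^ (m - 1)) = \<one>"
proof (cases "t \<in> generate G {x}")
  case True
  then obtain i :: nat where i: "t = x [^] i"
    using quat_simps(10)[OF q] by (auto simp: generate_singleton)
  have "t [^] ((2::nat) ^ (m - 1)) = (x [^] ((2::nat) ^ (m - 1))) [^] i"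
    unfolding i using quat_simps(10)[OF q] by (simp add: nat_pow_pow mult.commute)
  then show ?thesis using quat_pow_eq_one[OF q] by simp
next
  case False
  have C: "t \<in> carrier G" using quat_simps(1)[OF q] t by (rule subgroup_mem_carrier)
  have "(2::nat) ^ 2 dvd 2 ^ (m - 1)"
    using quat_simps(2)[OF q] by (intro le_imp_power_dvd) simp
  then obtain l where "(2::nat) ^ (m - 1) = 4 * l" by (auto simp: dvd_def)
  then have "t [^] ((2::nat) ^ (m - 1)) = (t [^] (4::nat)) [^] l" using C by (simp add: nat_pow_pow)
  then show ?thesis using quat_pow_half_outside[OF q t False] by simp
qed

lemma normal_mult_pow:
  assumes "N \<lhd> G" "n \<in> N" "t \<in> carrier G"
  shows "\<exists>n'\<in>N. (n \<otimes> t) [^] (k::nat) = n' \<otimes> t [^] k"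
proof (induction k)
  case 0
  then show ?case using subgroup.one_closed[OF normal_imp_subgroup[OF assms(1)]] by force
next
  case (Suc k)
  then obtain n' where n': "n' \<in> N" "(n \<otimes> t) [^] k = n' \<otimes> t [^] k" by blast
  have C: "n \<in> carrier G" "n' \<in> carrier G"
    using assms(2) n'(1) normal_imp_subgroup[OF assms(1)] subgroup_mem_carrier by blast+
  have "(n \<otimes> t) [^] Suc k = (n' \<otimes> conj_by G (t [^] k) n) \<otimes> t [^] Suc k"
    using n'(2) C assms(3) by (simp add: conj_by_def m_assoc)
  moreover have "n' \<otimes> conj_by G (t [^] k) n \<in> N"
    using normal_conj_closed[OF assms(1) _ assms(2), of "t [^] k"] assms(3) n'(1)
      normal_imp_subgroup[OF assms(1)] by (simp add: subgroup.m_closed)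
  ultimately show ?case by blast
qed

text \<open>Modulo the odd complement N every element comes from T, whose exponent is only half of
  |T|. So no element has the full power of 2 as its order, and the Sylow 2-subgroups are not
  cyclic.\<close>

lemma type_II_invariants:
  assumes "type_II_structure G A"
  shows "type_of G = Type_II" "char_A G A"
proof -
  obtain B T BT q where AB: "AB_conditions G A B" and BT: "internal_direct G BT B T"
    and G: "internal_semidirect G (carrier G) A BT" and T: "is_quaternionic q (G\<lparr>carrier := T\<rparr>)"
    using assms by (auto simp: type_II_structure_def)
  note ab = AB_conditionsD[OF AB] and D = type_I_II_D[OF AB BT G]
  obtain m x y where q: "quat_gens G T m x y" by (rule quat_gensE[OF D(2) T])
  note c = quat_simps(3)[OF q]
  show "char_A G A" by (rule type_I_II_char_A[OF AB BT G c])
  obtain N where N: "N \<lhd> G" "odd (card N)" "order G = card N * card T"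
    "\<forall>g\<in>carrier G. \<exists>n\<in>N. \<exists>t\<in>T. g = n \<otimes> t" using odd_complement[OF AB BT G] by blast
  have "\<not> has_cyclic_2_sylow G"
  proof
    assume "has_cyclic_2_sylow G"
    then obtain g k where g: "g \<in> carrier G" "ord g = 2 ^ k" "odd (order G div 2 ^ k)"
      by (auto simp: has_cyclic_2_sylow_def)
    have "2 ^ k dvd order G" using ord_dvd_group_order[OF g(1)] g(2) by simp
    then have "order G = 2 ^ k * (order G div 2 ^ k)" by simp
    then have e: "2 ^ m * card N = 2 ^ k * (order G div 2 ^ k)" using N(3) c by (simp add: mult.commute)
    have "m \<le> k"
    proof (rule ccontr)
      assume "\<not> m \<le> k"
      then have "2 ^ m = 2 ^ k * (2::nat) ^ (m - k)" by (simp flip: power_add)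
      then have "2 ^ (m - k) * card N = order G div 2 ^ k" using e by simp
      moreover have "even ((2::nat) ^ (m - k) * card N)" using \<open>\<not> m \<le> k\<close> by simp
      ultimately show False using g(3) by simp
    qed
    obtain n t where nt: "n \<in> N" "t \<in> T" "g = n \<otimes> t" using N(4) g(1) by blast
    have tC: "t \<in> carrier G" using D(2) nt(2) by (rule subgroup_mem_carrier)
    let ?e = "(2::nat) ^ (m - 1)"
    obtain n' where n': "n' \<in> N" "g [^] ?e = n' \<otimes> t [^] ?e"
      using normal_mult_pow[OF N(1) nt(1) tC] nt(3) by blast
    have SN: "subgroup N G" using N(1) by (rule normal_imp_subgroup)
    have gN: "g [^] ?e \<in> N"
      using n' quat_exponent[OF q nt(2)] subgroup_mem_carrier[OF SN n'(1)] by simp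
    have "(g [^] ?e) [^] card N = \<one>" by (rule pow_card_subgroup[OF SN gN])
    then have "2 ^ k dvd ?e * card N" using g(1,2) by (simp add: nat_pow_pow pow_eq_id)
    moreover have "coprime (2 ^ k) (card N)" using N(2) by simp
    ultimately have "2 ^ k dvd ?e" using coprime_dvd_mult_left_iff by blast
    then have "k \<le> m - 1" by (simp add: power_dvd_imp_le)
    then show False using \<open>m \<le> k\<close> quat_simps(2)[OF q] by simp
  qed
  then show "type_of G = Type_II"
    using type_I_II_char_A(2)[OF AB BT G c] by (simp add: type_of_def)
qed

text \<open>The number d is 1 for type III and 2 for type IV. An element c of
  \<open>\<Theta>\<close> that moves Q cannot lie in a normal subgroup of odd order, which would
  centralize the normal 2-group Q; but a normal 2-complement and a normal Sylow 3-subgroup would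
  each contain c.\<close>

lemma type_III_IV_invariants:
  assumes dec: "type_III_decomposition G H Q A \<Theta> B" and H: "H \<lhd> G" "order G = d * card H" "d = 1 \<or> d = 2"
    and nQ: "Q \<lhd> G"
  shows "\<not> has_normal_2_complement G" "has_normal_8 G" "char_A G A" "16 dvd order G \<longleftrightarrow> d = 2"
proof -
  note D = type_III_D[OF dec]
  note ab = AB_conditionsD[OF D(1)]
  show "has_normal_8 G" using nQ D(10) by (auto simp: has_normal_8_def)
  obtain c q where c: "c \<in> \<Theta>" "q \<in> Q" "conj_by G c q \<noteq> q" using D(14) by blast
  have C: "c \<in> carrier G" "q \<in> carrier G" using c D(3,4) subgroup_mem_carrier by blast+
  obtain j where j: "card \<Theta> = 3 ^ j" using D(13) by blast
  have key: False if N: "N \<lhd> G" "odd (card N)" "c \<in> N" for N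
  proof -
    have SN: "subgroup N G" using N(1) by (rule normal_imp_subgroup)
    have "coprime (card N) (card Q)"
      using N(2) D(10) coprime_power_right_iff[of "card N" 2 3] by simp
    then have "N \<inter> Q = {\<one>}" by (rule coprime_subgroups_Int[OF SN D(3)])
    then have "c \<otimes> q = q \<otimes> c"
      using disjoint_normal_commute[OF SN N(3) _ D(3) c(2)] normal_conj_closed[OF N(1) C(2) N(3)]
        normal_conj_closed[OF nQ C(1) c(2)] by blast
    then show False using c(3) C by (simp add: conj_by_eq_self_iff)
  qed
  have cp: "c [^] ((3::nat) ^ j) = \<one>" using pow_card_subgroup[OF D(4) c(1)] j by simp
  show "\<not> has_normal_2_complement G"
  proof
    assume "has_normal_2_complement G"
    then obtain N k where N: "N \<lhd> G" "odd (card N)" "order G = card N * 2 ^ k"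
      by (auto simp: has_normal_2_complement_def)
    have "coprime ((3::nat) ^ j) (2 ^ k)" by simp
    then show False using key[OF N(1,2)] hall_mem[OF N(1,3) C(1) cp] by blast
  qed
  have o: "order G = card A * (card B * (d * 8 * 3 ^ j))" using H(2) D(9) j by (simp add: mult_ac)
  have cA: "coprime (card A) (d * 8 * 3 ^ j)"
    using ab(5) D(15) H(3) coprime_power_right_iff[of "card A" 2 3] by auto
  have oddr: "odd (card A * card B * 3 ^ j)" using ab(5,6) by simp
  have o8: "order G = 8 * (d * (card A * card B * 3 ^ j))" using o by (simp add: mult_ac)
  show "16 dvd order G \<longleftrightarrow> d = 2"
  proof -
    have "(16::nat) = 8 * 2" by simp
    then have "16 dvd order G \<longleftrightarrow> 2 dvd d * (card A * card B * 3 ^ j)"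
      unfolding o8 by (metis nat_mult_dvd_cancel_disj zero_neq_numeral)
    then show ?thesis using oddr H(3) by auto
  qed
  show "char_A G A"
  proof (rule char_AI[OF D(1) _ o cA])
    show "A \<lhd> G"
    proof (rule hall_normal[OF H(1) ab(1) D(6) D(18)])
      show "card H = card A * (8 * (3 ^ j * card B))" using D(9) j by (simp add: mult_ac)
      show "coprime (card A) (8 * (3 ^ j * card B))" using cA ab(7) by auto
    qed
    fix p :: nat and N assume p: "Factorial_Ring.prime p" "odd p" "p dvd d * 8 * 3 ^ j" and N: "N \<lhd> G"
      and cN: "card N = p ^ multiplicity p (order G)"
    have "p dvd 3 ^ j"
    proof -
      have "\<not> p dvd d * 8"
      proof
        assume "p dvd d * 8"
        then have "p dvd 2 ^ 4" using H(3) by (auto intro: dvd_trans)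
        then show False using p(1,2) prime_dvd_power[of p 2 4] primes_dvd_imp_eq[of p 2] by auto
      qed
      then show ?thesis using p(1,3) by (simp add: prime_dvd_mult_iff)
    qed
    then have "p dvd 3" using p(1) prime_dvd_power by blast
    then have p3: "p = 3" using primes_dvd_imp_eq[OF p(1), of 3] by simp
    obtain s where s: "order G = card N * s" using card_subgroup_dvd[OF normal_imp_subgroup[OF N]] by blast
    have "\<not> p dvd s" by (rule not_dvd_cofactor[OF p(1)]) (use s in \<open>unfold cN\<close>)
    then have "\<not> 3 dvd s" unfolding p3 .
    then have "coprime ((3::nat) ^ j) s" by (simp add: prime_imp_coprime)
    then have "c \<in> N" by (rule hall_mem[OF N s C(1) cp])
    moreover have "odd (card N)" unfolding cN using p(2) by simp
    ultimately show False using key[OF N] by simp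
  qed
qed

text \<open>The number d is 1 for type V and 2 for type VI, and \<open>ind\<close> says that the
  elements outside H form at most one coset. A normal 2-complement, or a normal Sylow subgroup for 3
  or 5, would contain all elements of Q of order 3 or all of order 5, and with them the involution
  of Q.\<close>

lemma type_V_VI_invariants:
  assumes dec: "type_V_decomposition G H Q A B" and H: "H \<lhd> G" "order G = d * card H" "d = 1 \<or> d = 2"
    and ind: "\<And>x y. x \<in> carrier G \<Longrightarrow> y \<in> carrier G \<Longrightarrow> x \<notin> H \<Longrightarrow> y \<notin> H \<Longrightarrow> x \<otimes> inv y \<in> H"
  shows "\<not> has_normal_2_complement G" "\<not> has_normal_8 G" "char_A G A" "16 dvd order G \<longleftrightarrow> d = 2"
proof -
  note D = type_V_D[OF dec]
  note ab = AB_conditionsD[OF D(1)]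
  obtain f where f: "f \<in> iso (G\<lparr>carrier := Q\<rparr>) SL2_F5" using D(9) by (auto simp: is_iso_def)
  interpret f: group_hom "G\<lparr>carrier := Q\<rparr>" SL2_F5 f
    using f subgroup_imp_group[OF D(3)] SL2.is_group by (simp add: group_hom_def group_hom_axioms_def iso_def)
  have inj: "inj_on f Q" and im: "f ` Q = carrier SL2_F5" using f by (auto simp: iso_def bij_betw_def)
  have QC: "x \<in> carrier G" if "x \<in> Q" for x using D(3) that by (rule subgroup_mem_carrier)
  have fpow: "f (x [^] (k::nat)) = f x [^]\<^bsub>SL2_F5\<^esub> k" if "x \<in> Q" for x k
    using f.hom_nat_pow[of x k] that by (simp flip: nat_pow_consistent)
  have fmul: "f (x \<otimes> y) = f x \<otimes>\<^bsub>SL2_F5\<^esub> f y" if "x \<in> Q" "y \<in> Q" for x y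
    using f.hom_mult[of x y] that by simp
  have finv: "f (inv x) = inv\<^bsub>SL2_F5\<^esub> f x" if "x \<in> Q" for x
    using f.hom_inv[of x] that m_inv_consistent[OF D(3) that] by simp
  have fone: "f x = \<one>\<^bsub>SL2_F5\<^esub> \<longleftrightarrow> x = \<one>" if "x \<in> Q" for x
    using f.hom_one inj that subgroup.one_closed[OF D(3)] by (auto simp: inj_on_def)
  have key: False if N: "subgroup N G" "odd (card N)" and p: "p = 3 \<or> p = 5"
    and mem: "\<And>x. x \<in> Q \<Longrightarrow> x [^] (p::nat) = \<one> \<Longrightarrow> x \<in> N" for N p
  proof -
    have NQ: "subgroup (N \<inter> Q) G" using subgroups_Inter_pair[OF N(1) D(3)] .
    have "subgroup (f ` (N \<inter> Q)) SL2_F5"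
      using f.subgroup_img_is_subgroup[OF subgroup_incl[OF NQ D(3)]] by simp
    moreover have "card (f ` (N \<inter> Q)) = card (N \<inter> Q)"
      using inj by (intro card_image) (auto simp: inj_on_def)
    moreover have "odd (card (N \<inter> Q))"
      using card_subgroup_dvd_subgroup[OF NQ N(1)] N(2) by (meson Int_lower1 dvd_trans)
    moreover have "y \<in> f ` (N \<inter> Q)" if y: "y \<in> carrier SL2_F5" "y [^]\<^bsub>SL2_F5\<^esub> p = \<one>\<^bsub>SL2_F5\<^esub>" for y
    proof -
      obtain x where x: "x \<in> Q" "y = f x" using im y(1) by blast
      then have "x [^] p = \<one>" using fone[OF subgroup_pow_closed[OF D(3) x(1)]] fpow[OF x(1)] y(2) by simp
      then show ?thesis using mem x by blast
    qed
    ultimately show False using SL2_odd_subgroup[of "f ` (N \<inter> Q)" p] p by simp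
  qed
  show "\<not> has_normal_2_complement G"
  proof
    assume "has_normal_2_complement G"
    then obtain N k where N: "N \<lhd> G" "odd (card N)" "order G = card N * 2 ^ k"
      by (auto simp: has_normal_2_complement_def)
    have "coprime (3::nat) (2 ^ k)" by simp
    then show False
      using key[OF normal_imp_subgroup[OF N(1)] N(2), of 3] hall_mem[OF N(1,3) QC] by blast
  qed
  have odds: "odd (card A * card B)" using ab(5,6) by simp
  show "\<not> has_normal_8 G"
  proof
    assume "has_normal_8 G"
    then obtain N where N: "N \<lhd> G" "card N = 8" by (auto simp: has_normal_8_def)
    have SN: "subgroup N G" using N(1) by (rule normal_imp_subgroup)
    have NC: "x \<in> carrier G" if "x \<in> N" for x using SN that by (rule subgroup_mem_carrier)
    have p8: "x [^] (8::nat) = \<one>" if "x \<in> N" for x using pow_card_subgroup[OF SN that] N(2) by simp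
    have HQ: "x \<in> Q" if "x \<in> N" "x \<in> H" for x
    proof (rule hall_mem_subgroup[OF D(2,3,4,12) _ that(2) p8[OF that(1)]])
      show "card H = card Q * (card A * card B)" using D(7,8) by simp
      show "coprime 8 (card A * card B)" using odds coprime_power_left_iff[of 2 3 "card A * card B"] by simp
    qed auto
    \<comment> \<open>For x in N and in Q the commutators with elements of Q lie in N, so their
      eighth powers are 1; in SL_2(F_5) only I and -I have this property.\<close>
    have cent: "f x \<in> {mat2 1 0 0 1, mat2 4 0 0 4}" if x: "x \<in> N" "x \<in> H" for x
    proof -
      have xQ: "x \<in> Q" using HQ x by blast
      have "f x = mat2 1 0 0 1 \<or> f x = mat2 4 0 0 4"
      proof (rule SL2_noncentral_commutator)
        show "f x \<in> carrier SL2_F5" using im xQ by blast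
        fix g assume "g \<in> carrier SL2_F5"
        then obtain q where q: "q \<in> Q" "g = f q" using im by blast
        define w where "w = conj_by G x q \<otimes> inv q"
        have cQ: "conj_by G x q \<in> Q" "inv q \<in> Q"
          using subgroup_conj_closed[OF D(3) xQ q(1)] subgroup.m_inv_closed[OF D(3) q(1)] .
        have wQ: "w \<in> Q" unfolding w_def by (rule subgroup.m_closed[OF D(3) cQ])
        have "w = x \<otimes> conj_by G q (inv x)"
          unfolding w_def using QC[OF q(1)] NC[OF x(1)] by (simp add: conj_by_def m_assoc)
        then have wN: "w \<in> N" using normal_commutator_mem(1)[OF N(1) x(1) QC[OF q(1)]] by simp
        have "f (conj_by G x q) = conj_by SL2_F5 (f x) g"
          unfolding conj_by_def q(2)
          using fmul finv xQ q(1) D(3) by (simp add: subgroup.m_closed subgroup.m_inv_closed del: SL2_mult)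
        then have "f w = conj_by SL2_F5 (f x) g \<otimes>\<^bsub>SL2_F5\<^esub> inv\<^bsub>SL2_F5\<^esub> g"
          unfolding w_def using fmul[OF cQ] finv[OF q(1)] q(2) by simp
        moreover have "f w [^]\<^bsub>SL2_F5\<^esub> (8::nat) = \<one>\<^bsub>SL2_F5\<^esub>"
          using fpow[OF wQ, of 8] p8[OF wN] fone[OF subgroup.one_closed[OF D(3)]] by simp
        ultimately show "(conj_by SL2_F5 (f x) g \<otimes>\<^bsub>SL2_F5\<^esub> inv\<^bsub>SL2_F5\<^esub> g) [^]\<^bsub>SL2_F5\<^esub> (8::nat) = \<one>\<^bsub>SL2_F5\<^esub>"
          by metis
      qed
      then show ?thesis by blast
    qed
    have fN: "finite N" using finite_subgroup[OF SN] .
    have "inj_on f (N \<inter> H)" using inj HQ by (auto simp: inj_on_def)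
    then have c2: "card (N \<inter> H) \<le> card {mat2 1 0 0 1, mat2 4 0 0 4}"
      by (rule card_inj_on_le) (use cent in auto)
    \<comment> \<open>Multiplication by the inverse of one element of N outside H maps the rest of N
      - H injectively into the part of N inside H, so N has at most 4 elements.\<close>
    have "card (N - H) \<le> card (N \<inter> H)"
    proof (cases "N - H = {}")
      case False
      then obtain y where y: "y \<in> N" "y \<notin> H" by blast
      show ?thesis
      proof (rule card_inj_on_le)
        show "inj_on (\<lambda>x. x \<otimes> inv y) (N - H)" using NC y by (auto simp: inj_on_def)
        show "(\<lambda>x. x \<otimes> inv y) ` (N - H) \<subseteq> N \<inter> H"
          using ind NC y SN by (auto intro: subgroup.m_closed subgroup.m_inv_closed)
      qed (use fN in auto)
    next
      case True
      then show ?thesis by (simp only: card.empty)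
    qed
    moreover have "card N = card (N \<inter> H) + card (N - H)"
      using card_Un_disjoint[of "N \<inter> H" "N - H"] fN by (simp add: Int_Diff_Un Int_Diff_disjoint)
    moreover have "card {mat2 1 0 0 1, mat2 4 0 0 4} \<le> 2" by (simp add: card_insert_if)
    ultimately show False using c2 N(2) by simp
  qed
  have o: "order G = card A * (card B * (d * 120))" using H(2) D(7) by (simp add: mult_ac)
  have c15: "coprime (card A) 3" "coprime (card A) 5"
    using D(10) coprime_mult_right_iff[of "card A" 3 5] by simp_all
  have cA: "coprime (card A) (d * 120)"
  proof -
    have "coprime (card A) (2 ^ 3 * (3 * 5))"
      using ab(5) c15 by (simp only: coprime_mult_right_iff coprime_power_right_iff) simp
    also have "2 ^ 3 * (3 * 5) = (120::nat)" by simp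
    finally have "coprime (card A) 120" .
    moreover have "coprime (card A) d" using H(3) ab(5) by auto
    ultimately show ?thesis by (simp only: coprime_mult_right_iff)
  qed
  show "16 dvd order G \<longleftrightarrow> d = 2"
  proof -
    have "order G = 8 * (d * (15 * (card A * card B)))" using o by (simp add: mult_ac)
    moreover have "(16::nat) = 8 * 2" by simp
    ultimately have "16 dvd order G \<longleftrightarrow> 2 dvd d * (15 * (card A * card B))"
      by (metis nat_mult_dvd_cancel_disj zero_neq_numeral)
    then show ?thesis using odds H(3) by auto
  qed
  show "char_A G A"
  proof (rule char_AI[OF D(1) _ o cA])
    show "A \<lhd> G"
    proof (rule hall_normal[OF H(1) ab(1) D(5) D(13)])
      show "card H = card A * (120 * card B)" using D(7) by (simp add: mult_ac)
      show "coprime (card A) (120 * card B)" using cA ab(7) by (simp only: coprime_mult_right_iff)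
    qed
    fix p :: nat and N assume p: "Factorial_Ring.prime p" "odd p" "p dvd d * 120" and N: "N \<lhd> G"
      and cN: "card N = p ^ multiplicity p (order G)"
    have p35: "p = 3 \<or> p = 5"
    proof -
      have "p dvd 2 ^ 4 * (3 * 5)" using p(3) H(3) by (auto intro: dvd_trans)
      then have "p dvd 2 ^ 4 \<or> p dvd 3 \<or> p dvd 5" using p(1) by (simp only: prime_dvd_mult_iff)
      moreover have "\<not> p dvd 2 ^ 4"
        using p(1,2) prime_dvd_power[of p 2 4] primes_dvd_imp_eq[of p 2] by auto
      moreover have "Factorial_Ring.prime (3::nat)" "Factorial_Ring.prime (5::nat)" by simp_all
      ultimately show ?thesis using p(1) primes_dvd_imp_eq by blast
    qed
    obtain s where s: "order G = card N * s" using card_subgroup_dvd[OF normal_imp_subgroup[OF N]] by blast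
    have "\<not> p dvd s" by (rule not_dvd_cofactor[OF p(1)]) (use s in \<open>unfold cN\<close>)
    then have "coprime p s" using p(1) by (simp add: prime_imp_coprime)
    then have "x \<in> N" if "x \<in> Q" "x [^] p = \<one>" for x
      using hall_mem[OF N s QC[OF that(1)] that(2)] by blast
    moreover have "odd (card N)" unfolding cN using p(2) by simp
    ultimately show False
      using key[OF normal_imp_subgroup[OF N] _ p35] by blast
  qed
qed

end

text \<open>The condition inside \<open>index2_subgroup\<close>, named so that existence and
  uniqueness can be stated apart from the definite description.\<close>

definition is_index2 :: "('a, 'c) monoid_scheme \<Rightarrow> 'a set \<Rightarrow> bool" where
  "is_index2 G K \<longleftrightarrow> subgroup K G \<and> card (rcosets\<^bsub>G\<^esub> K) = 2 \<and>
     (\<forall>P. is_sylow_of G 2 P K \<longrightarrow> cyclic_group (G\<lparr>carrier := P\<rparr>))"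

lemma index2_subgroup_eq: "is_index2 G K \<Longrightarrow> (\<And>L. is_index2 G L \<Longrightarrow> L = K) \<Longrightarrow> index2_subgroup G = K"
  unfolding index2_subgroup_def is_index2_def[symmetric] by (rule the_equality)

context finite_group
begin

lemma has_type_invariants:
  assumes "has_type G \<tau> A"
  shows "type_of G = \<tau>" "char_A G A"
proof -
  have "type_of G = \<tau> \<and> char_A G A"
  proof (cases \<tau>)
    case Type_I
    then show ?thesis using assms type_I_invariants by simp
  next
    case Type_II
    then show ?thesis using assms type_II_invariants by simp
  next
    case Type_III
    then obtain Q C B where d: "type_III_decomposition G (carrier G) Q A C B" using assms by auto
    have Q: "Q \<lhd> G" using type_III_D(3,17)[OF d] by (simp add: normal_iff_conj)
    have "order G = 1 * card (carrier G)" by (simp add: order_def)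
    from type_III_IV_invariants[OF d normal_self this _ Q] Type_III show ?thesis by (simp add: type_of_def)
  next
    case Type_IV
    then obtain H Q C B F where d: "type_III_decomposition G H Q A C B" and n: "nonsplit_extension_by_2 G H F"
      and F: "\<forall>f\<in>F. ord f = 4 \<longrightarrow> acts_by_outer_auto G f Q"
      using assms by (auto simp: type_IV_structure_def)
    note D = type_III_D[OF d] and N = nonsplit_extension_D[OF n]
    obtain f where f: "f \<in> F" "f \<in> carrier G" "ord f = 4" "\<forall>g\<in>carrier G. \<exists>h\<in>H. g = h \<or> g = h \<otimes> f"
      using N(3) by blast
    have fQ: "conj_by G f q \<in> Q" if "q \<in> Q" for q
      using acts_by_outer_auto_maps[OF _ that] F f by blast
    have Q: "Q \<lhd> G" unfolding normal_iff_conj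
    proof (intro conjI ballI)
      fix g q assume g: "g \<in> carrier G" "q \<in> Q"
      obtain h where h: "h \<in> H" "g = h \<or> g = h \<otimes> f" using f(4) g(1) by blast
      have C: "h \<in> carrier G" "q \<in> carrier G" using h g D(2,3) subgroup_mem_carrier by blast+
      show "conj_by G g q \<in> Q" using h(2) D(17)[OF h(1)] fQ g(2) C f(2) by (auto simp: conj_by_conj_by)
    qed (rule D(3))
    from type_III_IV_invariants[OF d N(1,2) _ Q] Type_IV show ?thesis by (simp add: type_of_def)
  next
    case Type_V
    then obtain Q B where d: "type_V_decomposition G (carrier G) Q A B" using assms by auto
    have "order G = 1 * card (carrier G)" by (simp add: order_def)
    from type_V_VI_invariants[OF d normal_self this] Type_V show ?thesis by (simp add: type_of_def)
  next
    case Type_VI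
    then obtain H Q B F where d: "type_V_decomposition G H Q A B" and n: "nonsplit_extension_by_2 G H F"
      using assms by (auto simp: type_VI_structure_def)
    note N = nonsplit_extension_D[OF n]
    obtain f where f: "f \<in> carrier G" "\<forall>g\<in>carrier G. \<exists>h\<in>H. g = h \<or> g = h \<otimes> f" using N(3) by blast
    have S: "subgroup H G" using N(1) by (rule normal_imp_subgroup)
    have ind: "x \<otimes> inv y \<in> H" if xy: "x \<in> carrier G" "y \<in> carrier G" "x \<notin> H" "y \<notin> H" for x y
    proof -
      obtain h k where h: "h \<in> H" "x = h \<otimes> f" and k: "k \<in> H" "y = k \<otimes> f" using f(2) xy by metis
      have C: "h \<in> carrier G" "k \<in> carrier G" using h(1) k(1) S subgroup_mem_carrier by blast+
      have "x \<otimes> inv y = h \<otimes> inv k" unfolding h(2) k(2) using C f(1) by (simp add: inv_mult_group m_assoc)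
      then show ?thesis using h(1) k(1) S by (simp add: subgroup.m_closed subgroup.m_inv_closed)
    qed
    from type_V_VI_invariants[OF d N(1,2) _ ind] Type_VI show ?thesis by (simp add: type_of_def)
  qed
  then show "type_of G = \<tau>" "char_A G A" by blast+
qed

section \<open>The index 2 subgroup in type II\<close>

lemma index2_square:
  assumes K: "subgroup K G" "card (rcosets K) = 2" and g: "g \<in> carrier G"
  shows "g \<otimes> g \<in> K"
proof (cases "g \<in> K")
  case True
  then show ?thesis using K(1) by (simp add: subgroup.m_closed)
next
  case False
  have KC: "K \<subseteq> carrier G" using K(1) by (rule subgroup.subset)
  have in1: "K \<in> rcosets K" using K(1) by (simp add: subgroup.subgroup_in_rcosets[OF K(1) is_group])
  have in2: "K #> g \<in> rcosets K" using g KC by (rule rcosetsI[rotated])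
  have "K #> g \<noteq> K" using rcos_self[OF g K(1)] False by blast
  moreover have "finite (rcosets K)" using K(2) card.infinite by fastforce
  ultimately have "rcosets K = {K, K #> g}"
    using in1 in2 K(2) by (intro card_subset_eq[symmetric]) auto
  then have "carrier G = K \<union> (K #> g)" using rcosets_part_G[OF K(1)] by auto
  then have "g \<otimes> g \<in> K \<or> g \<otimes> g \<in> K #> g" using g by blast
  moreover have "g \<otimes> g \<notin> K #> g"
  proof
    assume "g \<otimes> g \<in> K #> g"
    then obtain k where k: "k \<in> K" "g \<otimes> g = k \<otimes> g" by (auto simp: r_coset_def)
    then have "g = k" using g KC by auto
    then show False using False k(1) by simp
  qed
  ultimately show ?thesis by blast
qed

lemma multiplicity_2_odd_mult:
  assumes "odd (n::nat)"
  shows "multiplicity 2 (n * 2 ^ k) = k"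
proof -
  have n: "n \<noteq> 0" using assms by (metis even_zero)
  have "multiplicity 2 n = 0" using assms by (simp add: not_dvd_imp_multiplicity_0)
  then show ?thesis
    using n prime_elem_multiplicity_mult_distrib[of "2::nat" n "2 ^ k"] by (simp add: prime_elem_nat_iff multiplicity_same_power)
qed

text \<open>A subgroup L of index 2 contains all squares, hence the odd-order group N, so L is N
  times its intersection with T. That intersection is cyclic of order 2^(m-1), which is at least 8,
  while elements of T outside the powers of x have fourth power 1; so it consists of the powers of
  x.\<close>

lemma type_II_index2:
  assumes N: "N \<lhd> G" "odd (card N)" "order G = card N * card T" "\<And>g. g \<in> carrier G \<Longrightarrow> \<exists>n\<in>N. \<exists>t\<in>T. g = n \<otimes> t"
    and q: "quat_gens G T m x y" and m: "m \<ge> 4"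
  shows "index2_subgroup G = N <#> generate G {x}" "is_index2 G (N <#> generate G {x})"
    "\<And>L. is_index2 G L \<Longrightarrow> L = N <#> generate G {x}"
proof -
  define X where "X = generate G {x}"
  define K where "K = N <#> X"
  note Q = quat_simps[OF q]
  have SN: "subgroup N G" using N(1) by (rule normal_imp_subgroup)
  have SX: "subgroup X G" unfolding X_def using Q(10) by (intro generate_is_subgroup) simp
  have cX: "card X = 2 ^ (m - 1)" unfolding X_def using generate_pow_card[OF Q(10)] Q(6) by simp
  have XT: "X \<subseteq> T" unfolding X_def using generate_subgroup_incl[of "{x}" T] Q by simp
  have NC: "n \<in> carrier G" if "n \<in> N" for n using SN that by (rule subgroup_mem_carrier)
  have XC: "n \<in> carrier G" if "n \<in> X" for n using SX that by (rule subgroup_mem_carrier)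
  have TC: "n \<in> carrier G" if "n \<in> T" for n using Q(1) that by (rule subgroup_mem_carrier)
  have memK: "g \<in> K \<longleftrightarrow> (\<exists>n\<in>N. \<exists>s\<in>X. g = n \<otimes> s)" for g by (auto simp: K_def set_mult_def)
  have cN: "coprime (card N) (2 ^ k)" for k using N(2) by simp
  have "N \<inter> X = {\<one>}" by (rule coprime_subgroups_Int[OF SN SX]) (simp only: cX cN)
  then have cK: "card K = card N * 2 ^ (m - 1)" unfolding K_def using card_set_mult[OF SN SX] cX by simp
  have SK: "subgroup K G"
  proof (rule finite_subgroupI)
    show "K \<subseteq> carrier G" using NC XC memK by auto
    show "\<one> \<in> K" using memK subgroup.one_closed[OF SN] subgroup.one_closed[OF SX] by force
    fix g g' assume "g \<in> K" "g' \<in> K"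
    then obtain n s n' s' where g: "g = n \<otimes> s" "g' = n' \<otimes> s'" "n \<in> N" "s \<in> X" "n' \<in> N" "s' \<in> X"
      by (auto simp: memK)
    have "g \<otimes> g' = (n \<otimes> conj_by G s n') \<otimes> (s \<otimes> s')"
      using g NC XC by (simp add: conj_by_def m_assoc)
    moreover have "n \<otimes> conj_by G s n' \<in> N" "s \<otimes> s' \<in> X"
      using g normal_conj_closed[OF N(1) XC] SN SX by (simp_all add: subgroup.m_closed)
    ultimately show "g \<otimes> g' \<in> K" using memK by blast
  qed
  have two: "(2::nat) ^ m = 2 * 2 ^ (m - 1)" using m by (simp flip: power_Suc)
  have oK: "order G = 2 * card K" using N(3) Q(3) cK two by simp
  have xX: "x \<in> X" unfolding X_def by (simp add: generate.incl)
  have xK: "x \<in> K" using memK subgroup.one_closed[OF SN] xX XC by (metis l_one)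
  have cyc: "cyclic_group (G\<lparr>carrier := P\<rparr>)" if "is_sylow_of G 2 P K" for P
  proof -
    have P: "subgroup P (G\<lparr>carrier := K\<rparr>)" "card P = 2 ^ (m - 1)"
      using that multiplicity_2_odd_mult[OF N(2), of "m - 1"] cK by (simp_all add: is_sylow_of_def)
    have SP: "subgroup P G" and PK: "P \<subseteq> K"
      using incl_subgroup[OF SK P(1)] subgroup.subset[OF P(1)] by simp_all
    have NP: "N \<inter> P = {\<one>}" by (rule coprime_subgroups_Int[OF SN SP]) (simp only: P(2) cN)
    have NK: "N \<subseteq> K" using memK subgroup.one_closed[OF SX] NC by (metis r_one subsetI)
    have "N <#> P = K"
    proof (rule card_subset_eq)
      show "N <#> P \<subseteq> K" using NK PK SK by (auto simp: set_mult_def subset_iff intro: subgroup.m_closed)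
      show "card (N <#> P) = card K" using card_set_mult[OF SN SP NP] cK P(2) by simp
    qed (rule finite_subgroup[OF SK])
    \<comment> \<open>Modulo N the elements x and p agree, so ord x divides ord p, and p generates
      P.\<close>
    then obtain n p where np: "n \<in> N" "p \<in> P" "x = n \<otimes> p" using xK by (auto simp: set_mult_def)
    have C: "p \<in> carrier G" using SP np(2) by (rule subgroup_mem_carrier)
    obtain n' where n': "n' \<in> N" "x [^] ord p = n' \<otimes> p [^] ord p"
      using normal_mult_pow[OF N(1) np(1) C] np(3) by blast
    then have "x [^] ord p \<in> N" using C NC by simp
    moreover have "x [^] ord p \<in> X" using SX xX by (rule subgroup_pow_closed)
    ultimately have "x [^] ord p = \<one>" using \<open>N \<inter> X = {\<one>}\<close> by blast
    then have "ord x dvd ord p" using pow_eq_id[OF Q(10)] by simp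
    moreover have "ord p dvd card P" using pow_card_subgroup[OF SP np(2)] pow_eq_id[OF C] by simp
    ultimately have "ord p = card P" using Q(6) P(2) by (simp add: dvd_antisym)
    then show ?thesis by (rule cyclic_subgroupI(1)[OF SP np(2)])
  qed
  have "card (rcosets K) = 2"
    using lagrange[OF SK] oK card_subgroup_pos[OF SK] by simp
  then have i2: "is_index2 G K" using SK cyc by (simp add: is_index2_def)
  have un: "L = K" if L: "is_index2 G L" for L
  proof -
    have SL: "subgroup L G" and c2: "card (rcosets L) = 2"
      and sy: "\<And>P. is_sylow_of G 2 P L \<Longrightarrow> cyclic_group (G\<lparr>carrier := P\<rparr>)"
      using L by (simp_all add: is_index2_def)
    have LC: "l \<in> carrier G" if "l \<in> L" for l using SL that by (rule subgroup_mem_carrier)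
    have cL: "card L = card K" using lagrange[OF SL] c2 oK by simp
    have NL: "N \<subseteq> L"
    proof
      fix n assume n: "n \<in> N"
      show "n \<in> L"
      proof (rule coprime_pow_mem[OF SL NC[OF n], of 2 "card N"])
        show "n [^] (2::nat) \<in> L" using index2_square[OF SL c2 NC[OF n]] NC[OF n] by (simp add: numeral_2_eq_2)
        show "n [^] card N \<in> L" using pow_card_subgroup[OF SN n] subgroup.one_closed[OF SL] by simp
      qed (use N(2) in simp)
    qed
    define P where "P = L \<inter> T"
    have SP: "subgroup P G" unfolding P_def by (rule subgroups_Inter_pair[OF SL Q(1)])
    have NP: "N \<inter> P = {\<one>}"
    proof -
      have "N \<inter> T = {\<one>}" by (rule coprime_subgroups_Int[OF SN Q(1)]) (simp only: Q(3) cN)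
      then show ?thesis unfolding P_def using subgroup.one_closed[OF SL] by blast
    qed
    have "L = N <#> P"
    proof
      show "L \<subseteq> N <#> P"
      proof
        fix l assume l: "l \<in> L"
        obtain n t where nt: "n \<in> N" "t \<in> T" "l = n \<otimes> t" using N(4)[OF LC[OF l]] by blast
        have "inv n \<otimes> l \<in> L" using nt(1) NL l SL by (auto intro: subgroup.m_closed subgroup.m_inv_closed)
        then have "t \<in> P" unfolding P_def using nt NC TC by simp
        then show "l \<in> N <#> P" using nt by (auto simp: set_mult_def)
      qed
      show "N <#> P \<subseteq> L" using NL SL by (auto simp: set_mult_def P_def intro: subgroup.m_closed)
    qed
    then have "card L = card N * card P" using card_set_mult[OF SN SP NP] by simp
    then have cP: "card P = 2 ^ (m - 1)" using cL cK card_subgroup_pos[OF SN] by simp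
    have "is_sylow_of G 2 P L"
      unfolding is_sylow_of_def using subgroup_incl[OF SP SL] cP cL cK multiplicity_2_odd_mult[OF N(2), of "m - 1"]
      by (simp add: P_def)
    then obtain s where s: "s \<in> P" "s \<in> carrier G" "generate G {s} = P" "ord s = card P"
      using cyclic_subgroupE[OF SP sy] by metis
    have "s \<in> X"
    proof (rule ccontr)
      assume "s \<notin> X"
      then have "s [^] (4::nat) = \<one>" using quat_pow_half_outside[OF q] s(1) by (simp add: P_def X_def)
      then have "ord s \<le> 4" using pow_eq_id[OF s(2)] by (simp add: dvd_imp_le)
      moreover have "(2::nat) ^ 3 \<le> 2 ^ (m - 1)" using m by (intro power_increasing) auto
      ultimately show False using s(4) cP by simp
    qed
    then have "P \<subseteq> X" using generate_subgroup_incl[of "{s}" X] SX s(3) by simp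
    then have "P = X" using cP cX finite_subgroup[OF SX] by (intro card_subset_eq) auto
    then show "L = K" using \<open>L = N <#> P\<close> K_def by simp
  qed
  show "index2_subgroup G = N <#> generate G {x}"
    using index2_subgroup_eq[OF i2 un] by (simp add: K_def X_def)
  show "is_index2 G (N <#> generate G {x})" using i2 by (simp add: K_def X_def)
  show "\<And>L. is_index2 G L \<Longrightarrow> L = N <#> generate G {x}" using un by (simp add: K_def X_def)
qed

text \<open>The complement N has odd order, so 16 divides the order of T; this is the bound m at
  least 4 under which the subgroup is unique.\<close>

lemma type_II_index2_unique:
  assumes H: "type_II_structure G A" "16 dvd order G"
  shows "\<exists>K. is_index2 G K \<and> (\<forall>L. is_index2 G L \<longrightarrow> L = K)"
proof -
  obtain B T BT q where AB: "AB_conditions G A B" and BT: "internal_direct G BT B T"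
    and sd: "internal_semidirect G (carrier G) A BT" and q: "is_quaternionic q (G\<lparr>carrier := T\<rparr>)"
    using H(1) by (auto simp: type_II_structure_def)
  obtain m x y where qg: "quat_gens G T m x y"
    by (rule quat_gensE[OF type_I_II_D(2)[OF AB BT sd] q])
  obtain N where N: "N \<lhd> G" "odd (card N)" "order G = card N * card T"
    "\<forall>g\<in>carrier G. \<exists>n\<in>N. \<exists>t\<in>T. g = n \<otimes> t" using odd_complement[OF AB BT sd] by blast
  have "(2::nat) ^ 4 dvd card N * 2 ^ m" using H(2) N(3) quat_simps(3)[OF qg] by simp
  moreover have "coprime ((2::nat) ^ 4) (card N)" using N(2) by (simp only: coprime_power_left_iff) simp
  ultimately have "(2::nat) ^ 4 dvd 2 ^ m" using coprime_dvd_mult_right_iff by blast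
  then have m4: "4 \<le> m" by (rule power_dvd_imp_le) simp
  have dec: "\<exists>n\<in>N. \<exists>t\<in>T. g = n \<otimes> t" if "g \<in> carrier G" for g using N(4) that by blast
  show ?thesis
    using type_II_index2(2,3)[OF N(1-3) dec qg m4] by (intro exI[of _ "N <#> generate G {x}"]) blast
qed

lemma unit_image_iff:
  "u \<in> unit_image G A S \<longleftrightarrow> u \<in> totatives (card A) \<and> (\<exists>s\<in>S. \<forall>n\<in>A. n [^] u = conj_by G s n)"
proof -
  have "(\<lambda>n\<in>A. n [^] u) = conj_map G A s \<longleftrightarrow> (\<forall>n\<in>A. n [^] u = conj_by G s n)" for s
    by (auto simp: conj_map_def conj_by_def fun_eq_iff restrict_def split: if_splits)
  then show ?thesis by (auto simp: unit_image_def image_iff)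
qed

end

section \<open>Transport of the invariants along an isomorphism\<close>

locale finite_group_iso = G: finite_group G + G': finite_group G'
  for G :: "('a, 'c) monoid_scheme" and G' :: "('b, 'd) monoid_scheme" +
  fixes h
  assumes h: "h \<in> iso G G'"
begin

sublocale group_hom G G' h
  using h by unfold_locales (simp add: iso_def)

lemma inj: "inj_on h (carrier G)" and surj: "h ` carrier G = carrier G'"
  using h by (auto simp: iso_def bij_betw_def)

lemma inverse: "finite_group_iso G' G (inv_into (carrier G) h)"
  using G.iso_set_sym[OF h] by unfold_locales

lemma card_img: "S \<subseteq> carrier G \<Longrightarrow> card (h ` S) = card S"
  using inj by (meson card_image inj_on_subset)

lemma img_inverse: "S' \<subseteq> carrier G' \<Longrightarrow> h ` inv_into (carrier G) h ` S' = S'"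
  using surj by (simp add: image_inv_into_cancel)

lemma order_eq: "order G = order G'"
  using h by (rule iso_same_order)

lemma h_conj: "g \<in> carrier G \<Longrightarrow> x \<in> carrier G \<Longrightarrow> h (conj_by G g x) = conj_by G' (h g) (h x)"
  by (simp add: conj_by_def)

lemma ord_img: "x \<in> carrier G \<Longrightarrow> G'.ord (h x) = G.ord x"
proof -
  assume x: "x \<in> carrier G"
  have "h x [^]\<^bsub>G'\<^esub> n = \<one>\<^bsub>G'\<^esub> \<longleftrightarrow> x [^]\<^bsub>G\<^esub> n = \<one>\<^bsub>G\<^esub>" for n :: nat
    using inj_onD[OF inj, of "x [^]\<^bsub>G\<^esub> n" "\<one>\<^bsub>G\<^esub>"] x by (auto simp flip: hom_nat_pow)
  then show ?thesis using x by (simp add: G'.ord_unique G.pow_eq_id)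
qed

lemma cyclic_img:
  assumes "subgroup P G" "cyclic_group (G\<lparr>carrier := P\<rparr>)"
  shows "cyclic_group (G'\<lparr>carrier := h ` P\<rparr>)"
proof -
  obtain a where a: "a \<in> P" "a \<in> carrier G" "G.ord a = card P"
    using G.cyclic_subgroupE[OF assms] by metis
  show ?thesis
    by (rule G'.cyclic_subgroupI(1)[of _ "h a"])
      (use a subgroup_img_is_subgroup[OF assms(1)] ord_img card_img subgroup.subset[OF assms(1)] in auto)
qed

lemma normal_img: "N \<lhd> G \<Longrightarrow> h ` N \<lhd> G'"
  using iso_normal_subgroup[OF h G.is_group G'.is_group] .

lemma normal_card_img: "N \<lhd> G \<Longrightarrow> card (h ` N) = card N"
  using card_img normal_imp_subgroup subgroup.subset by blast

lemma type_predicates: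
  "has_normal_2_complement G \<Longrightarrow> has_normal_2_complement G'"
  "has_cyclic_2_sylow G \<Longrightarrow> has_cyclic_2_sylow G'"
  "has_normal_8 G \<Longrightarrow> has_normal_8 G'"
proof -
  show "has_normal_2_complement G'" if c: "has_normal_2_complement G"
  proof -
    obtain N k where N: "N \<lhd> G" "odd (card N)" "order G = card N * 2 ^ k"
      using c by (auto simp: has_normal_2_complement_def)
    show ?thesis unfolding has_normal_2_complement_def
      by (intro exI[of _ "h ` N"] exI[of _ k] conjI normal_img[OF N(1)])
        (use N normal_card_img order_eq in simp_all)
  qed
  show "has_normal_8 G'" if "has_normal_8 G"
    using that normal_img normal_card_img unfolding has_normal_8_def by metis
  show "has_cyclic_2_sylow G'" if "has_cyclic_2_sylow G"
    using that ord_img order_eq unfolding has_cyclic_2_sylow_def by (metis hom_closed)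
qed

lemma char_A_img:
  assumes A: "char_A G A"
  shows "char_A G' (h ` A)"
proof -
  note A' = assms[unfolded char_A_def]
  have nA: "A \<lhd> G" using A' by blast
  interpret i: finite_group_iso G' G "inv_into (carrier G) h" by (rule inverse)
  have "card N \<noteq> p ^ multiplicity p (order G')"
    if "Factorial_Ring.prime p" "odd p" "p dvd order G' div card (h ` A)" "N \<lhd> G'" for p N
    using A' that i.normal_img[OF that(4)] i.normal_card_img[OF that(4)] order_eq normal_card_img[OF nA] by metis
  then show ?thesis
    unfolding char_A_def
    using A' normal_img[OF nA] normal_card_img[OF nA] order_eq cyclic_img[OF normal_imp_subgroup[OF nA]] by simp
qed

lemma unit_image_img:
  assumes "A \<subseteq> carrier G" "S \<subseteq> carrier G"
  shows "unit_image G' (h ` A) (h ` S) = unit_image G A S"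
proof -
  have "h n [^]\<^bsub>G'\<^esub> u = conj_by G' (h s) (h n) \<longleftrightarrow> n [^]\<^bsub>G\<^esub> u = conj_by G s n"
    if "n \<in> A" "s \<in> S" for n s and u :: nat
  proof -
    have C: "n \<in> carrier G" "s \<in> carrier G" using assms that by auto
    then have "h n [^]\<^bsub>G'\<^esub> u = conj_by G' (h s) (h n) \<longleftrightarrow> h (n [^]\<^bsub>G\<^esub> u) = h (conj_by G s n)"
      by (simp add: h_conj hom_nat_pow)
    also have "\<dots> \<longleftrightarrow> n [^]\<^bsub>G\<^esub> u = conj_by G s n"
      using C inj by (auto simp: inj_on_def)
    finally show ?thesis .
  qed
  then show ?thesis
    using card_img[OF assms(1)] by (auto simp: G'.unit_image_iff G.unit_image_iff set_eq_iff)
qed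

lemma is_index2_img:
  assumes K: "is_index2 G K"
  shows "is_index2 G' (h ` K)"
proof -
  interpret i: finite_group_iso G' G "inv_into (carrier G) h" by (rule inverse)
  have SK: "subgroup K G" and c2: "card (rcosets\<^bsub>G\<^esub> K) = 2"
    and sy: "\<And>P. is_sylow_of G 2 P K \<Longrightarrow> cyclic_group (G\<lparr>carrier := P\<rparr>)"
    using K by (simp_all add: is_index2_def)
  have SK': "subgroup (h ` K) G'" by (rule subgroup_img_is_subgroup[OF SK])
  note KC = subgroup.subset[OF SK]
  have cK: "card (h ` K) = card K" by (rule card_img[OF KC])
  have "card (rcosets\<^bsub>G'\<^esub> (h ` K)) = 2"
  proof -
    have "card (rcosets\<^bsub>G'\<^esub> (h ` K)) * card K = 2 * card K"
      using G.lagrange[OF SK] G'.lagrange[OF SK'] c2 cK order_eq by simp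
    then show ?thesis using G.card_subgroup_pos[OF SK] by simp
  qed
  moreover have "cyclic_group (G'\<lparr>carrier := P\<rparr>)" if P: "is_sylow_of G' 2 P (h ` K)" for P
  proof -
    have SP: "subgroup P G'" and PK: "P \<subseteq> h ` K" and cP: "card P = 2 ^ multiplicity 2 (card (h ` K))"
      using P G'.incl_subgroup[OF SK'] subgroup.subset[of P "G'\<lparr>carrier := h ` K\<rparr>"]
      by (auto simp: is_sylow_of_def)
    define P0 where "P0 = inv_into (carrier G) h ` P"
    have SP0: "subgroup P0 G" unfolding P0_def by (rule i.subgroup_img_is_subgroup[OF SP])
    have hP0: "h ` P0 = P" unfolding P0_def by (rule img_inverse[OF subgroup.subset[OF SP]])
    have "P0 \<subseteq> K"
    proof
      fix p assume p: "p \<in> P0"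
      then have "h p \<in> h ` K" using hP0 PK by blast
      then show "p \<in> K" using p G.subgroup_mem_carrier[OF SP0] KC inj by (auto simp: inj_on_def)
    qed
    moreover have "card P0 = card P" unfolding P0_def by (rule i.card_img[OF subgroup.subset[OF SP]])
    ultimately have "is_sylow_of G 2 P0 K"
      using G.subgroup_incl[OF SP0 SK] cP cK by (simp add: is_sylow_of_def)
    then show ?thesis using cyclic_img[OF SP0 sy] hP0 by simp
  qed
  ultimately show ?thesis using SK' by (simp add: is_index2_def)
qed

end

lemma type_of_iso:
  assumes "finite_group G" "finite_group G'" "h \<in> iso G G'"
  shows "type_of G = type_of G'"
proof -
  interpret finite_group_iso G G' h
    using assms by (simp add: finite_group_iso_def finite_group_iso_axioms_def)
  interpret i: finite_group_iso G' G "inv_into (carrier G) h" by (rule inverse)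
  have "has_normal_2_complement G \<longleftrightarrow> has_normal_2_complement G'"
    "has_cyclic_2_sylow G \<longleftrightarrow> has_cyclic_2_sylow G'" "has_normal_8 G \<longleftrightarrow> has_normal_8 G'"
    using type_predicates i.type_predicates by blast+
  then show ?thesis using order_eq by (simp add: type_of_def)
qed

lemma invariants_of_iso:
  assumes G: "finite_group G" and G': "finite_group G'" and iso: "G \<cong> G'"
    and t: "has_type G \<tau> A" "has_type G' \<tau>' A'"
  shows "\<tau> = \<tau>'" "order G = order G'" "card A = card A'"
    "unit_image G A (carrier G) = unit_image G' A' (carrier G')"
    "\<tau> = Type_II \<Longrightarrow> 16 dvd order G \<Longrightarrow>
       unit_image G A (index2_subgroup G) = unit_image G' A' (index2_subgroup G')"
proof -
  obtain h where h: "h \<in> iso G G'" using iso by (auto simp: is_iso_def)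
  interpret finite_group_iso G G' h
    using G G' h by (simp add: finite_group_iso_def finite_group_iso_axioms_def)
  note T = G.has_type_invariants[OF t(1)] and T' = G'.has_type_invariants[OF t(2)]
  show \<tau>: "\<tau> = \<tau>'" using T(1) T'(1) type_of_iso[OF G G' h] by simp
  show o: "order G = order G'" by (rule order_eq)
  \<comment> \<open>Both A' and the image of A satisfy the characterization \<open>char_A\<close>,
    whose uniqueness identifies them.\<close>
  have A': "A' = h ` A" using G'.char_A_unique[OF T'(2) char_A_img[OF T(2)]] .
  have nA: "A \<lhd> G" using T(2) by (simp add: char_A_def)
  have AC: "A \<subseteq> carrier G" by (rule subgroup.subset[OF normal_imp_subgroup[OF nA]])
  show "card A = card A'" using A' card_img[OF AC] by simp
  show "unit_image G A (carrier G) = unit_image G' A' (carrier G')"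
    using unit_image_img[OF AC, of "carrier G"] surj A' by simp
  show "unit_image G A (index2_subgroup G) = unit_image G' A' (index2_subgroup G')"
    if II: "\<tau> = Type_II" and d16: "16 dvd order G"
  proof -
    obtain K where K: "is_index2 G K" "\<And>L. is_index2 G L \<Longrightarrow> L = K"
      using G.type_II_index2_unique[of A] t(1) II d16 by auto
    obtain K' where K': "is_index2 G' K'" "\<And>L. is_index2 G' L \<Longrightarrow> L = K'"
      using G'.type_II_index2_unique[of A'] t(2) II \<tau> d16 o by auto
    have "h ` K = K'" using K'(2) is_index2_img[OF K(1)] by blast
    moreover have "K \<subseteq> carrier G" using K(1) subgroup.subset by (auto simp: is_index2_def)
    ultimately show ?thesis
      using index2_subgroup_eq[OF K] index2_subgroup_eq[OF K'] unit_image_img[OF AC] A' by metis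
  qed
qed

section \<open>Groups with the same image in \<open>Aut(A)\<close>\<close>

lemma prime_power_cofactor_unique:
  fixes n n' p :: nat
  assumes "Factorial_Ring.prime p" "\<not> p dvd n" "\<not> p dvd n'" "n * p ^ k = n' * p ^ k'"
  shows "k = k' \<and> n = n'"
proof -
  have "multiplicity p (l * p ^ i) = i" if "\<not> p dvd l" for l i
  proof -
    have "l \<noteq> 0" using that by (metis dvd_0_right)
    moreover have "multiplicity p l = 0" using that by (rule not_dvd_imp_multiplicity_0)
    ultimately show ?thesis
      using assms(1) prime_elem_multiplicity_mult_distrib[of p l "p ^ i"]
      by (simp add: prime_elem_nat_iff multiplicity_same_power)
  qed
  then have k: "k = k'" using assms(2-4) by metis
  then show ?thesis using assms(1,4) by simp
qed

text \<open>Lets every lifting statement be read in the other direction by exchanging the roles of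
  the two groups.\<close>

lemma same_action_swap: "(x, y) \<in> same_action G a G' a' \<longleftrightarrow> (y, x) \<in> same_action G' a' G a"
  by (auto simp: same_action_def)

context finite_group
begin

lemma conj_by_generator:
  assumes "A \<lhd> G" "a \<in> carrier G" "generate G {a} = A" "g \<in> carrier G"
  shows "\<exists>u::nat. conj_by G g a = a [^] u"
proof -
  have "a \<in> A" using assms(3) by (auto intro: generate.incl)
  then have "conj_by G g a \<in> generate G {a}" using normal_conj_closed[OF assms(1,4)] assms(3) by simp
  then show ?thesis using assms(2) by (auto simp: generate_singleton)
qed

text \<open>The automorphism group of a cyclic group is abelian, so conjugate elements act on A in
  the same way. This is applied when one element inverts another.\<close>

lemma conj_by_generator_commute:
  assumes "A \<lhd> G" "a \<in> carrier G" "generate G {a} = A" "g \<in> carrier G" "h \<in> carrier G"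
  shows "conj_by G (conj_by G g h) a = conj_by G h a"
proof -
  obtain u :: nat where u: "conj_by G (inv g) a = a [^] u" using conj_by_generator[OF assms(1-3)] assms(4) by blast
  obtain v :: nat where v: "conj_by G h a = a [^] v" using conj_by_generator[OF assms(1-3,5)] by blast
  have "conj_by G (conj_by G g h) a = conj_by G g (conj_by G h (conj_by G (inv g) a))"
    using assms(2,4,5) by (simp add: conj_by_def[of G g h] conj_by_conj_by)
  also have "conj_by G h (conj_by G (inv g) a) = (a [^] v) [^] u"
    using assms(2,5) u v by (simp add: conj_by_pow)
  also have "\<dots> = (conj_by G (inv g) a) [^] v" using assms(2) u by (simp add: nat_pow_pow mult.commute)
  also have "conj_by G g \<dots> = a [^] v" using assms(2,4) by (simp add: conj_by_pow)
  finally show ?thesis using v by simp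
qed

text \<open>Conjugation preserves the order of a, so the exponent by which g acts is a unit modulo
  |A|; its reduction is the representative that \<open>unit_image\<close> uses.\<close>

lemma unit_image_power:
  assumes "A \<lhd> G" "a \<in> carrier G" "generate G {a} = A" "S \<subseteq> carrier G" "g \<in> S"
  shows "\<exists>u\<in>unit_image G A S. conj_by G g a = a [^] u"
proof -
  have g: "g \<in> carrier G" using assms(4,5) by blast
  have o: "ord a = card A" using generate_pow_card[OF assms(2)] assms(3) by simp
  obtain v :: nat where v: "conj_by G g a = a [^] v" using conj_by_generator[OF assms(1-3) g] by blast
  have "conj_by G g a [^] n = \<one> \<longleftrightarrow> a [^] n = \<one>" for n :: nat
    using conj_by_inj[OF g, of "a [^] n" \<one>] assms(2) g by (auto simp flip: conj_by_pow)
  then have "ord (conj_by G g a) = ord a" using assms(2) g by (simp add: ord_unique pow_eq_id)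
  then have cop: "coprime v (card A)"
    using pow_ord_eq_ord_iff[OF fin assms(2), of v] v o by simp
  \<comment> \<open>Representatives lie between 1 and \<open>card A\<close>, so remainder 0 is
    written as \<open>card A\<close>. Since v is prime to \<open>card A\<close>, this happens only
    for the trivial group, where the unit is 1.\<close>
  define u where "u = (if v mod card A = 0 then card A else v mod card A)"
  have pos: "card A > 0" using o ord_pos[OF assms(2)] by simp
  have um: "u mod card A = v mod card A" by (simp add: u_def)
  have "a [^] u = a [^] v"
  proof -
    have "a [^] k = a [^] (k mod card A)" for k :: nat
    proof -
      have "a [^] k = a [^] (card A * (k div card A) + k mod card A)" by simp
      also have "\<dots> = (a [^] card A) [^] (k div card A) \<otimes> a [^] (k mod card A)"
        using assms(2) by (simp only: nat_pow_mult nat_pow_pow)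
      also have "a [^] card A = \<one>" using pow_ord_eq_1[OF assms(2)] o by simp
      finally show ?thesis using assms(2) by simp
    qed
    then show ?thesis using um by metis
  qed
  then have ua: "conj_by G g a = a [^] u" using v by simp
  have "coprime u (card A)" using cop um by (metis coprime_mod_left_iff pos neq0_conv)
  moreover have "0 < u" "u \<le> card A" using pos by (simp_all add: u_def)
  ultimately have "u \<in> totatives (card A)" by (simp add: totatives_def)
  moreover have "n [^] u = conj_by G g n" if n: "n \<in> A" for n
  proof -
    obtain k :: nat where k: "n = a [^] k" using n assms(2,3) generate_singleton by blast
    show ?thesis unfolding k using ua assms(2) g by (simp add: conj_by_pow nat_pow_pow mult.commute)
  qed
  ultimately have "u \<in> unit_image G A S" using assms(5) by (auto simp: unit_image_iff)
  then show ?thesis using ua by blast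
qed

end

text \<open>The set S makes the statement serve both for the whole group and for the subgroup of
  index 2 in type II.\<close>

lemma same_action_lift:
  assumes "finite_group G" "finite_group G'"
    and A: "A \<lhd> G" "a \<in> carrier G" "generate G {a} = A" and S: "S \<subseteq> carrier G" "g \<in> S"
    and A': "a' \<in> A'" "S' \<subseteq> carrier G'" and u: "unit_image G A S \<subseteq> unit_image G' A' S'"
  shows "\<exists>g'\<in>S'. (g, g') \<in> same_action G a G' a'"
proof -
  interpret G: finite_group G by fact
  interpret G': finite_group G' by fact
  obtain u where u': "u \<in> unit_image G A S" "conj_by G g a = a [^]\<^bsub>G\<^esub> u"
    using G.unit_image_power[OF A S] by blast
  then obtain g' where "g' \<in> S'" "a' [^]\<^bsub>G'\<^esub> u = conj_by G' g' a'"
    using u A'(1) G'.unit_image_iff by blast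
  then show ?thesis
    using u'(2) S A'(2) by (intro bexI[of _ g']) (auto simp: same_action_def)
qed

section \<open>Lifting generators through the common action on A\<close>

locale action_pair = G: finite_group G + G': finite_group G'
  for G :: "('a, 'c) monoid_scheme" and G' :: "('b, 'd) monoid_scheme" +
  fixes A A' a a'
  assumes A: "A \<lhd> G" "a \<in> carrier G" "generate G {a} = A"
    and A': "A' \<lhd> G'" "a' \<in> carrier G'" "generate G' {a'} = A'"
    and card_A: "card A = card A'"
    and units: "unit_image G A (carrier G) = unit_image G' A' (carrier G')"
begin

sublocale group_pair G G' "same_action G a G' a'"
  by (simp add: group_pair_def group_pair_axioms_def G.finite_group_axioms G'.finite_group_axioms
      same_action_subgroup A(2) A'(2))

abbreviation "E \<equiv> same_action G a G' a'"
abbreviation "P \<equiv> G \<times>\<times> G'"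

lemma swapped: "action_pair G' G A' A a' a"
  using A A' card_A units
  by (simp add: action_pair_def action_pair_axioms_def G.finite_group_axioms G'.finite_group_axioms)

lemma a_mem: "a \<in> A" "a' \<in> A'"
  using A(3) A'(3) by (auto intro: generate.incl)

lemma aa_pow: "a [^]\<^bsub>G\<^esub> card A = \<one>\<^bsub>G\<^esub>" "a' [^]\<^bsub>G'\<^esub> card A = \<one>\<^bsub>G'\<^esub>"
  using G.pow_card_subgroup[OF normal_imp_subgroup[OF A(1)] a_mem(1)]
    G'.pow_card_subgroup[OF normal_imp_subgroup[OF A'(1)] a_mem(2)] card_A by simp_all

lemma E_kernel:
  assumes "z \<in> carrier G" "z' \<in> carrier G'" "conj_by G z a = a" "conj_by G' z' a' = a'"
  shows "(z, z') \<in> E"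
  using assms A(2) A'(2) by (auto simp: same_action_def intro!: exI[of _ 1])

lemma E_D: "(g, g') \<in> E \<Longrightarrow> \<exists>u::nat. conj_by G g a = a [^]\<^bsub>G\<^esub> u \<and> conj_by G' g' a' = a' [^]\<^bsub>G'\<^esub> u"
  by (auto simp: same_action_def)

text \<open>Both components move by the same exponent u, so (a, a') is sent to its own u-th power.
  This is the point at which membership in \<open>E\<close> enters the counting.\<close>

lemma conj_pair_a:
  assumes "(g, g') \<in> E" "(a, a') \<in> X"
  shows "conj_by P (g, g') (a, a') \<in> generate P X"
proof -
  obtain u :: nat where u: "conj_by G g a = a [^]\<^bsub>G\<^esub> u" "conj_by G' g' a' = a' [^]\<^bsub>G'\<^esub> u"
    using E_D[OF assms(1)] by blast
  have C: "g \<in> carrier G" "g' \<in> carrier G'" using E_carrier[OF assms(1)] .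
  have "conj_by P (g, g') (a, a') = (a, a') [^]\<^bsub>P\<^esub> u"
    using u C by (simp add: conj_by_DirProd[OF G.is_group G'.is_group] pow_DirProd)
  moreover have "p [^]\<^bsub>P\<^esub> u \<in> generate P X" if p: "p \<in> X" for p
  proof (induction u)
    case 0
    show ?case using generate.one[of P X] by simp
  next
    case (Suc u)
    show ?case using generate.eng[OF Suc generate.incl[OF p]] by simp
  qed
  ultimately show ?thesis using assms(2) by simp
qed

lemma card_generate_aa: "card (generate P {(a, a')}) \<le> card A"
proof -
  have C: "(a, a') \<in> carrier P" using A(2) A'(2) by simp
  have "(a, a') [^]\<^bsub>P\<^esub> card A = \<one>\<^bsub>P\<^esub>" using aa_pow by (simp add: pow_DirProd)
  then have "P.ord (a, a') dvd card A" by (simp only: P.pow_eq_id[OF C])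
  then show ?thesis
    using P.generate_pow_card[OF C] G.card_subgroup_pos[OF normal_imp_subgroup[OF A(1)]]
    by (simp add: dvd_imp_le)
qed

lemma lift: "g \<in> carrier G \<Longrightarrow> \<exists>g'\<in>carrier G'. (g, g') \<in> E"
  using same_action_lift[OF G.finite_group_axioms G'.finite_group_axioms A subset_refl _ a_mem(2) subset_refl] units
  by blast

text \<open>A partner of g factors as z (b' t') with z centralizing A'; then (1, z) belongs to
  \<open>E\<close> and z can be cancelled. The commuting factors b' and t' have coprime orders, and
  the one whose order does not match is removed.\<close>

lemma split_lift:
  assumes s: "action_split G A B T" and s': "action_split G' A' B' T'"
    and c: "card B = card B'" "card T = card T'"
  shows "b \<in> B \<Longrightarrow> \<exists>b'\<in>B'. (b, b') \<in> E" "t \<in> T \<Longrightarrow> \<exists>t'\<in>T'. (t, t') \<in> E"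
proof -
  have S: "subgroup B G" "subgroup T G" "subgroup B' G'" "subgroup T' G'" "coprime (card B) (card T)"
    using s s' by (simp_all add: action_split_def)
  have com: "b \<otimes>\<^bsub>G'\<^esub> t = t \<otimes>\<^bsub>G'\<^esub> b" if "b \<in> B'" "t \<in> T'" for b t
    using s' that unfolding action_split_def by blast
  have dec: "\<exists>b'\<in>B'. \<exists>t'\<in>T'. (g, b' \<otimes>\<^bsub>G'\<^esub> t') \<in> E" if g: "g \<in> carrier G" for g
  proof -
    obtain g' where g': "g' \<in> carrier G'" "(g, g') \<in> E" using lift[OF g] by blast
    obtain z b' t' where z: "z \<in> carrier G'" "\<forall>x\<in>A'. conj_by G' z x = x" "b' \<in> B'" "t' \<in> T'"
      "g' = z \<otimes>\<^bsub>G'\<^esub> (b' \<otimes>\<^bsub>G'\<^esub> t')"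
      using s' g'(1) by (auto simp: action_split_def)
    have bt: "b' \<otimes>\<^bsub>G'\<^esub> t' \<in> carrier G'" using z(3,4) S(3,4) G'.subgroup_mem_carrier by simp
    have "(\<one>\<^bsub>G\<^esub>, z) \<in> E" using z(1,2) a_mem(2) A(2) by (intro E_kernel) auto
    moreover have "(\<one>\<^bsub>G\<^esub> \<otimes>\<^bsub>G\<^esub> g, z \<otimes>\<^bsub>G'\<^esub> (b' \<otimes>\<^bsub>G'\<^esub> t')) \<in> E" using g'(2) g z(5) by simp
    ultimately have "(g, b' \<otimes>\<^bsub>G'\<^esub> t') \<in> E" using E_cancel_left g bt by blast
    then show ?thesis using z(3,4) by blast
  qed
  have one: "(\<one>\<^bsub>G\<^esub>, x [^]\<^bsub>G'\<^esub> card H) \<in> E" if "subgroup H G'" "x \<in> H" for H x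
    using G'.pow_card_subgroup[OF that] E_one by simp
  show "\<exists>b'\<in>B'. (b, b') \<in> E" if b: "b \<in> B"
  proof -
    obtain b' t' where bt: "b' \<in> B'" "t' \<in> T'" "(b, b' \<otimes>\<^bsub>G'\<^esub> t') \<in> E"
      using dec G.subgroup_mem_carrier[OF S(1) b] by blast
    have C: "b' \<in> carrier G'" "t' \<in> carrier G'"
      using G'.subgroup_mem_carrier[OF S(3) bt(1)] G'.subgroup_mem_carrier[OF S(4) bt(2)] .
    have p: "b' [^]\<^bsub>G'\<^esub> card B = \<one>\<^bsub>G'\<^esub>" unfolding c(1) by (rule G'.pow_card_subgroup[OF S(3) bt(1)])
    have cop: "coprime (card B) (card T')" using S(5) unfolding c(2) .
    have "(b, b') \<in> E"
      by (rule E_coprime_part[OF bt(3) C com[OF bt(1,2)] G.pow_card_subgroup[OF S(1) b] p one[OF S(4) bt(2)] cop])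
    then show ?thesis using bt(1) by blast
  qed
  show "\<exists>t'\<in>T'. (t, t') \<in> E" if t: "t \<in> T"
  proof -
    obtain b' t' where bt: "b' \<in> B'" "t' \<in> T'" "(t, b' \<otimes>\<^bsub>G'\<^esub> t') \<in> E"
      using dec G.subgroup_mem_carrier[OF S(2) t] by blast
    have tb: "t' \<otimes>\<^bsub>G'\<^esub> b' = b' \<otimes>\<^bsub>G'\<^esub> t'" using com[OF bt(1,2)] by simp
    have "(t, t' \<otimes>\<^bsub>G'\<^esub> b') \<in> E" using bt(3) tb by simp
    have C: "t' \<in> carrier G'" "b' \<in> carrier G'"
      using G'.subgroup_mem_carrier[OF S(4) bt(2)] G'.subgroup_mem_carrier[OF S(3) bt(1)] .
    have p: "t' [^]\<^bsub>G'\<^esub> card T = \<one>\<^bsub>G'\<^esub>" unfolding c(2) by (rule G'.pow_card_subgroup[OF S(4) bt(2)])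
    have cop: "coprime (card T) (card B')" using S(5) unfolding c(1) by (simp only: coprime_commute)
    have "(t, t') \<in> E"
      by (rule E_coprime_part[OF \<open>(t, t' \<otimes>\<^bsub>G'\<^esub> b') \<in> E\<close> C tb G.pow_card_subgroup[OF S(2) t] p one[OF S(3) bt(1)] cop])
    then show ?thesis using bt(2) by blast
  qed
qed

lemma split_lift':
  assumes s: "action_split G A B T" and s': "action_split G' A' B' T'"
    and c: "card B = card B'" "card T = card T'"
  shows "b' \<in> B' \<Longrightarrow> \<exists>b\<in>B. (b, b') \<in> E" "t' \<in> T' \<Longrightarrow> \<exists>t\<in>T. (t, t') \<in> E"
proof -
  interpret s: action_pair G' G A' A a' a by (rule swapped)
  show "b' \<in> B' \<Longrightarrow> \<exists>b\<in>B. (b, b') \<in> E" "t' \<in> T' \<Longrightarrow> \<exists>t\<in>T. (t, t') \<in> E"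
    using s.split_lift[OF s' s c[symmetric]] by (simp_all only: same_action_swap[of _ _ G a G' a'])
qed

text \<open>An arbitrary generator of B is kept, and only that of B' is replaced, by a power whose
  exponent is prime to its order.\<close>

lemma cyclic_pair:
  assumes B: "subgroup B G" "cyclic_group (G\<lparr>carrier := B\<rparr>)" and B': "subgroup B' G'" "cyclic_group (G'\<lparr>carrier := B'\<rparr>)"
    and l: "\<And>b. b \<in> B \<Longrightarrow> \<exists>b'\<in>B'. (b, b') \<in> E" "\<And>b'. b' \<in> B' \<Longrightarrow> \<exists>b\<in>B. (b, b') \<in> E"
  shows "\<exists>b b'. b \<in> B \<and> b' \<in> B' \<and> generate G {b} = B \<and> generate G' {b'} = B' \<and> (b, b') \<in> E"
proof -
  obtain b where b: "b \<in> B" "b \<in> carrier G" "generate G {b} = B" "G.ord b = card B" by (rule G.cyclic_subgroupE[OF B])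
  obtain b' where b': "b' \<in> B'" "b' \<in> carrier G'" "generate G' {b'} = B'" "G'.ord b' = card B'" by (rule G'.cyclic_subgroupE[OF B'])
  obtain j :: nat where j: "(b, b' [^]\<^bsub>G'\<^esub> j) \<in> E"
    using l(1)[OF b(1)] b'(2,3) G'.generate_singleton[OF b'(2)] by auto
  obtain i :: nat where i: "(b [^]\<^bsub>G\<^esub> i, b') \<in> E"
    using l(2)[OF b'(1)] b(2,3) G.generate_singleton[OF b(2)] by auto
  obtain k :: nat where k: "coprime k (G'.ord b')" "(b, b' [^]\<^bsub>G'\<^esub> k) \<in> E"
    using cyclic_lift[OF b(2) b'(2) j i] by blast
  have m: "b' [^]\<^bsub>G'\<^esub> k \<in> B'" by (rule G'.subgroup_pow_closed[OF B'(1) b'(1)])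
  have "G'.ord (b' [^]\<^bsub>G'\<^esub> k) = card B'"
    using G'.pow_ord_eq_ord_iff[OF G'.fin b'(2), of k] k(1) b'(4) by simp
  then have "generate G' {b' [^]\<^bsub>G'\<^esub> k} = B'" by (rule G'.cyclic_subgroupI(2)[OF B'(1) m])
  then show ?thesis using b m k(2) by blast
qed

lemma generate_pair_intros:
  "(x, x') \<in> X \<Longrightarrow> (x, x') \<in> generate P X"
  "(\<one>\<^bsub>G\<^esub>, \<one>\<^bsub>G'\<^esub>) \<in> generate P X"
  "(x, x') \<in> generate P X \<Longrightarrow> (y, y') \<in> generate P X \<Longrightarrow> (x \<otimes>\<^bsub>G\<^esub> y, x' \<otimes>\<^bsub>G'\<^esub> y') \<in> generate P X"
proof -
  show "(x, x') \<in> X \<Longrightarrow> (x, x') \<in> generate P X" by (rule generate.incl)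
  show "(\<one>\<^bsub>G\<^esub>, \<one>\<^bsub>G'\<^esub>) \<in> generate P X" using generate.one[of P X] by simp
  show "(x, x') \<in> generate P X \<Longrightarrow> (y, y') \<in> generate P X \<Longrightarrow> (x \<otimes>\<^bsub>G\<^esub> y, x' \<otimes>\<^bsub>G'\<^esub> y') \<in> generate P X"
    using generate.eng[of "(x, x')" P X "(y, y')"] by simp
qed

lemma generate_pair_inv:
  assumes "X \<subseteq> carrier P" "(x, x') \<in> generate P X"
  shows "(inv\<^bsub>G\<^esub> x, inv\<^bsub>G'\<^esub> x') \<in> generate P X"
proof -
  have "(x, x') \<in> carrier P" using P.generate_in_carrier[OF assms] .
  then show ?thesis
    using P.generate_m_inv_closed[OF assms] by (simp add: inv_DirProd[OF G.is_group G'.is_group])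
qed

lemma generate_pair_pow:
  "(x, x') \<in> generate P X \<Longrightarrow> (x [^]\<^bsub>G\<^esub> (n::nat), x' [^]\<^bsub>G'\<^esub> n) \<in> generate P X"
  by (induction n) (simp_all add: generate_pair_intros)

lemma conj_pair_aE: "(g, g') \<in> E \<Longrightarrow> (a, a') \<in> X \<Longrightarrow> (conj_by G g a, conj_by G' g' a') \<in> generate P X"
  using conj_pair_a[of g g' X] E_carrier[of g g'] by (simp add: conj_by_DirProd[OF G.is_group G'.is_group])

end

section \<open>Generators and their actions\<close>

context finite_group
begin

lemma generate_singleton_mono: "x \<in> X \<Longrightarrow> generate G {x} \<subseteq> generate G X"
  by (rule mono_generate) simp

lemma AB_conj_trivial:
  assumes "AB_conditions G A B" "x \<in> A" "y \<in> A"
  shows "conj_by G x y = y"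
proof -
  note ab = AB_conditionsD[OF assms(1)]
  have "x \<in> carrier G" "y \<in> carrier G" using ab(1) assms(2,3) subgroup_mem_carrier by blast+
  then show ?thesis using cyclic_commute[OF ab(1,3) assms(2,3)] by (simp add: conj_by_eq_self_iff)
qed

lemma action_splitI:
  assumes "AB_conditions G A B" "A \<lhd> G" "subgroup T G" "coprime (card B) (card T)"
    and "\<And>b t. b \<in> B \<Longrightarrow> t \<in> T \<Longrightarrow> b \<otimes> t = t \<otimes> b"
    and "\<And>g. g \<in> carrier G \<Longrightarrow>
      \<exists>z\<in>carrier G. \<exists>b\<in>B. \<exists>t\<in>T. (\<forall>a\<in>A. conj_by G z a = a) \<and> g = z \<otimes> (b \<otimes> t)"
  shows "action_split G A B T"
proof -
  note ab = AB_conditionsD[OF assms(1)]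
  have "\<forall>g\<in>carrier G. \<exists>z\<in>carrier G. (\<forall>a\<in>A. conj_by G z a = a) \<and> (\<exists>b\<in>B. \<exists>t\<in>T. g = z \<otimes> (b \<otimes> t))"
    using assms(6) by blast
  then show ?thesis
    unfolding action_split_def using assms(2-5) ab by blast
qed

lemma type_I_II_split:
  assumes AB: "AB_conditions G A B" and BT: "internal_direct G BT B T"
    and G: "internal_semidirect G (carrier G) A BT" and T: "card T = 2 ^ k"
  shows "action_split G A B T"
proof -
  note ab = AB_conditionsD[OF AB] and D = type_I_II_D[OF AB BT G]
  show ?thesis
  proof (rule action_splitI[OF AB D(1,2) _ D(4)])
    show "coprime (card B) (card T)" using ab(6) T by simp
    fix g assume "g \<in> carrier G"
    then obtain x b t where g: "x \<in> A" "b \<in> B" "t \<in> T" "g = x \<otimes> (b \<otimes> t)" using D(5) by blast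
    have "x \<in> carrier G" using ab(1) g(1) by (rule subgroup_mem_carrier)
    then show "\<exists>z\<in>carrier G. \<exists>b\<in>B. \<exists>t\<in>T. (\<forall>a\<in>A. conj_by G z a = a) \<and> g = z \<otimes> (b \<otimes> t)"
      using g AB_conj_trivial[OF AB g(1)] by blast
  qed
qed

lemma conj_by_central_product:
  assumes "subgroup A G" "q \<in> carrier G" "\<And>a. a \<in> A \<Longrightarrow> q \<otimes> a = a \<otimes> q" "a \<in> A"
  shows "conj_by G q a = a"
  using assms subgroup_mem_carrier[OF assms(1,4)] by (simp add: conj_by_eq_self_iff)

text \<open>If the generator c centralized Q, all of \<open>\<Theta>\<close> would. So c, having odd
  order, acts as a 3-cycle.\<close>

lemma type_III_quat:
  assumes dec: "type_III_decomposition G H Q A C B" and c: "c \<in> C" "generate G {c} = C"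
  shows "\<exists>x y. quat_gens G Q 3 x y \<and> conj_by G c x = y \<and> conj_by G c y = x \<otimes> y"
proof -
  note D = type_III_D[OF dec]
  have cC: "c \<in> carrier G" using D(4) c(1) by (rule subgroup_mem_carrier)
  obtain x y where xy: "quat_gens G Q 3 x y" using D(11) by blast
  have n: "conj_by G c q \<in> Q" if "q \<in> Q" for q using D(17)[OF _ that] c(1) D(7) by blast
  have odd: "odd (card C)" using D(13) by auto
  have "\<not> (\<forall>q\<in>Q. conj_by G c q = q)"
  proof
    assume triv: "\<forall>q\<in>Q. conj_by G c q = q"
    obtain d q where d: "d \<in> C" "q \<in> Q" "conj_by G d q \<noteq> q" using D(14) by blast
    have qC: "q \<in> carrier G" using D(3) d(2) by (rule subgroup_mem_carrier)
    obtain k :: nat where k: "d = c [^] k" using d(1) c(2) generate_singleton[OF cC] by blast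
    have "conj_by G (c [^] k) q = q"
      by (induction k) (use triv d(2) qC cC in \<open>simp_all add: conj_by_conj_by\<close>)
    then show False using d(3) k by simp
  qed
  then show ?thesis
    using q8_odd_action[OF xy cC n pow_card_subgroup[OF D(4) c(1)] odd] by blast
qed

lemma type_III_split:
  assumes dec: "type_III_decomposition G (carrier G) Q A C B" and A: "A \<lhd> G"
  shows "action_split G A B C"
proof -
  note D = type_III_D[OF dec]
  note ab = AB_conditionsD[OF D(1)]
  obtain j where j: "card C = 3 ^ j" using D(13) by blast
  show ?thesis
  proof (rule action_splitI[OF D(1) A D(4)])
    show "coprime (card B) (card C)" using D(16) j by simp
    show "\<And>b t. b \<in> B \<Longrightarrow> t \<in> C \<Longrightarrow> b \<otimes> t = t \<otimes> b" using D(20) by metis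
    fix g assume "g \<in> carrier G"
    then obtain q x c b where g: "q \<in> Q" "x \<in> A" "c \<in> C" "b \<in> B" "g = (q \<otimes> x) \<otimes> (c \<otimes> b)" using D(22) by blast
    have C: "q \<in> carrier G" "x \<in> carrier G" using D(3) ab(1) g subgroup_mem_carrier by blast+
    have "conj_by G (q \<otimes> x) y = y" if "y \<in> A" for y
    proof -
      have "conj_by G q y = y" using conj_by_central_product[OF ab(1) C(1) _ that] D(19) g(1) by blast
      then show ?thesis
        using AB_conj_trivial[OF D(1) g(2) that] C subgroup_mem_carrier[OF ab(1) that] by (simp add: conj_by_conj_by)
    qed
    then show "\<exists>z\<in>carrier G. \<exists>b\<in>B. \<exists>t\<in>C. (\<forall>a\<in>A. conj_by G z a = a) \<and> g = z \<otimes> (b \<otimes> t)"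
      using g C D(20)[OF g(3,4)] by (intro bexI[of _ "q \<otimes> x"] bexI[of _ b] bexI[of _ c]) auto
  qed
qed

text \<open>By \<open>dec\<close> the group H acts on A through B alone, so G acts through B and the
  cyclic group of order 4 generated by f, and f commutes with B.\<close>

lemma extension_split:
  assumes AB: "AB_conditions G A B" and A: "A \<lhd> G" and f: "f \<in> carrier G" "ord f = 4"
    and fb: "\<forall>b\<in>B. conj_by G f b = b"
    and dec: "\<forall>h\<in>H. \<exists>z\<in>carrier G. \<exists>b\<in>B. (\<forall>a\<in>A. conj_by G z a = a) \<and> h = z \<otimes> b"
    and ext: "\<forall>g\<in>carrier G. \<exists>h\<in>H. g = h \<or> g = h \<otimes> f"
  shows "action_split G A B (generate G {f})"
proof -
  note ab = AB_conditionsD[OF AB]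
  have BC: "b \<in> carrier G" if "b \<in> B" for b using ab(2) that by (rule subgroup_mem_carrier)
  show ?thesis
  proof (rule action_splitI[OF AB A])
    show "subgroup (generate G {f}) G" using f(1) by (intro generate_is_subgroup) simp
    show "coprime (card B) (card (generate G {f}))"
      using generate_pow_card[OF f(1)] f(2) ab(6) coprime_power_right_iff[of "card B" 2 2] by simp
    show "b \<otimes> t = t \<otimes> b" if bt: "b \<in> B" "t \<in> generate G {f}" for b t
    proof -
      obtain k :: nat where k: "t = f [^] k" using bt(2) generate_singleton[OF f(1)] by blast
      have "f \<otimes> b = b \<otimes> f" using bspec[OF fb bt(1)] f(1) BC[OF bt(1)] by (simp add: conj_by_eq_self_iff)
      then show ?thesis using group_commutes_pow[OF _ f(1) BC[OF bt(1)], of k] k by simp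
    qed
    fix g assume "g \<in> carrier G"
    then obtain h where h: "h \<in> H" "g = h \<or> g = h \<otimes> f" using ext by blast
    obtain z b where z: "z \<in> carrier G" "b \<in> B" "\<forall>a\<in>A. conj_by G z a = a" "h = z \<otimes> b" using bspec[OF dec h(1)] by blast
    have "\<exists>t\<in>generate G {f}. g = z \<otimes> (b \<otimes> t)"
      using h(2)
    proof
      assume "g = h"
      then have "g = z \<otimes> (b \<otimes> \<one>)" using z BC by simp
      then show ?thesis using generate.one[of G "{f}"] by blast
    next
      assume "g = h \<otimes> f"
      then have "g = z \<otimes> (b \<otimes> f)" using z BC f(1) by (simp add: m_assoc)
      then show ?thesis using generate.incl[of f "{f}" G] by blast
    qed
    then show "\<exists>z\<in>carrier G. \<exists>b\<in>B. \<exists>t\<in>generate G {f}. (\<forall>a\<in>A. conj_by G z a = a) \<and> g = z \<otimes> (b \<otimes> t)"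
      using z by blast
  qed
qed

text \<open>Aut(A) is abelian, so c and its conjugate c^-1 act alike and c^2 acts trivially; the odd
  order of c finishes the argument. In type IV it follows that \<open>\<Theta>\<close> centralizes
  A.\<close>

lemma inverted_acts_trivially:
  assumes A: "A \<lhd> G" "a \<in> carrier G" "generate G {a} = A" and C: "f \<in> carrier G" "c \<in> carrier G"
    and inv: "conj_by G f c = inv c" and ord: "c [^] (n::nat) = \<one>" "odd n"
  shows "conj_by G c a = a"
proof -
  have "conj_by G (inv c) a = conj_by G c a"
    using conj_by_generator_commute[OF A C] inv by simp
  then have "conj_by G c (conj_by G c a) = a"
    using C(2) A(2) by (metis conj_by_inv_cancel(2))
  then have "conj_by G (c [^] (2::nat)) a = a"
    using C(2) A(2) by (simp add: numeral_2_eq_2 conj_by_conj_by)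
  then have "c [^] (2::nat) \<otimes> a = a \<otimes> c [^] (2::nat)" using C(2) A(2) by (simp add: conj_by_eq_self_iff)
  then have "c \<otimes> a = a \<otimes> c"
    using coprime_pow_commute[OF C(2) A(2) _ ord(1), of 2] ord(2) by simp
  then show ?thesis using C(2) A(2) by (simp add: conj_by_eq_self_iff)
qed

lemma type_IV_E:
  assumes "type_IV_structure G A"
  obtains H Q C B f where "type_III_decomposition G H Q A C B" "order G = 2 * card H"
    "f \<in> carrier G" "ord f = 4" "f \<otimes> f \<in> H" "\<forall>g\<in>carrier G. \<exists>h\<in>H. g = h \<or> g = h \<otimes> f"
    "\<forall>q\<in>Q. conj_by G f q \<in> Q" "\<forall>c\<in>C. conj_by G f c = inv c" "\<forall>b\<in>B. conj_by G f b = b"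
proof -
  obtain H Q C B F where d: "type_III_decomposition G H Q A C B" and n: "nonsplit_extension_by_2 G H F"
    and F: "\<forall>f\<in>F. ord f = 4 \<longrightarrow> acts_by_outer_auto G f Q \<and> acts_by_inversion G f C \<and> acts_trivially G f B"
    using assms by (auto simp: type_IV_structure_def)
  note N = nonsplit_extension_D[OF n]
  obtain f where f: "f \<in> F" "f \<in> carrier G" "ord f = 4" "f \<otimes> f \<in> H" "\<forall>g\<in>carrier G. \<exists>h\<in>H. g = h \<or> g = h \<otimes> f"
    using N(3) by blast
  have act: "acts_by_outer_auto G f Q" "acts_by_inversion G f C" "acts_trivially G f B" using F f(1,3) by blast+
  have Q: "\<forall>q\<in>Q. conj_by G f q \<in> Q" using acts_by_outer_auto_maps[OF act(1)] by blast
  have c: "\<forall>c\<in>C. conj_by G f c = inv c" using act(2) by (simp add: acts_by_inversion_iff)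
  have b: "\<forall>b\<in>B. conj_by G f b = b" using act(3) by (simp add: acts_trivially_iff)
  show thesis by (rule that[OF d N(2) f(2-5) Q c b])
qed

lemma type_VI_E:
  assumes "type_VI_structure G A"
  obtains H Q B f where "type_V_decomposition G H Q A B" "order G = 2 * card H"
    "f \<in> carrier G" "ord f = 4" "f \<otimes> f \<in> H" "\<forall>g\<in>carrier G. \<exists>h\<in>H. g = h \<or> g = h \<otimes> f"
    "\<forall>q\<in>Q. conj_by G f q \<in> Q" "\<forall>x\<in>Q. \<exists>q\<in>Q. conj_by G f q \<noteq> conj_by G x q"
    "\<forall>b\<in>B. conj_by G f b = b"
proof -
  obtain H Q B F where d: "type_V_decomposition G H Q A B" and n: "nonsplit_extension_by_2 G H F"
    and F: "\<forall>f\<in>F. ord f = 4 \<longrightarrow> acts_by_outer_auto G f Q \<and> acts_trivially G f B"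
    using assms by (auto simp: type_VI_structure_def)
  note N = nonsplit_extension_D[OF n]
  obtain f where f: "f \<in> F" "f \<in> carrier G" "ord f = 4" "f \<otimes> f \<in> H" "\<forall>g\<in>carrier G. \<exists>h\<in>H. g = h \<or> g = h \<otimes> f"
    using N(3) by blast
  have act: "acts_by_outer_auto G f Q" "acts_trivially G f B" using F f(1,3) by blast+
  have Q: "\<forall>q\<in>Q. conj_by G f q \<in> Q" using acts_by_outer_auto_maps[OF act(1)] by blast
  have x: "\<forall>x\<in>Q. \<exists>q\<in>Q. conj_by G f q \<noteq> conj_by G x q"
  proof (intro ballI, rule ccontr)
    fix x assume x: "x \<in> Q" and "\<not> (\<exists>q\<in>Q. conj_by G f q \<noteq> conj_by G x q)"
    then have "conj_map G Q f = conj_map G Q x"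
      unfolding conj_map_def conj_by_def by (intro restrict_ext) simp
    then show False using act(1) x by (auto simp: acts_by_outer_auto_def)
  qed
  have b: "\<forall>b\<in>B. conj_by G f b = b" using act(2) by (simp add: acts_trivially_iff)
  show thesis by (rule that[OF d N(2) f(2-5) Q x b])
qed

text \<open>The generators of Q are adapted to c and then rotated so that f acts by fixed formulas.
  The square of f has order 2 and lies in H, hence in Q by coprimality, and Q has only one
  involution.\<close>

lemma type_IV_quat:
  assumes dec: "type_III_decomposition G H Q A C B" and c: "c \<in> C" "generate G {c} = C"
    and f: "f \<in> carrier G" "ord f = 4" "f \<otimes> f \<in> H" "\<forall>q\<in>Q. conj_by G f q \<in> Q" "conj_by G f c = inv c"
  shows "\<exists>x y. quat_gens G Q 3 x y \<and> conj_by G c x = y \<and> conj_by G c y = x \<otimes> y \<and>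
    conj_by G f x = inv x \<and> conj_by G f y = inv (x \<otimes> y) \<and> f \<otimes> f = x \<otimes> x"
proof -
  note D = type_III_D[OF dec]
  note ab = AB_conditionsD[OF D(1)]
  have cC: "c \<in> carrier G" using D(4) c(1) by (rule subgroup_mem_carrier)
  obtain x0 y0 where 0: "quat_gens G Q 3 x0 y0" "conj_by G c x0 = y0" "conj_by G c y0 = x0 \<otimes> y0"
    using type_III_quat[OF dec c] by blast
  obtain x y where xy: "quat_gens G Q 3 x y" "conj_by G c x = y" "conj_by G c y = x \<otimes> y"
      "conj_by G f x = inv x" "conj_by G f y = inv (x \<otimes> y)"
    using q8_inverted_action[OF 0(1) cC f(1) 0(2,3) _ f(5)] f(4) by blast
  have f4: "f [^] (4::nat) = \<one>" using pow_ord_eq_1[OF f(1)] f(2) by simp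
  then have ff4: "(f \<otimes> f) \<otimes> (f \<otimes> f) = \<one>" using f(1) by (simp add: eval_nat_numeral m_assoc)
  have odd: "odd (card A * (card C * card B))" using ab(5,6) D(13) by auto
  have ffQ: "f \<otimes> f \<in> Q"
  proof (rule hall_mem_subgroup[OF D(2,3,5,17) _ f(3)])
    show "card H = card Q * (card A * (card C * card B))" using D(9,10) by simp
    show "(f \<otimes> f) [^] (2::nat) = \<one>" using ff4 f(1) by (simp add: numeral_2_eq_2)
    show "coprime 2 (card A * (card C * card B))" using odd by simp
  qed auto
  have "f \<otimes> f \<noteq> \<one>"
  proof
    assume "f \<otimes> f = \<one>"
    then have "f [^] (2::nat) = \<one>" using f(1) by (simp add: numeral_2_eq_2)
    then have "4 dvd (2::nat)" using pow_eq_id[OF f(1), of 2] f(2) by simp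
    then show False by simp
  qed
  then have "f \<otimes> f = x \<otimes> x" using q8_square[OF xy(1) ffQ] q8_center(4)[OF xy(1)] ff4 by auto
  then show ?thesis using xy by blast
qed

text \<open>As y inverts x and Aut(A) is abelian, x^2 acts trivially, and every square in T is an
  even power of x.\<close>

lemma quat_square_trivial:
  assumes q: "quat_gens G T m x y" and A: "A \<lhd> G" "a \<in> carrier G" "generate G {a} = A" and t: "t \<in> T"
  shows "conj_by G (t \<otimes> t) a = a"
proof -
  note Q = quat_simps[OF q]
  have "conj_by G (inv x) a = conj_by G x a"
    using conj_by_generator_commute[OF A Q(11,10)] Q(8) by simp
  then have "conj_by G x (conj_by G x a) = a" using Q(10) A(2) by (metis conj_by_inv_cancel(2))
  then have xx: "conj_by G (x [^] (2::nat)) a = a" using Q(10) A(2) by (simp add: numeral_2_eq_2 conj_by_conj_by)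
  have even: "conj_by G (x [^] (2 * k)) a = a" for k :: nat
  proof (induction k)
    case 0
    show ?case using A(2) by simp
  next
    case (Suc k)
    have "x [^] (2 * Suc k) = x [^] (2::nat) \<otimes> x [^] (2 * k)" using Q(10) by (simp add: nat_pow_mult)
    then show ?case using Suc xx Q(10) A(2) by (simp add: conj_by_conj_by)
  qed
  show ?thesis
  proof (cases "t \<in> generate G {x}")
    case True
    then obtain i :: nat where "t = x [^] i" using generate_singleton[OF Q(10)] by blast
    then have "t \<otimes> t = x [^] (2 * i)" using Q(10) by (simp add: nat_pow_mult mult_2)
    then show ?thesis using even by simp
  next
    case False
    have "t \<otimes> t = t [^] (2::nat)" using subgroup_mem_carrier[OF Q(1) t] by (simp add: numeral_2_eq_2)
    also have "\<dots> = x [^] ((2::nat) * 2 ^ (m - 3))"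
    proof -
      have "(2::nat) ^ (m - 2) = 2 * 2 ^ (m - 3)" using Q(2) by (simp flip: power_Suc add: Suc_diff_le numeral_3_eq_3)
      then show ?thesis using quat_simps(9)[OF quat_change_y[OF q t False]] by simp
    qed
    finally show ?thesis using even by simp
  qed
qed

lemma conj_trivial_on_generate:
  assumes "c \<in> carrier G" "a \<in> carrier G" "conj_by G c a = a" "x \<in> generate G {a}"
  shows "conj_by G c x = x"
proof -
  obtain k :: nat where "x = a [^] k" using assms(4) generate_singleton[OF assms(2)] by blast
  then show ?thesis using assms(1-3) by (simp add: conj_by_pow)
qed

lemma type_III_generate:
  assumes dec: "type_III_decomposition G H Q A C B" and q: "quat_gens G Q 3 x y"
    and g: "generate G {a} = A" "generate G {b} = B" "generate G {c} = C" and Y: "{a, b, c, x, y} \<subseteq> Y"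
  shows "H \<subseteq> generate G Y"
proof
  fix h assume "h \<in> H"
  then obtain q0 a0 c0 b0 where h: "q0 \<in> Q" "a0 \<in> A" "c0 \<in> C" "b0 \<in> B" "h = (q0 \<otimes> a0) \<otimes> (c0 \<otimes> b0)"
    using type_III_D(22)[OF dec] by blast
  have "generate G {x, y} \<subseteq> generate G Y" using Y by (intro mono_generate) simp
  then have "q0 \<in> generate G Y" using h(1) quat_generate[OF q] by blast
  moreover have "a0 \<in> generate G Y" "b0 \<in> generate G Y" "c0 \<in> generate G Y"
    using h(2-4) g Y generate_singleton_mono[of a Y] generate_singleton_mono[of b Y] generate_singleton_mono[of c Y]
    by blast+
  ultimately show "h \<in> generate G Y" unfolding h(5) by (intro generate.eng)
qed

text \<open>Since \<open>C\<close> is inverted by f it centralizes A, so the factors from Q, A and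
  \<open>C\<close> all go into the part acting trivially, and only B and f are left.\<close>

lemma type_IV_split:
  assumes dec: "type_III_decomposition G H Q A C B" and A: "A \<lhd> G" "a \<in> carrier G" "generate G {a} = A"
    and f: "f \<in> carrier G" "ord f = 4" "\<forall>b\<in>B. conj_by G f b = b" "\<forall>c\<in>C. conj_by G f c = inv c"
    and ext: "\<forall>g\<in>carrier G. \<exists>h\<in>H. g = h \<or> g = h \<otimes> f"
  shows "action_split G A B (generate G {f})" "\<And>c. c \<in> C \<Longrightarrow> conj_by G c a = a"
proof -
  note D = type_III_D[OF dec]
  note ab = AB_conditionsD[OF D(1)]
  have CC: "c \<in> carrier G" if "c \<in> C" for c using D(4) that by (rule subgroup_mem_carrier)
  have odd: "odd (card C)" using D(13) by auto
  show triv: "conj_by G c a = a" if c: "c \<in> C" for c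
    by (rule inverted_acts_trivially[OF A f(1) CC[OF c] bspec[OF f(4) c] pow_card_subgroup[OF D(4) c] odd])
  show "action_split G A B (generate G {f})"
  proof (rule extension_split[OF D(1) A(1) f(1-3) _ ext], rule ballI)
    fix h assume "h \<in> H"
    then obtain q x c b where g: "q \<in> Q" "x \<in> A" "c \<in> C" "b \<in> B" "h = (q \<otimes> x) \<otimes> (c \<otimes> b)" using D(22) by blast
    have C: "q \<in> carrier G" "x \<in> carrier G" "b \<in> carrier G"
      using subgroup_mem_carrier[OF D(3) g(1)] subgroup_mem_carrier[OF ab(1) g(2)] subgroup_mem_carrier[OF ab(2) g(4)] .
    have "conj_by G ((q \<otimes> x) \<otimes> c) y = y" if y: "y \<in> A" for y
    proof -
      have yC: "y \<in> carrier G" using ab(1) y by (rule subgroup_mem_carrier)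
      have "conj_by G q y = y" using conj_by_central_product[OF ab(1) C(1) _ y] D(19) g(1) by blast
      moreover have "conj_by G x y = y" by (rule AB_conj_trivial[OF D(1) g(2) y])
      moreover have "conj_by G c y = y" using conj_trivial_on_generate[OF CC[OF g(3)] A(2) triv[OF g(3)]] A(3) y by simp
      ultimately show ?thesis using C(1,2) CC[OF g(3)] yC by (simp add: conj_by_conj_by)
    qed
    moreover have "h = ((q \<otimes> x) \<otimes> c) \<otimes> b" unfolding g(5) using C CC[OF g(3)] by (simp add: m_assoc)
    ultimately show "\<exists>z\<in>carrier G. \<exists>b\<in>B. (\<forall>a\<in>A. conj_by G z a = a) \<and> h = z \<otimes> b"
      using C CC[OF g(3)] g(4) by (intro bexI[of _ "(q \<otimes> x) \<otimes> c"] bexI[of _ b]) auto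
  qed
qed

lemma type_V_conj_trivial:
  assumes dec: "type_V_decomposition G H Q A B" and g: "q \<in> Q" "x \<in> A" "y \<in> A"
  shows "conj_by G (q \<otimes> x) y = y"
proof -
  note D = type_V_D[OF dec]
  note ab = AB_conditionsD[OF D(1)]
  have C: "q \<in> carrier G" "x \<in> carrier G" "y \<in> carrier G"
    using subgroup_mem_carrier[OF D(3) g(1)] subgroup_mem_carrier[OF ab(1) g(2)] subgroup_mem_carrier[OF ab(1) g(3)] .
  have "conj_by G q y = y" using conj_by_central_product[OF ab(1) C(1) _ g(3)] D(14) g(1) by blast
  then show ?thesis using AB_conj_trivial[OF D(1) g(2,3)] C by (simp add: conj_by_conj_by)
qed

lemma type_V_cofactor:
  assumes dec: "type_V_decomposition G H Q A B"
  shows "\<forall>h\<in>H. \<exists>z\<in>carrier G. \<exists>b\<in>B. (\<forall>a\<in>A. conj_by G z a = a) \<and> h = z \<otimes> b"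
proof
  fix h assume h: "h \<in> H"
  note D = type_V_D[OF dec]
  note ab = AB_conditionsD[OF D(1)]
  obtain q x b where g: "q \<in> Q" "x \<in> A" "b \<in> B" "h = q \<otimes> (x \<otimes> b)" using D(16)[OF h] by blast
  have C: "q \<in> carrier G" "x \<in> carrier G" "b \<in> carrier G"
    using subgroup_mem_carrier[OF D(3) g(1)] subgroup_mem_carrier[OF ab(1) g(2)] subgroup_mem_carrier[OF ab(2) g(3)] .
  have "h = (q \<otimes> x) \<otimes> b" unfolding g(4) using C by (simp add: m_assoc)
  then show "\<exists>z\<in>carrier G. \<exists>b\<in>B. (\<forall>a\<in>A. conj_by G z a = a) \<and> h = z \<otimes> b"
    using C g(3) type_V_conj_trivial[OF dec g(1,2)] by (intro bexI[of _ "q \<otimes> x"] bexI[of _ b]) auto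
qed

lemma type_V_split:
  assumes dec: "type_V_decomposition G (carrier G) Q A B" and A: "A \<lhd> G"
  shows "action_split G A B {\<one>}"
proof -
  note D = type_V_D[OF dec]
  note ab = AB_conditionsD[OF D(1)]
  have BC: "b \<in> carrier G" if "b \<in> B" for b using ab(2) that by (rule subgroup_mem_carrier)
  show ?thesis
  proof (rule action_splitI[OF D(1) A])
    show "subgroup {\<one>} G" by (rule triv_subgroup)
    show "coprime (card B) (card {\<one>})" by simp
    show "\<And>b t. b \<in> B \<Longrightarrow> t \<in> {\<one>} \<Longrightarrow> b \<otimes> t = t \<otimes> b" using BC by simp
    show "\<exists>z\<in>carrier G. \<exists>b\<in>B. \<exists>t\<in>{\<one>}. (\<forall>a\<in>A. conj_by G z a = a) \<and> g = z \<otimes> (b \<otimes> t)" if "g \<in> carrier G" for g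
      using bspec[OF type_V_cofactor[OF dec] that] BC by auto
  qed
qed

lemma type_V_generate:
  assumes dec: "type_V_decomposition G H Q A B" and g: "generate G {a} = A" "generate G {b} = B"
    and Y: "{a, b} \<subseteq> Y" "Q \<subseteq> Y"
  shows "H \<subseteq> generate G Y"
proof
  fix h assume "h \<in> H"
  then obtain q0 a0 b0 where h: "q0 \<in> Q" "a0 \<in> A" "b0 \<in> B" "h = q0 \<otimes> (a0 \<otimes> b0)"
    using type_V_D(16)[OF dec] by blast
  have "a0 \<in> generate G Y" "b0 \<in> generate G Y"
    using h(2,3) g Y generate_singleton_mono[of a Y] generate_singleton_mono[of b Y] by blast+
  moreover have "q0 \<in> generate G Y" using h(1) Y(2) by (blast intro: generate.incl)
  ultimately show "h \<in> generate G Y" unfolding h(4) by (intro generate.eng)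
qed

text \<open>The square of f is an involution of H, and Q contains every element of H of 2-power
  order because its index in H is odd.\<close>

lemma type_VI_square:
  assumes dec: "type_V_decomposition G H Q A B" and f: "f \<in> carrier G" "ord f = 4" "f \<otimes> f \<in> H"
  shows "f \<otimes> f \<in> Q" "(f \<otimes> f) \<otimes> (f \<otimes> f) = \<one>" "f \<otimes> f \<noteq> \<one>"
proof -
  note D = type_V_D[OF dec]
  note ab = AB_conditionsD[OF D(1)]
  have f4: "f [^] (4::nat) = \<one>" using pow_ord_eq_1[OF f(1)] f(2) by simp
  then show ff4: "(f \<otimes> f) \<otimes> (f \<otimes> f) = \<one>" using f(1) by (simp add: eval_nat_numeral m_assoc)
  have odd: "odd (card A * card B)" using ab(5,6) by simp
  show "f \<otimes> f \<in> Q"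
  proof (rule hall_mem_subgroup[OF D(2,3,4,12) _ f(3)])
    show "card H = card Q * (card A * card B)" using D(7,8) by simp
    show "(f \<otimes> f) [^] (2::nat) = \<one>" using ff4 f(1) by (simp add: numeral_2_eq_2)
    show "coprime 2 (card A * card B)" using odd by simp
  qed auto
  show "f \<otimes> f \<noteq> \<one>"
  proof
    assume "f \<otimes> f = \<one>"
    then have "f [^] (2::nat) = \<one>" using f(1) by (simp add: numeral_2_eq_2)
    then have "4 dvd (2::nat)" using pow_eq_id[OF f(1), of 2] f(2) by simp
    then show False by simp
  qed
qed

text \<open>Every isomorphism sends an involution to -I, the only involution of SL_2(F_5), and that
  matrix is central.\<close>

lemma SL2_iso_involution:
  assumes Q: "subgroup Q G" and h: "h \<in> iso (G\<lparr>carrier := Q\<rparr>) SL2_F5"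
    and z: "z \<in> Q" "z \<otimes> z = \<one>" "z \<noteq> \<one>"
  shows "h z = mat2 4 0 0 4" "\<And>q. q \<in> Q \<Longrightarrow> conj_by G z q = q"
proof -
  have hom: "h \<in> hom (G\<lparr>carrier := Q\<rparr>) SL2_F5" and bij: "bij_betw h Q (carrier SL2_F5)"
    using h by (simp_all add: iso_def)
  interpret Q: group "G\<lparr>carrier := Q\<rparr>" using Q by (rule subgroup_imp_group)
  interpret h: group_hom "G\<lparr>carrier := Q\<rparr>" SL2_F5 h by unfold_locales (rule hom)
  have mult: "h (r \<otimes> s) = h r ** h s" if "r \<in> Q" "s \<in> Q" for r s using hom_mult[OF hom, of r s] that by simp
  have C: "h r \<in> carrier SL2_F5" if "r \<in> Q" for r using h.hom_closed[of r] that by simp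
  have one: "h \<one> = mat2 1 0 0 1" using h.hom_one by simp
  have "h z ** h z = mat2 1 0 0 1" using mult[OF z(1,1)] z(2) one by simp
  moreover have "h z \<noteq> mat2 1 0 0 1"
    using bij z(1,3) one subgroup.one_closed[OF Q] by (metis bij_betw_def inj_onD)
  ultimately show hz: "h z = mat2 4 0 0 4" using SL2_involution[OF C[OF z(1)]] by blast
  fix q assume q: "q \<in> Q"
  obtain a b c d where m: "h q = mat2 a b c d" by (rule mat2_cases)
  have "h (z \<otimes> q) = h (q \<otimes> z)" unfolding mult[OF z(1) q] mult[OF q z(1)] hz m by (simp add: mult.commute)
  then have "z \<otimes> q = q \<otimes> z"
    using bij q z(1) subgroup.m_closed[OF Q] by (metis bij_betw_def inj_onD)
  then show "conj_by G z q = q"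
    using subgroup_mem_carrier[OF Q q] subgroup_mem_carrier[OF Q z(1)] by (simp add: conj_by_eq_self_iff)
qed

text \<open>The square of f is the central involution of Q, so conjugation by f is an automorphism
  of Q that is its own inverse, and it is outer. In suitable coordinates F it exchanges the
  transvections with entries 1 and 2; as these generate, the automorphism \<open>\<alpha>\<close>
  does not depend on the group.\<close>

lemma SL2_outer_normal_form:
  assumes Q: "subgroup Q G" "G\<lparr>carrier := Q\<rparr> \<cong> SL2_F5" and fC: "f \<in> carrier G" "\<forall>q\<in>Q. conj_by G f q \<in> Q"
    and ff: "f \<otimes> f \<in> Q" "(f \<otimes> f) \<otimes> (f \<otimes> f) = \<one>" "f \<otimes> f \<noteq> \<one>"
    and out: "\<forall>x\<in>Q. \<exists>q\<in>Q. conj_by G f q \<noteq> conj_by G x q"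
  shows "\<exists>F\<in>iso (G\<lparr>carrier := Q\<rparr>) SL2_F5. \<exists>\<alpha>\<in>hom SL2_F5 SL2_F5.
    \<alpha> (mat2 1 1 0 1) = mat2 1 0 2 1 \<and> \<alpha> (mat2 1 0 2 1) = mat2 1 1 0 1 \<and> (\<forall>q\<in>Q. F (conj_by G f q) = \<alpha> (F q))"
proof -
  let ?Q = "G\<lparr>carrier := Q\<rparr>" and ?S = SL2_F5
  interpret Q: group ?Q using Q(1) by (rule subgroup_imp_group)
  note QC = subgroup_mem_carrier[OF Q(1)] and f = fC(1) bspec[OF fC(2)]
  obtain h where h: "h \<in> iso ?Q ?S" using Q(2) by (auto simp: is_iso_def)
  define k where "k = inv_into Q h"
  have k: "k \<in> iso ?S ?Q" using Q.iso_set_sym[OF h] by (simp add: k_def)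
  have bij: "bij_betw h Q (carrier ?S)" using h by (simp add: iso_def)
  have hk: "h (k m) = m" "k m \<in> Q" if "m \<in> carrier ?S" for m
    using that bij by (auto simp: k_def bij_betw_def intro: f_inv_into_f inv_into_into)
  have kh: "k (h q) = q" if "q \<in> Q" for q using that bij by (simp add: k_def bij_betw_def)
  have hC: "h q \<in> carrier ?S" if "q \<in> Q" for q using that bij by (auto simp: bij_betw_def)
  have "inj_on (conj_by G f) Q" using conj_by_inj[OF f(1)] QC by (auto intro!: inj_onI)
  moreover have "conj_by G f ` Q \<subseteq> Q" using f(2) by blast
  ultimately have "bij_betw (conj_by G f) Q Q"
    using endo_inj_surj[OF finite_subgroup[OF Q(1)]] by (simp add: bij_betw_def)
  then have cf: "conj_by G f \<in> iso ?Q ?Q"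
    using f QC by (auto simp: iso_def hom_def conj_by_mult)
  define \<beta> where "\<beta> = h \<circ> (conj_by G f \<circ> k)"
  have \<beta>: "\<beta> \<in> iso ?S ?S" unfolding \<beta>_def by (rule iso_set_trans[OF iso_set_trans[OF k cf] h])
  have \<beta>h: "\<beta> (h q) = h (conj_by G f q)" if "q \<in> Q" for q using that kh by (simp add: \<beta>_def)
  have fq: "conj_by G f (conj_by G f q) = q" if "q \<in> Q" for q
    using SL2_iso_involution(2)[OF Q(1) h ff that] QC[OF that] f(1) by (simp add: conj_by_conj_by)
  have inv: "\<beta> (\<beta> m) = m" if m: "m \<in> carrier ?S" for m
    using hk[OF m] \<beta>h[OF hk(2)[OF m]] \<beta>h[OF f(2)[OF hk(2)[OF m]]] fq[OF hk(2)[OF m]] by simp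
  have out': "\<exists>m\<in>carrier ?S. \<beta> m \<noteq> conj_by ?S g m" if g: "g \<in> carrier ?S" for g
  proof -
    obtain q where q: "q \<in> Q" "conj_by G f q \<noteq> conj_by G (k g) q" using bspec[OF out hk(2)[OF g]] by blast
    interpret h: group_hom ?Q ?S h using h by unfold_locales (simp add: iso_def)
    have "h (conj_by G (k g) q) = conj_by ?S g (h q)"
    proof -
      have "h (conj_by ?Q (k g) q) = conj_by ?S (h (k g)) (h q)"
        unfolding conj_by_def
        using h.hom_mult[of "k g \<otimes> q" "inv\<^bsub>?Q\<^esub> (k g)"] h.hom_mult[of "k g" q] h.hom_inv[of "k g"]
          Q.inv_closed[of "k g"] Q.m_closed[of "k g" q] hk(2)[OF g] q(1)
        by (simp del: SL2_mult)
      moreover have "conj_by ?Q (k g) q = conj_by G (k g) q"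
        using m_inv_consistent[OF Q(1) hk(2)[OF g]] by (simp add: conj_by_def)
      ultimately show ?thesis using hk(1)[OF g] by simp
    qed
    moreover have "h (conj_by G f q) \<noteq> h (conj_by G (k g) q)"
      using q f(2)[OF q(1)] subgroup_conj_closed[OF Q(1) hk(2)[OF g] q(1)] kh by metis
    ultimately show ?thesis using \<beta>h[OF q(1)] hC[OF q(1)] by metis
  qed
  obtain e m where e: "e \<in> iso ?S ?S" "m \<in> carrier ?S" "e m = mat2 1 1 0 1" "e (\<beta> m) = mat2 1 0 2 1"
    using SL2_outer_involution[OF \<beta> inv out'] by blast
  define d where "d = inv_into (carrier ?S) e"
  have d: "d \<in> iso ?S ?S" using SL2.iso_set_sym[OF e(1)] by (simp add: d_def)
  have de: "d (e n) = n" if "n \<in> carrier ?S" for n using that e(1) by (simp add: d_def iso_def bij_betw_def)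
  have \<beta>C: "\<beta> n \<in> carrier ?S" if "n \<in> carrier ?S" for n using \<beta> that by (auto simp: iso_def bij_betw_def)
  let ?\<alpha> = "e \<circ> (\<beta> \<circ> d)"
  have \<alpha>e: "?\<alpha> (e n) = e (\<beta> n)" if "n \<in> carrier ?S" for n using de[OF that] by simp
  have "?\<alpha> \<in> hom ?S ?S" using iso_set_trans[OF iso_set_trans[OF d \<beta>] e(1)] by (simp add: iso_def)
  moreover have "?\<alpha> (mat2 1 1 0 1) = mat2 1 0 2 1" using \<alpha>e[OF e(2)] e(3,4) by simp
  moreover have "?\<alpha> (mat2 1 0 2 1) = mat2 1 1 0 1" using \<alpha>e[OF \<beta>C[OF e(2)]] inv[OF e(2)] e(3,4) by simp
  moreover have "\<forall>q\<in>Q. (e \<circ> h) (conj_by G f q) = ?\<alpha> ((e \<circ> h) q)" using \<alpha>e[OF hC] \<beta>h by simp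
  moreover have "e \<circ> h \<in> iso ?Q ?S" by (rule iso_set_trans[OF h e(1)])
  ultimately show ?thesis by blast
qed

end

section \<open>Isomorphisms from equal invariants\<close>

lemma not_dvd_of_coprime: "coprime n p \<Longrightarrow> 1 < p \<Longrightarrow> \<not> p dvd (n::nat)"
  using coprime_common_divisor_nat[of n p p] by auto

section \<open>Counting the generated subgroup in each type\<close>

context action_pair
begin

definition bounded_pairs :: "('a \<times> 'b) set \<Rightarrow> nat \<Rightarrow> bool" where
  "bounded_pairs X n \<longleftrightarrow> X \<subseteq> carrier P \<and> card (generate P X) \<le> n"

lemma bounded_aa: "bounded_pairs {(a, a')} (card A)"
  using A(2) A'(2) card_generate_aa by (simp add: bounded_pairs_def)

text \<open>The factor m bounds the index of the old subgroup in the new one: the new pair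
  normalizes what is already generated, and its m-th power belongs to it.\<close>

lemma bounded_insert:
  assumes X: "bounded_pairs X n" and c: "c \<in> carrier G" "c' \<in> carrier G'" and m: "(m::nat) > 0"
    and conj: "\<forall>p\<in>X. (conj_by G c (fst p), conj_by G' c' (snd p)) \<in> generate P X"
    and pow: "(c [^]\<^bsub>G\<^esub> m, c' [^]\<^bsub>G'\<^esub> m) \<in> generate P X"
  shows "bounded_pairs (insert (c, c') X) (m * n)"
proof -
  have X': "X \<subseteq> carrier P" "card (generate P X) \<le> n" using X by (simp_all add: bounded_pairs_def)
  have "card (generate P (insert (c, c') X)) \<le> m * card (generate P X)"
  proof (rule P.card_generate_insert_le[OF X'(1) _ _ _ m])
    show "(c, c') \<in> carrier P" using c by simp
    show "(c, c') [^]\<^bsub>P\<^esub> m \<in> generate P X" using pow by (simp add: pow_DirProd)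
    show "conj_by P (c, c') p \<in> generate P X" if "p \<in> X" for p
      using bspec[OF conj that] by (cases p) (simp add: conj_by_DirProd[OF G.is_group G'.is_group c])
  qed
  also have "\<dots> \<le> m * n" using X'(2) by simp
  finally show ?thesis using X'(1) c by (simp add: bounded_pairs_def)
qed

lemma bounded_insert_subgroup:
  assumes X: "bounded_pairs X n" and C: "subgroup C G" "c \<in> C" "subgroup C' G'" "c' \<in> C'" "card C = card C'"
    and conj: "\<forall>p\<in>X. (conj_by G c (fst p), conj_by G' c' (snd p)) \<in> generate P X"
  shows "bounded_pairs (insert (c, c') X) (card C * n)"
proof (rule bounded_insert[OF X _ _ _ conj])
  show "c \<in> carrier G" "c' \<in> carrier G'"
    using G.subgroup_mem_carrier[OF C(1,2)] G'.subgroup_mem_carrier[OF C(3,4)] .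
  show "card C > 0" using C(1) by (rule G.card_subgroup_pos)
  have "c [^]\<^bsub>G\<^esub> card C = \<one>\<^bsub>G\<^esub>" by (rule G.pow_card_subgroup[OF C(1,2)])
  moreover have "c' [^]\<^bsub>G'\<^esub> card C = \<one>\<^bsub>G'\<^esub>" unfolding C(5) by (rule G'.pow_card_subgroup[OF C(3,4)])
  ultimately show "(c [^]\<^bsub>G\<^esub> card C, c' [^]\<^bsub>G'\<^esub> card C) \<in> generate P X" using generate_pair_intros(2) by simp
qed

lemma iso_of_pairs:
  assumes "bounded_pairs X (order G)" "order G = order G'"
    and "carrier G \<subseteq> generate G (fst ` X)" "carrier G' \<subseteq> generate G' (snd ` X)"
  shows "G \<cong> G'"
  using is_iso_of_generated_graph[OF G.finite_group_axioms G'.finite_group_axioms, of X] assms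
  by (simp add: bounded_pairs_def)

lemma bounded_ab:
  assumes "subgroup B G" "b \<in> B" "subgroup B' G'" "b' \<in> B'" "card B = card B'" "(b, b') \<in> E"
  shows "bounded_pairs {(b, b'), (a, a')} (card B * card A)"
  using bounded_insert_subgroup[OF bounded_aa assms(1-5)] conj_pair_aE[OF assms(6)] by simp

lemma type_I_II_card:
  assumes AB: "AB_conditions G A B" "internal_direct G BT B T" "internal_semidirect G (carrier G) A BT"
    and AB': "AB_conditions G' A' B'" "internal_direct G' BT' B' T'" "internal_semidirect G' (carrier G') A' BT'"
    and o: "order G = order G'" and T: "card T = 2 ^ k" "card T' = 2 ^ k'"
  shows "k = k'" "card B = card B'"
proof -
  note ab = G.AB_conditionsD[OF AB(1)] and ab' = G'.AB_conditionsD[OF AB'(1)]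
  have "card A * (card B * 2 ^ k) = card A * (card B' * 2 ^ k')"
    using G.type_I_II_D(3)[OF AB] G'.type_I_II_D(3)[OF AB'] o card_A T by (simp only:)
  then have "card B * 2 ^ k = card B' * 2 ^ k'" using G.card_subgroup_pos[OF ab(1)] by simp
  then have "k = k' \<and> card B = card B'" using ab(6) ab'(6) by (intro prime_power_cofactor_unique) simp_all
  then show "k = k'" "card B = card B'" by simp_all
qed

lemma iso_type_I:
  assumes t: "type_I_structure G A" "type_I_structure G' A'" and o: "order G = order G'"
  shows "G \<cong> G'"
proof -
  obtain B T BT k where AB: "AB_conditions G A B" "internal_direct G BT B T"
      "internal_semidirect G (carrier G) A BT" and T: "cyclic_group (G\<lparr>carrier := T\<rparr>)" "card T = 2 ^ k"
    using t(1) by (auto simp: type_I_structure_def)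
  obtain B' T' BT' k' where AB': "AB_conditions G' A' B'" "internal_direct G' BT' B' T'"
      "internal_semidirect G' (carrier G') A' BT'" and T': "cyclic_group (G'\<lparr>carrier := T'\<rparr>)" "card T' = 2 ^ k'"
    using t(2) by (auto simp: type_I_structure_def)
  note ab = G.AB_conditionsD[OF AB(1)] and ab' = G'.AB_conditionsD[OF AB'(1)]
  note D = G.type_I_II_D[OF AB] and D' = G'.type_I_II_D[OF AB']
  have c: "card B = card B'" "card T = card T'" using type_I_II_card[OF AB AB' o T(2) T'(2)] T(2) T'(2) by simp_all
  note s = G.type_I_II_split[OF AB T(2)] and s' = G'.type_I_II_split[OF AB' T'(2)]
  obtain b b' where b: "b \<in> B" "b' \<in> B'" "generate G {b} = B" "generate G' {b'} = B'" "(b, b') \<in> E"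
    using cyclic_pair[OF ab(2,4) ab'(2,4) split_lift(1)[OF s s' c] split_lift'(1)[OF s s' c]] by blast
  obtain t t' where t: "t \<in> T" "t' \<in> T'" "generate G {t} = T" "generate G' {t'} = T'" "(t, t') \<in> E"
    using cyclic_pair[OF D(2) T(1) D'(2) T'(1) split_lift(2)[OF s s' c] split_lift'(2)[OF s s' c]] by blast
  note bC = E_carrier[OF b(5)] and tC = E_carrier[OF t(5)]
  have tb: "conj_by G t b = b" "conj_by G' t' b' = b'"
    using D(4)[OF b(1) t(1)] D'(4)[OF b(2) t(2)] bC tC
    by (simp_all add: G.conj_by_eq_self_iff G'.conj_by_eq_self_iff)
  \<comment> \<open>Each pair normalizes the group generated by those to its right, and the factors
    |T|, |B|, |A| multiply to the order of G.\<close>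
  let ?X = "{(t, t'), (b, b'), (a, a')}"
  have "bounded_pairs ?X (card T * (card B * card A))"
    using bounded_insert_subgroup[OF bounded_ab[OF ab(2) b(1) ab'(2) b(2) c(1) b(5)] D(2) t(1) D'(2) t(2) c(2)]
      conj_pair_aE[OF t(5)] tb generate_pair_intros(1) by simp
  then have bd: "bounded_pairs ?X (order G)" using D(3) by (simp add: mult_ac)
  show ?thesis
  proof (rule iso_of_pairs[OF bd o])
    have "A \<subseteq> generate G (fst ` ?X)" "B \<subseteq> generate G (fst ` ?X)" "T \<subseteq> generate G (fst ` ?X)"
      using G.generate_singleton_mono[of a "fst ` ?X"] G.generate_singleton_mono[of b "fst ` ?X"]
        G.generate_singleton_mono[of t "fst ` ?X"] A(3) b(3) t(3) by simp_all
    then show "carrier G \<subseteq> generate G (fst ` ?X)" using D(5) by (blast intro: generate.eng)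
    have "A' \<subseteq> generate G' (snd ` ?X)" "B' \<subseteq> generate G' (snd ` ?X)" "T' \<subseteq> generate G' (snd ` ?X)"
      using G'.generate_singleton_mono[of a' "snd ` ?X"] G'.generate_singleton_mono[of b' "snd ` ?X"]
        G'.generate_singleton_mono[of t' "snd ` ?X"] A'(3) b(4) t(4) by simp_all
    then show "carrier G' \<subseteq> generate G' (snd ` ?X)" using D'(5) by (blast intro: generate.eng)
  qed
qed

text \<open>The generator x belongs to the subgroup of index 2, so it has a partner in the product
  of N' with the powers of x'. The A' part of the partner centralizes A' and the B' part has order
  prime to |T|, so both can be removed and a power of x' remains.\<close>

lemma index2_lift:
  assumes AB: "AB_conditions G A B" "internal_direct G BT B T" "internal_semidirect G (carrier G) A BT"
    and q: "quat_gens G T m x y"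
    and AB': "AB_conditions G' A' B'" "internal_direct G' BT' B' T'" "internal_semidirect G' (carrier G') A' BT'"
    and q': "quat_gens G' T' m x' y'" and m: "m \<ge> 4"
    and u: "unit_image G A (index2_subgroup G) \<subseteq> unit_image G' A' (index2_subgroup G')"
  shows "\<exists>j::nat. (x, x' [^]\<^bsub>G'\<^esub> j) \<in> E"
proof -
  note Q = G.quat_simps[OF q] and Q' = G'.quat_simps[OF q']
  note ab' = G'.AB_conditionsD[OF AB'(1)] and D' = G'.type_I_II_D[OF AB']
  obtain N where N: "N \<lhd> G" "odd (card N)" "order G = card N * card T"
      "\<And>g. g \<in> carrier G \<Longrightarrow> \<exists>n\<in>N. \<exists>t\<in>T. g = n \<otimes>\<^bsub>G\<^esub> t"
    using G.odd_complement[OF AB] by blast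
  obtain N' where N': "N' \<lhd> G'" "odd (card N')" "order G' = card N' * card T'"
      "\<And>g. g \<in> carrier G' \<Longrightarrow> \<exists>n\<in>N'. \<exists>t\<in>T'. g = n \<otimes>\<^bsub>G'\<^esub> t" "\<forall>n\<in>N'. \<exists>a\<in>A'. \<exists>b\<in>B'. n = a \<otimes>\<^bsub>G'\<^esub> b"
    using G'.odd_complement[OF AB'] by blast
  note i = G.type_II_index2(1)[OF N q m] and i' = G'.type_II_index2(1)[OF N'(1-4) q' m]
  have NC: "N \<subseteq> carrier G" "N' \<subseteq> carrier G'"
    using normal_imp_subgroup[OF N(1)] normal_imp_subgroup[OF N'(1)] subgroup.subset by blast+
  have "\<one>\<^bsub>G\<^esub> \<otimes>\<^bsub>G\<^esub> x \<in> N <#>\<^bsub>G\<^esub> generate G {x}"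
    using subgroup.one_closed[OF normal_imp_subgroup[OF N(1)]] generate.incl[of x "{x}" G]
    unfolding set_mult_def by blast
  then have x: "x \<in> N <#>\<^bsub>G\<^esub> generate G {x}" using Q(10) by simp
  have S: "N <#>\<^bsub>G\<^esub> generate G {x} \<subseteq> carrier G"
    using NC(1) Q(10) G.generate_incl[of "{x}"] by (intro G.set_mult_closed) simp_all
  have S': "N' <#>\<^bsub>G'\<^esub> generate G' {x'} \<subseteq> carrier G'"
    using NC(2) Q'(10) G'.generate_incl[of "{x'}"] by (intro G'.set_mult_closed) simp_all
  obtain g' where g': "g' \<in> N' <#>\<^bsub>G'\<^esub> generate G' {x'}" "(x, g') \<in> E"
    using same_action_lift[OF G.finite_group_axioms G'.finite_group_axioms A S x a_mem(2) S'] u i i' by auto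
  then obtain n j where n: "n \<in> N'" "g' = n \<otimes>\<^bsub>G'\<^esub> x' [^]\<^bsub>G'\<^esub> (j::nat)"
    using G'.generate_singleton[OF Q'(10)] by (auto simp: set_mult_def)
  obtain a0 b0 where ab0: "a0 \<in> A'" "b0 \<in> B'" "n = a0 \<otimes>\<^bsub>G'\<^esub> b0" using N'(5) n(1) by blast
  have xT: "x' [^]\<^bsub>G'\<^esub> j \<in> T'" by (rule G'.subgroup_pow_closed[OF Q'(1,4)])
  have C: "a0 \<in> carrier G'" "b0 \<in> carrier G'" "x' [^]\<^bsub>G'\<^esub> j \<in> carrier G'"
    using G'.subgroup_mem_carrier[OF ab'(1) ab0(1)] G'.subgroup_mem_carrier[OF ab'(2) ab0(2)] Q'(10) by simp_all
  have com: "b0 \<otimes>\<^bsub>G'\<^esub> x' [^]\<^bsub>G'\<^esub> j = x' [^]\<^bsub>G'\<^esub> j \<otimes>\<^bsub>G'\<^esub> b0" by (rule D'(4)[OF ab0(2) xT])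
  have "g' = a0 \<otimes>\<^bsub>G'\<^esub> (x' [^]\<^bsub>G'\<^esub> j \<otimes>\<^bsub>G'\<^esub> b0)" unfolding n(2) ab0(3) com[symmetric] using C by (simp add: G'.m_assoc)
  then have 1: "(\<one>\<^bsub>G\<^esub> \<otimes>\<^bsub>G\<^esub> x, a0 \<otimes>\<^bsub>G'\<^esub> (x' [^]\<^bsub>G'\<^esub> j \<otimes>\<^bsub>G'\<^esub> b0)) \<in> E" using g'(2) Q(10) by simp
  have "(\<one>\<^bsub>G\<^esub>, a0) \<in> E"
    using C(1) A(2) G'.AB_conj_trivial[OF AB'(1) ab0(1) a_mem(2)] by (intro E_kernel) auto
  then have 2: "(x, x' [^]\<^bsub>G'\<^esub> j \<otimes>\<^bsub>G'\<^esub> b0) \<in> E" using E_cancel_left[OF 1] Q(10) C by blast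
  have 3: "(x' [^]\<^bsub>G'\<^esub> j) [^]\<^bsub>G'\<^esub> card T = \<one>\<^bsub>G'\<^esub>"
    using G'.pow_card_subgroup[OF Q'(1) xT] Q(3) Q'(3) by simp
  have 4: "(\<one>\<^bsub>G\<^esub>, b0 [^]\<^bsub>G'\<^esub> card B') \<in> E" using G'.pow_card_subgroup[OF ab'(2) ab0(2)] E_one by simp
  have 5: "coprime (card T) (card B')" using Q(3) ab'(6) by simp
  show ?thesis
    using E_coprime_part[OF 2 C(3,2) com[symmetric] G.pow_card_subgroup[OF Q(1,4)] 3 4 5] by blast
qed

lemma iso_type_II:
  assumes t: "type_II_structure G A" "type_II_structure G' A'" and o: "order G = order G'"
    and u: "16 dvd order G \<Longrightarrow> unit_image G A (index2_subgroup G) = unit_image G' A' (index2_subgroup G')"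
  shows "G \<cong> G'"
proof -
  obtain B T BT r where AB: "AB_conditions G A B" "internal_direct G BT B T"
      "internal_semidirect G (carrier G) A BT" and T: "is_quaternionic r (G\<lparr>carrier := T\<rparr>)"
    using t(1) by (auto simp: type_II_structure_def)
  obtain B' T' BT' r' where AB': "AB_conditions G' A' B'" "internal_direct G' BT' B' T'"
      "internal_semidirect G' (carrier G') A' BT'" and T': "is_quaternionic r' (G'\<lparr>carrier := T'\<rparr>)"
    using t(2) by (auto simp: type_II_structure_def)
  note ab = G.AB_conditionsD[OF AB(1)] and ab' = G'.AB_conditionsD[OF AB'(1)]
  note D = G.type_I_II_D[OF AB] and D' = G'.type_I_II_D[OF AB']
  obtain m x y where q: "quat_gens G T m x y" by (rule G.quat_gensE[OF D(2) T])
  obtain m' x' y' where q0: "quat_gens G' T' m' x' y'" by (rule G'.quat_gensE[OF D'(2) T'])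
  have mm: "m = m'" "card B = card B'"
    using type_I_II_card[OF AB AB' o G.quat_simps(3)[OF q] G'.quat_simps(3)[OF q0]] .
  have q': "quat_gens G' T' m x' y'" using q0 mm(1) by simp
  note Q = G.quat_simps[OF q] and Q' = G'.quat_simps[OF q']
  have c: "card B = card B'" "card T = card T'" using mm(2) Q(3) Q'(3) by simp_all
  note s = G.type_I_II_split[OF AB Q(3)] and s' = G'.type_I_II_split[OF AB' Q'(3)]
  obtain b b' where b: "b \<in> B" "b' \<in> B'" "generate G {b} = B" "generate G' {b'} = B'" "(b, b') \<in> E"
    using cyclic_pair[OF ab(2,4) ab'(2,4) split_lift(1)[OF s s' c] split_lift'(1)[OF s s' c]] by blast
  have sq: "(t \<otimes>\<^bsub>G\<^esub> t, \<one>\<^bsub>G'\<^esub>) \<in> E" if "t \<in> T" for t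
    using G.quat_square_trivial[OF q A that] G.subgroup_mem_carrier[OF Q(1) that] A'(2) by (intro E_kernel) auto
  have sq': "(\<one>\<^bsub>G\<^esub>, t \<otimes>\<^bsub>G'\<^esub> t) \<in> E" if "t \<in> T'" for t
    using G'.quat_square_trivial[OF q' A' that] G'.subgroup_mem_carrier[OF Q'(1) that] A(2) by (intro E_kernel) auto
  have u': "unit_image G A (index2_subgroup G) = unit_image G' A' (index2_subgroup G')" if "m \<ge> 4"
  proof -
    have "(2::nat) ^ 4 dvd card T" unfolding Q(3) using that by (rule le_imp_power_dvd)
    then have "16 dvd order G" using D(3) by simp
    then show ?thesis by (rule u)
  qed
  have X: "\<exists>j::nat. (x, x' [^]\<^bsub>G'\<^esub> j) \<in> E" if m: "m \<ge> 4"
    using index2_lift[OF AB q AB' q' m] u'[OF m] by simp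
  have X': "\<exists>i::nat. (x [^]\<^bsub>G\<^esub> i, x') \<in> E" if m: "m \<ge> 4"
  proof -
    interpret s: action_pair G' G A' A a' a by (rule swapped)
    show ?thesis using s.index2_lift[OF AB' q' AB q m] u'[OF m] by (simp only: same_action_swap[of _ _ G a G' a'])
  qed
  obtain v w where vw: "quat_gens G' T' m v w" "(x, v) \<in> E" "(y, w) \<in> E"
    using quaternion_lift[OF q q' split_lift(2)[OF s s' c] split_lift'(2)[OF s s' c] sq sq' X X'] by blast
  note W = G'.quat_simps[OF vw(1)]
  have com: "conj_by G t b = b" if "t \<in> T" for t
    using D(4)[OF b(1) that] G.subgroup_mem_carrier[OF Q(1) that] E_carrier(1)[OF b(5)]
    by (simp add: G.conj_by_eq_self_iff)
  have com': "conj_by G' t b' = b'" if "t \<in> T'" for t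
    using D'(4)[OF b(2) that] G'.subgroup_mem_carrier[OF W(1) that] E_carrier(2)[OF b(5)]
    by (simp add: G'.conj_by_eq_self_iff)
  \<comment> \<open>Here x contributes the factor 2^(m-1), while y contributes only 2 because its
    square is a power of x; together they give |T|.\<close>
  let ?X = "{(x, v), (b, b'), (a, a')}" and ?Y = "{(y, w), (x, v), (b, b'), (a, a')}"
  have 1: "bounded_pairs ?X (2 ^ (m - 1) * (card B * card A))"
  proof (rule bounded_insert[OF bounded_ab[OF ab(2) b(1) ab'(2) b(2) c(1) b(5)] Q(10) W(10)])
    show "\<forall>p\<in>{(b, b'), (a, a')}. (conj_by G x (fst p), conj_by G' v (snd p)) \<in> generate P {(b, b'), (a, a')}"
      using com[OF Q(4)] com'[OF W(4)] conj_pair_aE[OF vw(2)] generate_pair_intros(1) by simp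
    show "(x [^]\<^bsub>G\<^esub> (2::nat) ^ (m - 1), v [^]\<^bsub>G'\<^esub> (2::nat) ^ (m - 1)) \<in> generate P {(b, b'), (a, a')}"
      unfolding G.quat_pow_eq_one[OF q] G'.quat_pow_eq_one[OF vw(1)] by (rule generate_pair_intros(2))
  qed simp
  have XC: "?X \<subseteq> carrier P" using 1 by (simp add: bounded_pairs_def)
  have "bounded_pairs ?Y (2 * (2 ^ (m - 1) * (card B * card A)))"
  proof (rule bounded_insert[OF 1 Q(11) W(11)])
    show "\<forall>p\<in>?X. (conj_by G y (fst p), conj_by G' w (snd p)) \<in> generate P ?X"
      using com[OF Q(5)] com'[OF W(5)] conj_pair_aE[OF vw(3)] Q(8) W(8) generate_pair_intros(1)
        generate_pair_inv[OF XC, of x v] by simp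
    show "(y [^]\<^bsub>G\<^esub> (2::nat), w [^]\<^bsub>G'\<^esub> (2::nat)) \<in> generate P ?X"
      unfolding Q(9) W(9) by (intro generate_pair_pow generate_pair_intros(1)) simp
  qed simp
  moreover have "2 * (2 ^ (m - 1) * (card B * card A)) = order G"
  proof -
    have "2 * (2::nat) ^ (m - 1) = 2 ^ m" using Q(2) by (simp flip: power_Suc)
    then have "2 * ((2::nat) ^ (m - 1) * (card B * card A)) = 2 ^ m * (card B * card A)" by (simp only: mult.assoc[symmetric])
    then show ?thesis unfolding D(3) Q(3) by (simp only: mult_ac)
  qed
  ultimately have bd: "bounded_pairs ?Y (order G)" by simp
  show ?thesis
  proof (rule iso_of_pairs[OF bd o])
    have "generate G {x, y} \<subseteq> generate G (fst ` ?Y)" by (intro G.mono_generate) auto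
    then have "A \<subseteq> generate G (fst ` ?Y)" "B \<subseteq> generate G (fst ` ?Y)" "T \<subseteq> generate G (fst ` ?Y)"
      using G.generate_singleton_mono[of a "fst ` ?Y"] G.generate_singleton_mono[of b "fst ` ?Y"]
        A(3) b(3) G.quat_generate[OF q] by simp_all
    then show "carrier G \<subseteq> generate G (fst ` ?Y)" using D(5) by (blast intro: generate.eng)
    have "generate G' {v, w} \<subseteq> generate G' (snd ` ?Y)" by (intro G'.mono_generate) auto
    then have "A' \<subseteq> generate G' (snd ` ?Y)" "B' \<subseteq> generate G' (snd ` ?Y)" "T' \<subseteq> generate G' (snd ` ?Y)"
      using G'.generate_singleton_mono[of a' "snd ` ?Y"] G'.generate_singleton_mono[of b' "snd ` ?Y"]
        A'(3) b(4) G'.quat_generate[OF vw(1)] by simp_all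
    then show "carrier G' \<subseteq> generate G' (snd ` ?Y)" using D'(5) by (blast intro: generate.eng)
  qed
qed

lemma type_III_card:
  assumes dec: "type_III_decomposition G H Q A C B" "type_III_decomposition G' H' Q' A' C' B'"
    and o: "card H = card H'"
  shows "card B = card B'" "card C = card C'"
proof -
  note D = G.type_III_D[OF dec(1)] and D' = G'.type_III_D[OF dec(2)]
  obtain k k' where k: "card C = 3 ^ k" "card C' = 3 ^ k'" using D(13) D'(13) by blast
  have "card H = 8 * (card A * (card B * 3 ^ k))" "card H' = 8 * (card A * (card B' * 3 ^ k'))"
    using D(9) D'(9) k card_A by (simp_all only: mult_ac)
  then have "card A * (card B * 3 ^ k) = card A * (card B' * 3 ^ k')" using o by linarith
  then have "card B * 3 ^ k = card B' * 3 ^ k'" using G.card_subgroup_pos[OF normal_imp_subgroup[OF A(1)]] by simp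
  moreover have "\<not> 3 dvd card B" "\<not> 3 dvd card B'" using D(16) D'(16) not_dvd_of_coprime[of _ 3] by simp_all
  ultimately have "k = k' \<and> card B = card B'" by (intro prime_power_cofactor_unique[of 3]) simp_all
  then show "card B = card B'" "card C = card C'" using k by simp_all
qed

text \<open>Q centralizes A and commutes with B, so the pairs (x, x') and (y, y') are governed by
  the quaternion relations alone, and c and c' act on them by the same formula. The factors are 4,
  2, |B| and |C|; types III and IV share this count.\<close>

lemma bounded_type_III:
  assumes dec: "type_III_decomposition G H Q A C B" and dec': "type_III_decomposition G' H' Q' A' C' B'"
    and o: "card H = card H'"
    and q: "quat_gens G Q 3 x y" "conj_by G c x = y" "conj_by G c y = x \<otimes>\<^bsub>G\<^esub> y"
    and q': "quat_gens G' Q' 3 x' y'" "conj_by G' c' x' = y'" "conj_by G' c' y' = x' \<otimes>\<^bsub>G'\<^esub> y'"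
    and b: "b \<in> B" "b' \<in> B'" "(b, b') \<in> E" and c: "c \<in> C" "c' \<in> C'" "(c, c') \<in> E"
  shows "bounded_pairs {(c, c'), (b, b'), (y, y'), (x, x'), (a, a')} (card H)"
proof -
  note D = G.type_III_D[OF dec] and D' = G'.type_III_D[OF dec'] and cd = type_III_card[OF dec dec' o]
  note ab = G.AB_conditionsD[OF D(1)] and ab' = G'.AB_conditionsD[OF D'(1)]
  note Q = G.quat_simps[OF q(1)] and Q' = G'.quat_simps[OF q'(1)]
  note bC = E_carrier[OF b(3)] and cC = E_carrier[OF c(3)]
  have Qa: "conj_by G t a = a" if "t \<in> Q" for t
    using D(19)[OF that a_mem(1)] G.subgroup_mem_carrier[OF D(3) that] A(2) by (simp add: G.conj_by_eq_self_iff)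
  have Qa': "conj_by G' t a' = a'" if "t \<in> Q'" for t
    using D'(19)[OF that a_mem(2)] G'.subgroup_mem_carrier[OF D'(3) that] A'(2) by (simp add: G'.conj_by_eq_self_iff)
  have cb: "conj_by G c b = b" "conj_by G' c' b' = b'"
    using D(20)[OF c(1) b(1)] D'(20)[OF c(2) b(2)] bC cC
    by (simp_all add: G.conj_by_eq_self_iff G'.conj_by_eq_self_iff)
  have 1: "bounded_pairs {(x, x'), (a, a')} (4 * card A)"
  proof (rule bounded_insert[OF bounded_aa Q(10) Q'(10)])
    show "\<forall>p\<in>{(a, a')}. (conj_by G x (fst p), conj_by G' x' (snd p)) \<in> generate P {(a, a')}"
      using Qa[OF Q(4)] Qa'[OF Q'(4)] generate_pair_intros(1) by simp
    show "(x [^]\<^bsub>G\<^esub> (4::nat), x' [^]\<^bsub>G'\<^esub> (4::nat)) \<in> generate P {(a, a')}"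
      using G.quat_pow_eq_one[OF q(1)] G'.quat_pow_eq_one[OF q'(1)] generate_pair_intros(2) by simp
  qed simp
  then have XC: "{(x, x'), (a, a')} \<subseteq> carrier P" by (simp add: bounded_pairs_def)
  have 2: "bounded_pairs {(y, y'), (x, x'), (a, a')} (2 * (4 * card A))"
  proof (rule bounded_insert[OF 1 Q(11) Q'(11)])
    show "\<forall>p\<in>{(x, x'), (a, a')}. (conj_by G y (fst p), conj_by G' y' (snd p)) \<in> generate P {(x, x'), (a, a')}"
      using Qa[OF Q(5)] Qa'[OF Q'(5)] Q(8) Q'(8) generate_pair_intros(1) generate_pair_inv[OF XC, of x x'] by simp
    show "(y [^]\<^bsub>G\<^esub> (2::nat), y' [^]\<^bsub>G'\<^esub> (2::nat)) \<in> generate P {(x, x'), (a, a')}"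
      unfolding Q(9) Q'(9) by (intro generate_pair_pow generate_pair_intros(1)) simp
  qed simp
  have 3: "bounded_pairs {(b, b'), (y, y'), (x, x'), (a, a')} (card B * (2 * (4 * card A)))"
    using bounded_insert_subgroup[OF 2 ab(2) b(1) ab'(2) b(2) cd(1)] conj_pair_aE[OF b(3)]
      D(21)[OF Q(4) b(1)] D(21)[OF Q(5) b(1)] D'(21)[OF Q'(4) b(2)] D'(21)[OF Q'(5) b(2)]
      generate_pair_intros(1) by simp
  have "bounded_pairs {(c, c'), (b, b'), (y, y'), (x, x'), (a, a')} (card C * (card B * (2 * (4 * card A))))"
    using bounded_insert_subgroup[OF 3 D(4) c(1) D'(4) c(2) cd(2)] conj_pair_aE[OF c(3)]
      q(2,3) q'(2,3) cb generate_pair_intros(1,3) by simp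
  then show ?thesis using D(9) by (simp add: mult_ac)
qed

text \<open>The pairs for B and \<open>C\<close> are fixed in \<open>E\<close> before the quaternion
  generators; these are then chosen in each group so that c, respectively c', takes x to y and y to
  x y.\<close>

lemma iso_type_III:
  assumes dec: "type_III_decomposition G (carrier G) Q A C B" and dec': "type_III_decomposition G' (carrier G') Q' A' C' B'"
    and o: "order G = order G'"
  shows "G \<cong> G'"
proof -
  note D = G.type_III_D[OF dec] and D' = G'.type_III_D[OF dec']
  note ab = G.AB_conditionsD[OF D(1)] and ab' = G'.AB_conditionsD[OF D'(1)]
  have oc: "card (carrier G) = card (carrier G')" using o by (simp add: order_def)
  note cd = type_III_card[OF dec dec' oc]
  note s = G.type_III_split[OF dec A(1)] and s' = G'.type_III_split[OF dec' A'(1)]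
  obtain b b' where b: "b \<in> B" "b' \<in> B'" "generate G {b} = B" "generate G' {b'} = B'" "(b, b') \<in> E"
    using cyclic_pair[OF ab(2,4) ab'(2,4) split_lift(1)[OF s s' cd] split_lift'(1)[OF s s' cd]] by blast
  obtain c c' where c: "c \<in> C" "c' \<in> C'" "generate G {c} = C" "generate G' {c'} = C'" "(c, c') \<in> E"
    using cyclic_pair[OF D(4,12) D'(4,12) split_lift(2)[OF s s' cd] split_lift'(2)[OF s s' cd]] by blast
  obtain x y where q: "quat_gens G Q 3 x y" "conj_by G c x = y" "conj_by G c y = x \<otimes>\<^bsub>G\<^esub> y"
    using G.type_III_quat[OF dec c(1,3)] by blast
  obtain x' y' where q': "quat_gens G' Q' 3 x' y'" "conj_by G' c' x' = y'" "conj_by G' c' y' = x' \<otimes>\<^bsub>G'\<^esub> y'"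
    using G'.type_III_quat[OF dec' c(2,4)] by blast
  have bd: "bounded_pairs {(c, c'), (b, b'), (y, y'), (x, x'), (a, a')} (order G)"
    using bounded_type_III[OF dec dec' oc q q' b(1,2,5) c(1,2,5)] by (simp add: order_def)
  show ?thesis
    by (rule iso_of_pairs[OF bd o G.type_III_generate[OF dec q(1) A(3) b(3) c(3)]
        G'.type_III_generate[OF dec' q'(1) A'(3) b(4) c(4)]]) auto
qed

text \<open>As \<open>f\<^sup>2\<close> centralizes \<open>A\<close>, only the parity of an exponent matters.\<close>

lemma order_4_lift:
  assumes f: "f \<in> carrier G" "f' \<in> carrier G'" "conj_by G (f \<otimes>\<^bsub>G\<^esub> f) a = a" "conj_by G' (f' \<otimes>\<^bsub>G'\<^esub> f') a' = a'"
    and l: "(f, f' [^]\<^bsub>G'\<^esub> (j::nat)) \<in> E" "(f [^]\<^bsub>G\<^esub> (i::nat), f') \<in> E"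
  shows "(f, f') \<in> E"
proof -
  have ff: "(f \<otimes>\<^bsub>G\<^esub> f, \<one>\<^bsub>G'\<^esub>) \<in> E" "(\<one>\<^bsub>G\<^esub>, f' \<otimes>\<^bsub>G'\<^esub> f') \<in> E"
    using f A(2) A'(2) by (intro E_kernel; simp)+
  have p: "f [^]\<^bsub>G\<^esub> (2 * k + r) = (f \<otimes>\<^bsub>G\<^esub> f) [^]\<^bsub>G\<^esub> k \<otimes>\<^bsub>G\<^esub> f [^]\<^bsub>G\<^esub> r" for k r :: nat
  proof -
    have "f [^]\<^bsub>G\<^esub> (2::nat) = f \<otimes>\<^bsub>G\<^esub> f" using f(1) by (simp add: numeral_2_eq_2)
    then show ?thesis using f(1) by (simp flip: G.nat_pow_mult G.nat_pow_pow)
  qed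
  have p': "f' [^]\<^bsub>G'\<^esub> (2 * k + r) = (f' \<otimes>\<^bsub>G'\<^esub> f') [^]\<^bsub>G'\<^esub> k \<otimes>\<^bsub>G'\<^esub> f' [^]\<^bsub>G'\<^esub> r" for k r :: nat
  proof -
    have "f' [^]\<^bsub>G'\<^esub> (2::nat) = f' \<otimes>\<^bsub>G'\<^esub> f'" using f(2) by (simp add: numeral_2_eq_2)
    then show ?thesis using f(2) by (simp flip: G'.nat_pow_mult G'.nat_pow_pow)
  qed
  have "(\<one>\<^bsub>G\<^esub> \<otimes>\<^bsub>G\<^esub> f, (f' \<otimes>\<^bsub>G'\<^esub> f') [^]\<^bsub>G'\<^esub> (j div 2) \<otimes>\<^bsub>G'\<^esub> f' [^]\<^bsub>G'\<^esub> (j mod 2)) \<in> E"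
    using l(1) p'[of "j div 2" "j mod 2"] f(1) by simp
  moreover have "(\<one>\<^bsub>G\<^esub>, (f' \<otimes>\<^bsub>G'\<^esub> f') [^]\<^bsub>G'\<^esub> (j div 2)) \<in> E" using E_pow[OF ff(2), of "j div 2"] by simp
  ultimately have j: "(f, f' [^]\<^bsub>G'\<^esub> (j mod 2)) \<in> E"
    by (rule E_cancel_left) (use f in simp_all)
  have "((f \<otimes>\<^bsub>G\<^esub> f) [^]\<^bsub>G\<^esub> (i div 2) \<otimes>\<^bsub>G\<^esub> f [^]\<^bsub>G\<^esub> (i mod 2), \<one>\<^bsub>G'\<^esub> \<otimes>\<^bsub>G'\<^esub> f') \<in> E"
    using l(2) p[of "i div 2" "i mod 2"] f(2) by simp
  moreover have "((f \<otimes>\<^bsub>G\<^esub> f) [^]\<^bsub>G\<^esub> (i div 2), \<one>\<^bsub>G'\<^esub>) \<in> E" using E_pow[OF ff(1), of "i div 2"] by simp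
  ultimately have i: "(f [^]\<^bsub>G\<^esub> (i mod 2), f') \<in> E"
    by (rule E_cancel_left) (use f in simp_all)
  \<comment> \<open>If both exponents are even, then f and f' are each paired with 1, and the
    product of these two pairs is (f, f').\<close>
  consider "j mod 2 = 1" | "i mod 2 = 1" | "j mod 2 = 0" "i mod 2 = 0" by linarith
  then show ?thesis
  proof cases
    case 3
    then show ?thesis using E_mult[OF j i] f(1,2) by simp
  qed (use i j f in simp_all)
qed

text \<open>The elements f and f' themselves are paired, not merely some generators of their groups,
  because both are already tied to their actions on Q and Q'.\<close>

lemma order_4_pair:
  assumes s: "action_split G A B (generate G {f})" "action_split G' A' B' (generate G' {f'})"
    and c: "card B = card B'" and f: "f \<in> carrier G" "f' \<in> carrier G'" "G.ord f = 4" "G'.ord f' = 4"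
    and ff: "conj_by G (f \<otimes>\<^bsub>G\<^esub> f) a = a" "conj_by G' (f' \<otimes>\<^bsub>G'\<^esub> f') a' = a'"
  shows "(f, f') \<in> E" "\<exists>b b'. b \<in> B \<and> b' \<in> B' \<and> generate G {b} = B \<and> generate G' {b'} = B' \<and> (b, b') \<in> E"
proof -
  have t: "card (generate G {f}) = card (generate G' {f'})"
    using G.generate_pow_card[OF f(1)] G'.generate_pow_card[OF f(2)] f(3,4) by simp
  note l = split_lift[OF s c t] split_lift'[OF s c t]
  obtain j :: nat where j: "(f, f' [^]\<^bsub>G'\<^esub> j) \<in> E"
    using l(2)[of f] generate.incl[of f "{f}" G] G'.generate_singleton[OF f(2)] by auto
  obtain i :: nat where i: "(f [^]\<^bsub>G\<^esub> i, f') \<in> E"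
    using l(4)[of f'] generate.incl[of f' "{f'}" G'] G.generate_singleton[OF f(1)] by auto
  show "(f, f') \<in> E" by (rule order_4_lift[OF f(1,2) ff j i])
  have B: "subgroup B G" "cyclic_group (G\<lparr>carrier := B\<rparr>)" "subgroup B' G'" "cyclic_group (G'\<lparr>carrier := B'\<rparr>)"
    using s by (simp_all add: action_split_def)
  show "\<exists>b b'. b \<in> B \<and> b' \<in> B' \<and> generate G {b} = B \<and> generate G' {b'} = B' \<and> (b, b') \<in> E"
    by (rule cyclic_pair[OF B l(1,3)])
qed

lemma iso_type_IV:
  assumes t: "type_IV_structure G A" "type_IV_structure G' A'" and o: "order G = order G'"
  shows "G \<cong> G'"
proof -
  obtain H Q C B f where dec: "type_III_decomposition G H Q A C B" and oH: "order G = 2 * card H"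
    and f: "f \<in> carrier G" "G.ord f = 4" "f \<otimes>\<^bsub>G\<^esub> f \<in> H" "\<forall>g\<in>carrier G. \<exists>h\<in>H. g = h \<or> g = h \<otimes>\<^bsub>G\<^esub> f"
      "\<forall>q\<in>Q. conj_by G f q \<in> Q" "\<forall>c\<in>C. conj_by G f c = inv\<^bsub>G\<^esub> c" "\<forall>b\<in>B. conj_by G f b = b"
    by (rule G.type_IV_E[OF t(1)])
  obtain H' Q' C' B' f' where dec': "type_III_decomposition G' H' Q' A' C' B'" and oH': "order G' = 2 * card H'"
    and f': "f' \<in> carrier G'" "G'.ord f' = 4" "f' \<otimes>\<^bsub>G'\<^esub> f' \<in> H'"
      "\<forall>g\<in>carrier G'. \<exists>h\<in>H'. g = h \<or> g = h \<otimes>\<^bsub>G'\<^esub> f'"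
      "\<forall>q\<in>Q'. conj_by G' f' q \<in> Q'" "\<forall>c\<in>C'. conj_by G' f' c = inv\<^bsub>G'\<^esub> c" "\<forall>b\<in>B'. conj_by G' f' b = b"
    by (rule G'.type_IV_E[OF t(2)])
  note D = G.type_III_D[OF dec] and D' = G'.type_III_D[OF dec']
  have oc: "card H = card H'" using o oH oH' by simp
  note cd = type_III_card[OF dec dec' oc]
  note s = G.type_IV_split[OF dec A f(1,2,7,6,4)] and s' = G'.type_IV_split[OF dec' A' f'(1,2,7,6,4)]
  \<comment> \<open>Any generators of \<open>C\<close> and \<open>C'\<close> will do: they
    centralize A and A' and so form a pair in \<open>E\<close>.\<close>
  obtain c where c: "c \<in> C" "c \<in> carrier G" "generate G {c} = C" by (rule G.cyclic_subgroupE[OF D(4,12)])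
  obtain c' where c': "c' \<in> C'" "c' \<in> carrier G'" "generate G' {c'} = C'" by (rule G'.cyclic_subgroupE[OF D'(4,12)])
  have cE: "(c, c') \<in> E" by (rule E_kernel[OF c(2) c'(2) s(2)[OF c(1)] s'(2)[OF c'(1)]])
  obtain x y where q: "quat_gens G Q 3 x y" "conj_by G c x = y" "conj_by G c y = x \<otimes>\<^bsub>G\<^esub> y"
      "conj_by G f x = inv\<^bsub>G\<^esub> x" "conj_by G f y = inv\<^bsub>G\<^esub> (x \<otimes>\<^bsub>G\<^esub> y)" "f \<otimes>\<^bsub>G\<^esub> f = x \<otimes>\<^bsub>G\<^esub> x"
    using G.type_IV_quat[OF dec c(1,3) f(1-3,5) bspec[OF f(6) c(1)]] by blast
  obtain x' y' where q': "quat_gens G' Q' 3 x' y'" "conj_by G' c' x' = y'" "conj_by G' c' y' = x' \<otimes>\<^bsub>G'\<^esub> y'"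
      "conj_by G' f' x' = inv\<^bsub>G'\<^esub> x'" "conj_by G' f' y' = inv\<^bsub>G'\<^esub> (x' \<otimes>\<^bsub>G'\<^esub> y')" "f' \<otimes>\<^bsub>G'\<^esub> f' = x' \<otimes>\<^bsub>G'\<^esub> x'"
    using G'.type_IV_quat[OF dec' c'(1,3) f'(1-3,5) bspec[OF f'(6) c'(1)]] by blast
  have ff: "conj_by G (f \<otimes>\<^bsub>G\<^esub> f) a = a"
    unfolding q(6) using D(19)[OF G.q8_center(1)[OF q(1)] a_mem(1)] G.q8_center(2)[OF q(1)] A(2)
    by (simp add: G.conj_by_eq_self_iff)
  have ff': "conj_by G' (f' \<otimes>\<^bsub>G'\<^esub> f') a' = a'"
    unfolding q'(6) using D'(19)[OF G'.q8_center(1)[OF q'(1)] a_mem(2)] G'.q8_center(2)[OF q'(1)] A'(2)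
    by (simp add: G'.conj_by_eq_self_iff)
  note fE = order_4_pair[OF s(1) s'(1) cd(1) f(1) f'(1) f(2) f'(2) ff ff']
  obtain b b' where b: "b \<in> B" "b' \<in> B'" "generate G {b} = B" "generate G' {b'} = B'" "(b, b') \<in> E"
    using fE(2) by blast
  let ?X = "{(c, c'), (b, b'), (y, y'), (x, x'), (a, a')}"
  have bd: "bounded_pairs ?X (card H)"
    by (rule bounded_type_III[OF dec dec' oc q(1-3) q'(1-3) b(1,2,5) c(1) c'(1) cE])
  have XC: "?X \<subseteq> carrier P" using bd by (simp add: bounded_pairs_def)
  have m: "(x, x') \<in> generate P ?X" "(y, y') \<in> generate P ?X" "(b, b') \<in> generate P ?X" "(c, c') \<in> generate P ?X"
    by (intro generate_pair_intros(1); simp)+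
  \<comment> \<open>The two components act on every earlier pair by the same formulas, and the
    squares of f and f' are the corresponding central involutions, so the subgroup at most
    doubles.\<close>
  have "bounded_pairs (insert (f, f') ?X) (2 * card H)"
  proof (rule bounded_insert[OF bd f(1) f'(1)])
    show "\<forall>p\<in>?X. (conj_by G f (fst p), conj_by G' f' (snd p)) \<in> generate P ?X"
      using conj_pair_aE[OF fE(1)] bspec[OF f(6) c(1)] bspec[OF f'(6) c'(1)] bspec[OF f(7) b(1)] bspec[OF f'(7) b(2)] q(4,5) q'(4,5)
        generate_pair_inv[OF XC m(1)] generate_pair_inv[OF XC generate_pair_intros(3)[OF m(1,2)]]
        generate_pair_inv[OF XC m(4)] m(3) by simp
    show "(f [^]\<^bsub>G\<^esub> (2::nat), f' [^]\<^bsub>G'\<^esub> (2::nat)) \<in> generate P ?X"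
      using generate_pair_intros(3)[OF m(1,1)] q(6) q'(6) f(1) f'(1) by (simp add: numeral_2_eq_2)
  qed simp
  then have bd': "bounded_pairs (insert (f, f') ?X) (order G)" using oH by simp
  show ?thesis
  proof (rule iso_of_pairs[OF bd' o])
    have "H \<subseteq> generate G (fst ` insert (f, f') ?X)"
      by (rule G.type_III_generate[OF dec q(1) A(3) b(3) c(3)]) auto
    moreover have "f \<in> generate G (fst ` insert (f, f') ?X)" by (intro generate.incl) simp
    ultimately show "carrier G \<subseteq> generate G (fst ` insert (f, f') ?X)" using f(4) by (blast intro: generate.eng)
    have "H' \<subseteq> generate G' (snd ` insert (f, f') ?X)"
      by (rule G'.type_III_generate[OF dec' q'(1) A'(3) b(4) c'(3)]) auto
    moreover have "f' \<in> generate G' (snd ` insert (f, f') ?X)" by (intro generate.incl) simp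
    ultimately show "carrier G' \<subseteq> generate G' (snd ` insert (f, f') ?X)" using f'(4) by (blast intro: generate.eng)
  qed
qed

text \<open>R is the graph of the isomorphism from Q to Q' determined by F and F'. Being a subgroup
  with as many elements as Q, it serves as a starting block of pairs that generates nothing beyond
  itself.\<close>

lemma iso_graph:
  assumes Q: "subgroup Q G" "card Q = 120" "F \<in> iso (G\<lparr>carrier := Q\<rparr>) S"
    and Q': "subgroup Q' G'" "F' \<in> iso (G'\<lparr>carrier := Q'\<rparr>) S"
    and R: "R = {(r, r'). r \<in> Q \<and> r' \<in> Q' \<and> F r = F' r'}"
  shows "bounded_pairs R 120" "generate P R = R" "fst ` R = Q" "snd ` R = Q'"
proof -
  have hom: "F \<in> hom (G\<lparr>carrier := Q\<rparr>) S" "F' \<in> hom (G'\<lparr>carrier := Q'\<rparr>) S"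
    and bij: "bij_betw F Q (carrier S)" "bij_betw F' Q' (carrier S)"
    using Q(3) Q'(2) by (simp_all add: iso_def)
  have mult: "F (r \<otimes>\<^bsub>G\<^esub> s) = F r \<otimes>\<^bsub>S\<^esub> F s" if "r \<in> Q" "s \<in> Q" for r s using hom_mult[OF hom(1), of r s] that by simp
  have mult': "F' (r \<otimes>\<^bsub>G'\<^esub> s) = F' r \<otimes>\<^bsub>S\<^esub> F' s" if "r \<in> Q'" "s \<in> Q'" for r s using hom_mult[OF hom(2), of r s] that by simp
  have RC: "R \<subseteq> carrier P"
    using R G.subgroup_mem_carrier[OF Q(1)] G'.subgroup_mem_carrier[OF Q'(1)] by auto
  \<comment> \<open>The element of Q' that corresponds to the identity of G is idempotent, hence the
    identity.\<close>
  have one: "F \<one>\<^bsub>G\<^esub> = F' \<one>\<^bsub>G'\<^esub>"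
  proof -
    obtain r' where r': "r' \<in> Q'" "F' r' = F \<one>\<^bsub>G\<^esub>"
      using bij subgroup.one_closed[OF Q(1)] by (metis bij_betw_iff_bijections)
    have "F' (r' \<otimes>\<^bsub>G'\<^esub> r') = F' r'"
      using mult[of "\<one>\<^bsub>G\<^esub>" "\<one>\<^bsub>G\<^esub>"] mult'[OF r'(1,1)] r'(2) subgroup.one_closed[OF Q(1)] by simp
    then have "r' \<otimes>\<^bsub>G'\<^esub> r' = r'" using bij(2) r'(1) subgroup.m_closed[OF Q'(1)] by (metis bij_betw_def inj_onD)
    then have "r' = \<one>\<^bsub>G'\<^esub>" using G'.subgroup_mem_carrier[OF Q'(1) r'(1)] by simp
    then show ?thesis using r'(2) by simp
  qed
  have "subgroup R P"
  proof (rule P.finite_subgroupI[OF RC])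
    show "\<one>\<^bsub>P\<^esub> \<in> R" using one subgroup.one_closed[OF Q(1)] subgroup.one_closed[OF Q'(1)] by (simp add: R)
    show "p \<otimes>\<^bsub>P\<^esub> p' \<in> R" if "p \<in> R" "p' \<in> R" for p p'
      using that mult mult' subgroup.m_closed[OF Q(1)] subgroup.m_closed[OF Q'(1)] by (auto simp: R)
  qed
  then have "generate P R \<subseteq> R" using P.generate_subgroup_incl[of R R] by simp
  then show gen: "generate P R = R" by (auto intro: generate.incl)
  show "fst ` R = Q" using bij by (force simp: R bij_betw_iff_bijections)
  show "snd ` R = Q'"
  proof
    show "snd ` R \<subseteq> Q'" by (auto simp: R)
    show "Q' \<subseteq> snd ` R"
    proof
      fix r' assume r': "r' \<in> Q'"
      then have "F' r' \<in> F ` Q" using bij by (auto simp: bij_betw_def)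
      then obtain r where "r \<in> Q" "F r = F' r'" by auto
      then have "(r, r') \<in> R" using r' by (simp add: R)
      then show "r' \<in> snd ` R" by force
    qed
  qed
  have "inj_on fst R" using bij(2) by (auto simp: R inj_on_def bij_betw_def)
  then have "card R = 120" using card_image \<open>fst ` R = Q\<close> Q(2) by metis
  then show "bounded_pairs R 120" using RC gen by (simp add: bounded_pairs_def)
qed

text \<open>A and B centralize Q, so both new pairs fix every element of R; the action of (b, b') on
  (a, a') is governed by \<open>E\<close>.\<close>

lemma bounded_type_V:
  assumes dec: "type_V_decomposition G H Q A B" and dec': "type_V_decomposition G' H' Q' A' B'"
    and o: "card B = card B'"
    and F: "F \<in> iso (G\<lparr>carrier := Q\<rparr>) S" "F' \<in> iso (G'\<lparr>carrier := Q'\<rparr>) S"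
    and R: "R = {(r, r'). r \<in> Q \<and> r' \<in> Q' \<and> F r = F' r'}"
    and b: "b \<in> B" "b' \<in> B'" "(b, b') \<in> E"
  shows "bounded_pairs (insert (b, b') (insert (a, a') R)) (card H)"
proof -
  note D = G.type_V_D[OF dec] and D' = G'.type_V_D[OF dec']
  note ab = G.AB_conditionsD[OF D(1)] and ab' = G'.AB_conditionsD[OF D'(1)]
  note g = iso_graph[OF D(3,8) F(1) D'(3) F(2) R]
  have Qa: "conj_by G a q = q" "conj_by G b q = q" if "q \<in> Q" for q
    using D(14)[OF that a_mem(1)] D(15)[OF that b(1)] G.subgroup_mem_carrier[OF D(3) that] A(2) E_carrier(1)[OF b(3)]
    by (simp_all add: G.conj_by_eq_self_iff)
  have Qa': "conj_by G' a' q = q" "conj_by G' b' q = q" if "q \<in> Q'" for q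
    using D'(14)[OF that a_mem(2)] D'(15)[OF that b(2)] G'.subgroup_mem_carrier[OF D'(3) that] A'(2) E_carrier(2)[OF b(3)]
    by (simp_all add: G'.conj_by_eq_self_iff)
  have 1: "bounded_pairs (insert (a, a') R) (card A * 120)"
  proof (rule bounded_insert_subgroup[OF g(1) ab(1) a_mem(1) ab'(1) a_mem(2) card_A])
    show "\<forall>p\<in>R. (conj_by G a (fst p), conj_by G' a' (snd p)) \<in> generate P R"
      unfolding g(2) using Qa(1) Qa'(1) by (auto simp: R)
  qed
  have "bounded_pairs (insert (b, b') (insert (a, a') R)) (card B * (card A * 120))"
  proof (rule bounded_insert_subgroup[OF 1 ab(2) b(1) ab'(2) b(2) o], rule ballI)
    fix p assume p: "p \<in> insert (a, a') R"
    show "(conj_by G b (fst p), conj_by G' b' (snd p)) \<in> generate P (insert (a, a') R)"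
    proof (cases "p = (a, a')")
      case True
      then show ?thesis using conj_pair_aE[OF b(3), of "insert (a, a') R"] by simp
    next
      case False
      then have "p \<in> R" using p by simp
      then have "(conj_by G b (fst p), conj_by G' b' (snd p)) = p" using Qa(2) Qa'(2) by (auto simp: R)
      then show ?thesis using p by (simp add: generate.incl)
    qed
  qed
  then show ?thesis using D(7) by (simp add: mult_ac)
qed

text \<open>Q is a direct factor, so arbitrary isomorphisms F and F' onto SL_2(F_5) can be
  combined.\<close>

lemma iso_type_V:
  assumes dec: "type_V_decomposition G (carrier G) Q A B" and dec': "type_V_decomposition G' (carrier G') Q' A' B'"
    and o: "order G = order G'"
  shows "G \<cong> G'"
proof -
  note D = G.type_V_D[OF dec] and D' = G'.type_V_D[OF dec']
  note ab = G.AB_conditionsD[OF D(1)] and ab' = G'.AB_conditionsD[OF D'(1)]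
  have c: "card B = card B'"
    using o D(7) D'(7) card_A G.card_subgroup_pos[OF ab(1)] by (simp add: order_def)
  have t: "card {\<one>\<^bsub>G\<^esub>} = card {\<one>\<^bsub>G'\<^esub>}" by simp
  note s = G.type_V_split[OF dec A(1)] and s' = G'.type_V_split[OF dec' A'(1)]
  obtain b b' where b: "b \<in> B" "b' \<in> B'" "generate G {b} = B" "generate G' {b'} = B'" "(b, b') \<in> E"
    using cyclic_pair[OF ab(2,4) ab'(2,4) split_lift(1)[OF s s' c t] split_lift'(1)[OF s s' c t]] by blast
  obtain F F' where F: "F \<in> iso (G\<lparr>carrier := Q\<rparr>) SL2_F5" "F' \<in> iso (G'\<lparr>carrier := Q'\<rparr>) SL2_F5"
    using D(9) D'(9) by (auto simp: is_iso_def)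
  define R where "R = {(r, r'). r \<in> Q \<and> r' \<in> Q' \<and> F r = F' r'}"
  note g = iso_graph[OF D(3,8) F(1) D'(3) F(2) R_def]
  have bd: "bounded_pairs (insert (b, b') (insert (a, a') R)) (order G)"
    using bounded_type_V[OF dec dec' c F R_def b(1,2,5)] by (simp add: order_def)
  show ?thesis
    by (rule iso_of_pairs[OF bd o G.type_V_generate[OF dec A(3) b(3)] G'.type_V_generate[OF dec' A'(3) b(4)]])
      (use g(3,4) in auto)
qed

text \<open>In the coordinates F and F' the elements f and f' induce the same automorphism of
  SL_2(F_5), since it is prescribed on two generators. So the graph R is stable under (f, f'), and
  the squares of f and f' correspond because both become -I.\<close>

lemma iso_type_VI:
  assumes t: "type_VI_structure G A" "type_VI_structure G' A'" and o: "order G = order G'"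
  shows "G \<cong> G'"
proof -
  obtain H Q B f where dec: "type_V_decomposition G H Q A B" and oH: "order G = 2 * card H"
    and f: "f \<in> carrier G" "G.ord f = 4" "f \<otimes>\<^bsub>G\<^esub> f \<in> H" "\<forall>g\<in>carrier G. \<exists>h\<in>H. g = h \<or> g = h \<otimes>\<^bsub>G\<^esub> f"
      "\<forall>q\<in>Q. conj_by G f q \<in> Q" "\<forall>x\<in>Q. \<exists>q\<in>Q. conj_by G f q \<noteq> conj_by G x q"
      "\<forall>b\<in>B. conj_by G f b = b"
    by (rule G.type_VI_E[OF t(1)])
  obtain H' Q' B' f' where dec': "type_V_decomposition G' H' Q' A' B'" and oH': "order G' = 2 * card H'"
    and f': "f' \<in> carrier G'" "G'.ord f' = 4" "f' \<otimes>\<^bsub>G'\<^esub> f' \<in> H'"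
      "\<forall>g\<in>carrier G'. \<exists>h\<in>H'. g = h \<or> g = h \<otimes>\<^bsub>G'\<^esub> f'"
      "\<forall>q\<in>Q'. conj_by G' f' q \<in> Q'" "\<forall>x\<in>Q'. \<exists>q\<in>Q'. conj_by G' f' q \<noteq> conj_by G' x q"
      "\<forall>b\<in>B'. conj_by G' f' b = b"
    by (rule G'.type_VI_E[OF t(2)])
  note D = G.type_V_D[OF dec] and D' = G'.type_V_D[OF dec']
  note ab = G.AB_conditionsD[OF D(1)] and ab' = G'.AB_conditionsD[OF D'(1)]
  have c: "card B = card B'"
    using o oH oH' D(7) D'(7) card_A G.card_subgroup_pos[OF ab(1)] by simp
  note sq = G.type_VI_square[OF dec f(1-3)] and sq' = G'.type_VI_square[OF dec' f'(1-3)]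
  note s = G.extension_split[OF D(1) A(1) f(1,2,7) G.type_V_cofactor[OF dec] f(4)]
    and s' = G'.extension_split[OF D'(1) A'(1) f'(1,2,7) G'.type_V_cofactor[OF dec'] f'(4)]
  have ff: "conj_by G (f \<otimes>\<^bsub>G\<^esub> f) a = a"
    using D(14)[OF sq(1) a_mem(1)] G.subgroup_mem_carrier[OF D(3) sq(1)] A(2) by (simp add: G.conj_by_eq_self_iff)
  have ff': "conj_by G' (f' \<otimes>\<^bsub>G'\<^esub> f') a' = a'"
    using D'(14)[OF sq'(1) a_mem(2)] G'.subgroup_mem_carrier[OF D'(3) sq'(1)] A'(2) by (simp add: G'.conj_by_eq_self_iff)
  note fE = order_4_pair[OF s s' c f(1) f'(1) f(2) f'(2) ff ff']
  obtain b b' where b: "b \<in> B" "b' \<in> B'" "generate G {b} = B" "generate G' {b'} = B'" "(b, b') \<in> E"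
    using fE(2) by blast
  obtain F \<alpha> where F: "F \<in> iso (G\<lparr>carrier := Q\<rparr>) SL2_F5" "\<alpha> \<in> hom SL2_F5 SL2_F5"
      "\<alpha> (mat2 1 1 0 1) = mat2 1 0 2 1" "\<alpha> (mat2 1 0 2 1) = mat2 1 1 0 1" "\<forall>q\<in>Q. F (conj_by G f q) = \<alpha> (F q)"
    using G.SL2_outer_normal_form[OF D(3,9) f(1,5) sq f(6)] by blast
  obtain F' \<alpha>' where F': "F' \<in> iso (G'\<lparr>carrier := Q'\<rparr>) SL2_F5" "\<alpha>' \<in> hom SL2_F5 SL2_F5"
      "\<alpha>' (mat2 1 1 0 1) = mat2 1 0 2 1" "\<alpha>' (mat2 1 0 2 1) = mat2 1 1 0 1" "\<forall>q\<in>Q'. F' (conj_by G' f' q) = \<alpha>' (F' q)"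
    using G'.SL2_outer_normal_form[OF D'(3,9) f'(1,5) sq' f'(6)] by blast
  define R where "R = {(r, r'). r \<in> Q \<and> r' \<in> Q' \<and> F r = F' r'}"
  note g = iso_graph[OF D(3,8) F(1) D'(3) F'(1) R_def]
  have \<alpha>: "\<alpha> n = \<alpha>' n" if "n \<in> carrier SL2_F5" for n
  proof (rule hom_eq_on_generate[OF SL2.is_group SL2.is_group F(2) F'(2)])
    show "n \<in> generate SL2_F5 {mat2 1 1 0 1, mat2 1 0 2 1}" using that SL2_generate[of 2] by simp
    show "{mat2 1 1 0 1, mat2 1 0 2 1} \<subseteq> carrier SL2_F5" by simp
    show "\<And>x. x \<in> {mat2 1 1 0 1, mat2 1 0 2 1} \<Longrightarrow> \<alpha> x = \<alpha>' x" using F(3,4) F'(3,4) by auto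
  qed
  have FC: "F q \<in> carrier SL2_F5" if "q \<in> Q" for q using F(1) that by (auto simp: iso_def bij_betw_def)
  let ?X = "insert (b, b') (insert (a, a') R)"
  have bd: "bounded_pairs ?X (card H)" by (rule bounded_type_V[OF dec dec' c F(1) F'(1) R_def b(1,2,5)])
  have RX: "r \<in> generate P ?X" if "r \<in> R" for r using that by (intro generate.incl) simp
  have "bounded_pairs (insert (f, f') ?X) (2 * card H)"
  proof (rule bounded_insert[OF bd f(1) f'(1)])
    show "\<forall>p\<in>?X. (conj_by G f (fst p), conj_by G' f' (snd p)) \<in> generate P ?X"
    proof
      fix p assume p: "p \<in> ?X"
      consider "p = (b, b')" | "p = (a, a')" | "p \<in> R" using p by blast
      then show "(conj_by G f (fst p), conj_by G' f' (snd p)) \<in> generate P ?X"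
      proof cases
        case 1
        then show ?thesis using bspec[OF f(7) b(1)] bspec[OF f'(7) b(2)] p by (simp add: generate.incl)
      next
        case 2
        then show ?thesis using conj_pair_aE[OF fE(1), of ?X] by simp
      next
        case 3
        then obtain r r' where r: "p = (r, r')" "r \<in> Q" "r' \<in> Q'" "F r = F' r'" by (auto simp: R_def)
        have "F (conj_by G f r) = F' (conj_by G' f' r')"
          using F(5) F'(5) r \<alpha>[OF FC[OF r(2)]] by simp
        then have "(conj_by G f r, conj_by G' f' r') \<in> R" using bspec[OF f(5) r(2)] bspec[OF f'(5) r(3)] by (simp add: R_def)
        then show ?thesis using RX r(1) by simp
      qed
    qed
    have "F (f \<otimes>\<^bsub>G\<^esub> f) = F' (f' \<otimes>\<^bsub>G'\<^esub> f')"
      using G.SL2_iso_involution(1)[OF D(3) F(1) sq] G'.SL2_iso_involution(1)[OF D'(3) F'(1) sq'] by simp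
    then have "(f \<otimes>\<^bsub>G\<^esub> f, f' \<otimes>\<^bsub>G'\<^esub> f') \<in> R" using sq(1) sq'(1) by (simp add: R_def)
    then show "(f [^]\<^bsub>G\<^esub> (2::nat), f' [^]\<^bsub>G'\<^esub> (2::nat)) \<in> generate P ?X"
      using RX f(1) f'(1) by (simp add: numeral_2_eq_2)
  qed simp
  then have bd': "bounded_pairs (insert (f, f') ?X) (order G)" using oH by simp
  show ?thesis
  proof (rule iso_of_pairs[OF bd' o])
    have "H \<subseteq> generate G (fst ` insert (f, f') ?X)"
      by (rule G.type_V_generate[OF dec A(3) b(3)]) (use g(3) in auto)
    moreover have "f \<in> generate G (fst ` insert (f, f') ?X)" by (intro generate.incl) simp
    ultimately show "carrier G \<subseteq> generate G (fst ` insert (f, f') ?X)" using f(4) by (blast intro: generate.eng)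
    have "H' \<subseteq> generate G' (snd ` insert (f, f') ?X)"
      by (rule G'.type_V_generate[OF dec' A'(3) b(4)]) (use g(4) in auto)
    moreover have "f' \<in> generate G' (snd ` insert (f, f') ?X)" by (intro generate.incl) simp
    ultimately show "carrier G' \<subseteq> generate G' (snd ` insert (f, f') ?X)" using f'(4) by (blast intro: generate.eng)
  qed
qed

end

theorem theorem5p2:
  fixes G :: "('a, 'c) monoid_scheme" and G' :: "('b, 'd) monoid_scheme"
    and \<tau> \<tau>' :: sf_type and A :: "'a set" and A' :: "'b set"
  assumes "group G" and "finite (carrier G)"
    and "\<exists>n. acts_freely_isometrically_on_sphere G n"
    and "group G'" and "finite (carrier G')"
    and "\<exists>n. acts_freely_isometrically_on_sphere G' n"
    and "has_type G \<tau> A" and "has_type G' \<tau>' A'"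
  shows "G \<cong> G' \<longleftrightarrow>
    \<tau> = \<tau>' \<and> order G = order G' \<and> card A = card A' \<and>
    unit_image G A (carrier G) = unit_image G' A' (carrier G') \<and>
    (\<tau> = Type_II \<and> 16 dvd order G \<and> \<tau>' = Type_II \<and> 16 dvd order G' \<longrightarrow>
      unit_image G A (index2_subgroup G) = unit_image G' A' (index2_subgroup G'))"
    (is "_ \<longleftrightarrow> ?inv")
proof
  interpret G: finite_group G using assms(1,2) by (simp add: finite_group_def finite_group_axioms_def)
  interpret G': finite_group G' using assms(4,5) by (simp add: finite_group_def finite_group_axioms_def)
  note fg = G.finite_group_axioms G'.finite_group_axioms
  show "?inv" if "G \<cong> G'"
    using invariants_of_iso[OF fg that assms(7,8)] by blast
  assume inv: "?inv"
  have cA: "A \<lhd> G" "cyclic_group (G\<lparr>carrier := A\<rparr>)" "A' \<lhd> G'" "cyclic_group (G'\<lparr>carrier := A'\<rparr>)"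
    using G.has_type_invariants(2)[OF assms(7)] G'.has_type_invariants(2)[OF assms(8)]
    by (simp_all add: char_A_def)
  \<comment> \<open>Arbitrary generators may be taken: the power map belonging to a unit does not
    depend on the generator.\<close>
  obtain a where a: "a \<in> A" "a \<in> carrier G" "generate G {a} = A"
    by (rule G.cyclic_subgroupE[OF normal_imp_subgroup[OF cA(1)] cA(2)])
  obtain a' where a': "a' \<in> A'" "a' \<in> carrier G'" "generate G' {a'} = A'"
    by (rule G'.cyclic_subgroupE[OF normal_imp_subgroup[OF cA(3)] cA(4)])
  interpret action_pair G G' A A' a a'
    using fg cA a a' inv by (simp add: action_pair_def action_pair_axioms_def)
  have o: "order G = order G'" and t': "has_type G' \<tau> A'" using inv assms(8) by simp_all
  show "G \<cong> G'"
  proof (cases \<tau>)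
    case Type_I
    then show ?thesis using iso_type_I[OF _ _ o] assms(7) t' by simp
  next
    case Type_II
    then show ?thesis using iso_type_II[OF _ _ o] assms(7) t' inv by simp
  next
    case Type_III
    then show ?thesis using iso_type_III[OF _ _ o] assms(7) t' by auto
  next
    case Type_IV
    then show ?thesis using iso_type_IV[OF _ _ o] assms(7) t' by simp
  next
    case Type_V
    then show ?thesis using iso_type_V[OF _ _ o] assms(7) t' by auto
  next
    case Type_VI
    then show ?thesis using iso_type_VI[OF _ _ o] assms(7) t' by simp
  qed
qed

end
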